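(* Let $\bar\rho$ be the liquid Lane--Emden profile with adiabatic index $\gamma\in[1,2]$, central density $\bar\rho(0)>1$ and radius $R$, and let $\mathbf L$ be the associated linear operator. Suppose that either $\gamma\ge4/3$, or $\bar\rho(0)$ is close to $1$ (i.e. for each $\gamma\in[1,4/3)$ there is $\varepsilon_\gamma>0$ such that the following holds whenever $1<\bar\rho(0)<1+\varepsilon_\gamma$). Then on the set of irrotational $\boldsymbol\theta\in H=\{\boldsymbol\theta\in H^2(B_R;\mathbb R^3):(\nabla\cdot\boldsymbol\theta)|_{\partial B_R}=0\}$ with $\langle\boldsymbol\theta,\mathbf e_i\rangle_{\bar\rho}=0$ for $i=1,2,3$, one has $$\langle\mathbf L\boldsymbol\theta,\boldsymbol\theta\rangle_{\bar\rho}\not\gtrsim\|\nabla\boldsymbol\theta\|_{L^2(B_R)}^2,$$ that is, there is no constant $c>0$ such that $\langle\mathbf L\boldsymbol\theta,\boldsymbol\theta\rangle_{\bar\rho}\ge c\,\|\nabla\boldsymbol\theta\|_{L^2(B_R)}^2$ for all such $\boldsymbol\theta$.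
   Context: Liquid Lane--Emden profile: fix $\gamma\in[1,2]$ and a central density $\bar\rho(0)>1$. Let $f_0$ be the unique decreasing positive radial solution, with $f_0(0)=\bar\rho(0)$ and $f_0'(0)=0$, of $\frac{\gamma}{\gamma-1}\Delta f_0^{\gamma-1}+4\pi f_0=0$ if $\gamma>1$, and of $\Delta\ln f_0+4\pi f_0=0$ if $\gamma=1$, where $\Delta=r^{-2}\partial_r(r^2\partial_r)$. Let $R>0$ be the radius with $f_0(R)=1$, and set $\bar\rho(r)=f_0(r)\mathbf 1_{[0,R]}(r)$, $\bar\rho(\mathbf x)=\bar\rho(|\mathbf x|)$. Thus $\gamma(r^2\bar\rho^{\gamma-2}\bar\rho')'+4\pi r^2\bar\rho=0$ on $[0,R]$ and $\bar\rho(R)=1$; $\bar\rho'(R)$ is the one-sided derivative from inside. $B_R\subset\mathbb R^3$ is the ball of radius $R$ centred at the origin. Operators: $\mathcal K f(\mathbf x)=-\int_{B_R}\frac{f(\mathbf y)}{|\mathbf x-\mathbf y|}\,d\mathbf y$, $\mathcal K_\partial f(\mathbf x)=-\int_{\partial B_R}\frac{f(\mathbf y)}{|\mathbf x-\mathbf y|}\,dS(\mathbf y)$, and, for $\boldsymbol\theta\in H$, $$\mathbf L\boldsymbol\theta=-\nabla\Big((\gamma\bar\rho^{\gamma-2}+\mathcal K)\nabla\cdot(\bar\rho\boldsymbol\theta)+\int_{\partial B_R}\frac{\boldsymbol\theta(\mathbf z)}{|\mathbf x-\mathbf z|}\cdot d\mathbf S(\mathbf z)\Big)=-\nabla\Big(\big(\gamma\bar\rho^{\gamma-2}+\mathcal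 K-\bar\rho'(R)^{-1}\mathcal K_\partial\big)\nabla\cdot(\bar\rho\boldsymbol\theta)\Big).$$ Notation: $\langle\boldsymbol\theta_1,\boldsymbol\theta_2\rangle_{\bar\rho}=\int_{B_R}\bar\rho\,\boldsymbol\theta_1\cdot\boldsymbol\theta_2\,d\mathbf x$; $\mathbf e_1,\mathbf e_2,\mathbf e_3$ is the standard basis of $\mathbb R^3$. Irrotational means $\nabla\times\boldsymbol\theta=\mathbf 0$. *)

theory Defs
  imports "HOL-Analysis.Analysis"
begin

type_synonym vec3 = "real^3"
type_synonym scalar_field = "vec3 \<Rightarrow> real"
type_synonym vector_field = "vec3 \<Rightarrow> vec3"

section \<open>Smooth functions, weak derivatives and Sobolev spaces\<close>

definition partial :: "3 \<Rightarrow> scalar_field \<Rightarrow> scalar_field" where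
  "partial i f x = frechet_derivative f (at x) (axis i 1)"

primrec C_k :: "nat \<Rightarrow> scalar_field \<Rightarrow> bool" where
  "C_k 0 f \<longleftrightarrow> continuous_on UNIV f"
| "C_k (Suc k) f \<longleftrightarrow> f differentiable_on UNIV \<and> (\<forall>i. C_k k (partial i f))"

definition smooth :: "scalar_field \<Rightarrow> bool" where
  "smooth f \<longleftrightarrow> (\<forall>k. C_k k f)"

definition test_function :: "vec3 set \<Rightarrow> scalar_field \<Rightarrow> bool" where
  "test_function U \<phi> \<longleftrightarrow> smooth \<phi> \<and> compact (closure {x. \<phi> x \<noteq> 0}) \<and> closure {x. \<phi> x \<noteq> 0} \<subseteq> U"

definition locally_integrable :: "vec3 set \<Rightarrow> scalar_field \<Rightarrow> bool" where
  "locally_integrable U u \<longleftrightarrow> (\<forall>C. compact C \<and> C \<subseteq> U \<longrightarrow> u absolutely_integrable_on C)"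

definition has_weak_partial :: "vec3 set \<Rightarrow> 3 \<Rightarrow> scalar_field \<Rightarrow> scalar_field \<Rightarrow> bool" where
  "has_weak_partial U i u g \<longleftrightarrow> locally_integrable U u \<and> locally_integrable U g \<and>
     (\<forall>\<phi>. test_function U \<phi> \<longrightarrow>
        (LINT x|lebesgue_on U. u x * partial i \<phi> x) = - (LINT x|lebesgue_on U. g x * \<phi> x))"

text \<open>A representative of the weak derivative, which is determined only almost everywhere;
  it is used only where a weak derivative exists, and inside integrals over \<open>U\<close> or in
  conditions that do not depend on the representative.\<close>

definition weak_partial :: "vec3 set \<Rightarrow> 3 \<Rightarrow> scalar_field \<Rightarrow> scalar_field" where
  "weak_partial U i u = (SOME g. has_weak_partial U i u g)"

definition weak_grad :: "vec3 set \<Rightarrow> scalar_field \<Rightarrow> vector_field" where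
  "weak_grad U u x = (\<chi> i. weak_partial U i u x)"

definition weak_div :: "vec3 set \<Rightarrow> vector_field \<Rightarrow> scalar_field" where
  "weak_div U \<theta> x = (\<Sum>i\<in>UNIV. weak_partial U i (\<lambda>y. \<theta> y $ i) x)"

definition weak_curl :: "vec3 set \<Rightarrow> vector_field \<Rightarrow> vector_field" where
  "weak_curl U \<theta> x = (let D = (\<lambda>i j. weak_partial U i (\<lambda>y. \<theta> y $ j) x) in
     vector [D 2 3 - D 3 2, D 3 1 - D 1 3, D 1 2 - D 2 1])"

definition L2_on :: "vec3 set \<Rightarrow> scalar_field \<Rightarrow> bool" where
  "L2_on U u \<longleftrightarrow> u \<in> borel_measurable (lebesgue_on U) \<and> integrable (lebesgue_on U) (\<lambda>x. (u x)\<^sup>2)"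

primrec sobolev_H :: "nat \<Rightarrow> vec3 set \<Rightarrow> scalar_field \<Rightarrow> bool" where
  "sobolev_H 0 U u \<longleftrightarrow> L2_on U u"
| "sobolev_H (Suc k) U u \<longleftrightarrow> L2_on U u \<and> (\<forall>i. \<exists>g. has_weak_partial U i u g \<and> sobolev_H k U g)"

definition grad_norm_sq :: "vec3 set \<Rightarrow> vector_field \<Rightarrow> real" where
  "grad_norm_sq U \<theta> =
     (\<Sum>i\<in>UNIV. \<Sum>j\<in>UNIV. LINT x|lebesgue_on U. (weak_partial U i (\<lambda>y. \<theta> y $ j) x)\<^sup>2)"

section \<open>Surface measure and traces on the sphere\<close>

text \<open>The surface area of a subset \<open>A\<close> of the sphere of radius \<open>R\<close> is \<open>3 / R\<close> times the volume
  of the cone over \<open>A\<close> with apex at the origin.\<close>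

definition sphere_measure :: "real \<Rightarrow> vec3 measure" where
  "sphere_measure R =
     scale_measure (ennreal (3 / R)) (distr (lebesgue_on (ball 0 R)) borel (\<lambda>x. (R / norm x) *\<^sub>R x))"

text \<open>\<open>g\<close> is the boundary trace of \<open>u\<close>, a function in \<open>H\<^sup>1\<close> of the ball of radius \<open>R\<close>:
  the trace operator is the continuous extension, from \<open>H\<^sup>1\<close> to \<open>L\<^sup>2\<close> of the sphere, of the
  restriction of functions smooth up to the boundary.\<close>

definition has_trace :: "real \<Rightarrow> scalar_field \<Rightarrow> scalar_field \<Rightarrow> bool" where
  "has_trace R u g \<longleftrightarrow>
     sobolev_H 1 (ball 0 R) u \<and>
     g \<in> borel_measurable borel \<and> integrable (sphere_measure R) (\<lambda>z. (g z)\<^sup>2) \<and>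
     (\<exists>w. (\<forall>n. smooth (w n)) \<and>
        (\<lambda>n. LINT x|lebesgue_on (ball 0 R). (w n x - u x)\<^sup>2) \<longlonglongrightarrow> 0 \<and>
        (\<forall>i. (\<lambda>n. LINT x|lebesgue_on (ball 0 R).
                 (partial i (w n) x - weak_partial (ball 0 R) i u x)\<^sup>2) \<longlonglongrightarrow> 0) \<and>
        (\<lambda>n. LINT z|sphere_measure R. (w n z - g z)\<^sup>2) \<longlonglongrightarrow> 0)"

definition trace_on_sphere :: "real \<Rightarrow> scalar_field \<Rightarrow> scalar_field" where
  "trace_on_sphere R u = (SOME g. has_trace R u g)"

section \<open>Liquid Lane--Emden profiles\<close>

definition radial_laplacian :: "(real \<Rightarrow> real) \<Rightarrow> real \<Rightarrow> real" where
  "radial_laplacian w r = deriv (\<lambda>s. s\<^sup>2 * deriv w s) r / r\<^sup>2"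

definition enthalpy :: "real \<Rightarrow> (real \<Rightarrow> real) \<Rightarrow> real \<Rightarrow> real" where
  "enthalpy \<gamma> f r = (if \<gamma> = 1 then ln (f r) else \<gamma> / (\<gamma> - 1) * f r powr (\<gamma> - 1))"

text \<open>\<open>f\<close> is the positive decreasing solution on \<open>[0, S)\<close>, an interval on which it stays positive;
  values of \<open>f\<close> outside this interval are irrelevant.\<close>

definition lane_emden_solution :: "real \<Rightarrow> real \<Rightarrow> real \<Rightarrow> (real \<Rightarrow> real) \<Rightarrow> bool" where
  "lane_emden_solution \<gamma> \<rho>\<^sub>0 S f \<longleftrightarrow>
     f 0 = \<rho>\<^sub>0 \<and> (f has_real_derivative 0) (at 0 within {0..}) \<and>
     (\<forall>r\<in>{0..<S}. f r > 0) \<and> strict_antimono_on {0..<S} f \<and>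
     (\<forall>r\<in>{0<..<S}. f differentiable (at r) \<and>
        (\<lambda>s. s\<^sup>2 * deriv (enthalpy \<gamma> f) s) differentiable (at r) \<and>
        radial_laplacian (enthalpy \<gamma> f) r + 4 * pi * f r = 0)"

definition liquid_lane_emden :: "real \<Rightarrow> real \<Rightarrow> real \<Rightarrow> (real \<Rightarrow> real) \<Rightarrow> bool" where
  "liquid_lane_emden \<gamma> \<rho>\<^sub>0 R \<rho> \<longleftrightarrow> R > 0 \<and>
     (\<exists>f S. R < S \<and> lane_emden_solution \<gamma> \<rho>\<^sub>0 S f \<and> f R = 1 \<and>
            \<rho> = (\<lambda>r. f r * indicator {0..R} r))"

section \<open>The linearised operator\<close>

definition weighted_inner :: "real \<Rightarrow> (real \<Rightarrow> real) \<Rightarrow> vector_field \<Rightarrow> vector_field \<Rightarrow> real" where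
  "weighted_inner R \<rho> \<theta> \<eta> = (LINT x|lebesgue_on (ball 0 R). \<rho> (norm x) * (\<theta> x \<bullet> \<eta> x))"

definition newton_K :: "real \<Rightarrow> scalar_field \<Rightarrow> scalar_field" where
  "newton_K R f x = - (LINT y|lebesgue_on (ball 0 R). f y / norm (x - y))"

text \<open>The integral of \<open>\<theta>(z) / |x - z|\<close> against the vector surface element, where \<open>z / R\<close> is the
  outward unit normal at \<open>z\<close>.\<close>

definition surface_potential :: "real \<Rightarrow> vector_field \<Rightarrow> scalar_field" where
  "surface_potential R \<theta> x =
     (LINT z|sphere_measure R.
        ((\<chi> i. trace_on_sphere R (\<lambda>y. \<theta> y $ i) z) \<bullet> (z /\<^sub>R R)) / norm (x - z))"

definition lin_op :: "real \<Rightarrow> real \<Rightarrow> (real \<Rightarrow> real) \<Rightarrow> vector_field \<Rightarrow> vector_field" where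
  "lin_op \<gamma> R \<rho> \<theta> x =
     (let d = weak_div (ball 0 R) (\<lambda>y. \<rho> (norm y) *\<^sub>R \<theta> y) in
      - weak_grad (ball 0 R)
          (\<lambda>y. \<gamma> * \<rho> (norm y) powr (\<gamma> - 2) * d y + newton_K R d y + surface_potential R \<theta> y) x)"

definition H_space :: "real \<Rightarrow> vector_field set" where
  "H_space R = {\<theta>. (\<forall>j. sobolev_H 2 (ball 0 R) (\<lambda>x. \<theta> x $ j)) \<and>
                    has_trace R (weak_div (ball 0 R) \<theta>) (\<lambda>_. 0)}"

definition irrotational :: "real \<Rightarrow> vector_field \<Rightarrow> bool" where
  "irrotational R \<theta> \<longleftrightarrow> (AE x in lebesgue_on (ball 0 R). weak_curl (ball 0 R) \<theta> x = 0)"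

definition admissible :: "real \<Rightarrow> (real \<Rightarrow> real) \<Rightarrow> vector_field set" where
  "admissible R \<rho> = {\<theta> \<in> H_space R. irrotational R \<theta> \<and>
                         (\<forall>i. weighted_inner R \<rho> \<theta> (\<lambda>_. axis i 1) = 0)}"

definition coercive :: "real \<Rightarrow> real \<Rightarrow> (real \<Rightarrow> real) \<Rightarrow> bool" where
  "coercive \<gamma> R \<rho> \<longleftrightarrow>
     (\<exists>c>0. \<forall>\<theta>\<in>admissible R \<rho>.
        weighted_inner R \<rho> (lin_op \<gamma> R \<rho> \<theta>) \<theta> \<ge> c * grad_norm_sq (ball 0 R) \<theta>)"

end

theory Submission
  imports Defs "HOL-Computational_Algebra.Polynomial" "HOL-Real_Asymp.Real_Asymp"
begin

text \<open>Coercivity fails along the gradients of the harmonic polynomials \<open>Re z ^ (m + 1)\<close>, \<open>z = x\<^sub>1 + i x\<^sub>2\<close>, as \<open>m\<close> tends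
  to infinity. Up to a constant factor such a gradient is \<open>\<theta> = (Re z ^ m, - Im z ^ m, 0)\<close>. It is smooth, curl free and
  divergence free, so it satisfies the boundary condition, and for odd \<open>m\<close> it is odd, so it is orthogonal
  to constant fields. The form \<open>\<langle>L \<theta>, \<theta>\<rangle>\<close> sees \<open>\<theta>\<close> only through \<open>\<nabla>\<cdot>(\<rho> \<theta>) = \<rho>' \<theta> \<cdot> x / \<bar>x\<bar>\<close> and the normal component on the
  sphere, neither of which involves a derivative of \<open>\<theta>\<close>, whereas \<open>\<nabla> \<theta>\<close> is larger than \<open>\<theta>\<close> by a factor \<open>m\<close>.

  In numbers, let \<open>I\<close> be the integral of \<open>\<bar>z\<bar> ^ (2 m - 2)\<close> over the ball. Then the square norm of \<open>\<nabla> \<theta>\<close> is exactly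
  \<open>2 m\<^sup>2 I\<close> (\<open>grad_norm_sq_harm_grad\<close>). Integrating the Lane--Emden equation once gives
  \<open>\<gamma> \<rho> ^ (\<gamma> - 2) \<rho>' = - 4 \<pi> r M(r)\<close> with a bounded mean density \<open>M\<close> (\<open>liquid_lane_emden_profile\<close>), so the local part of the
  operator is the gradient of \<open>4 \<pi> M(\<bar>x\<bar>) Re z ^ (m + 1)\<close>, and it contributes at most a multiple of \<open>m I\<close>. The
  gravitational parts are gradients of potentials of measures with densities of size \<open>R ^ m\<close>; as
  \<open>1 / \<bar>x - y\<bar>\<^sup>2\<close> is integrable in \<open>x\<close> uniformly in \<open>y\<close>, they contribute at most a multiple of \<open>R ^ (2 m)\<close>
  (\<open>potential_has_weak_partial\<close>, \<open>harm_grad_form_bound\<close>). On the other hand \<open>m\<^sup>2 I\<close> is at least a multiple of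
  \<open>R ^ (2 m) \<surd>m\<close>, because of a thin shell along the equator (\<open>planar_moment_lower_bound\<close>). So the form is
  \<open>o(m\<^sup>2 I)\<close>.

  Weak derivatives and traces enter through arbitrarily chosen representatives. These are identified
  almost everywhere by testing against bump functions that increase to the indicator functions of boxes
  (\<open>has_weak_partial_unique\<close>) and by the trace inequality for smooth functions (\<open>smooth_trace_unique\<close>).\<close>

section \<open>Smooth functions and bump functions\<close>

lemma partial_eq: "(f has_derivative D) (at x) \<Longrightarrow> partial i f x = D (axis i 1)"
  unfolding partial_def by (metis frechet_derivative_at)

lemma C_k_imp_continuous: "C_k k f \<Longrightarrow> continuous_on UNIV f"
  by (cases k) (auto simp: differentiable_imp_continuous_on)

lemma C_k_Suc_D: "C_k (Suc k) f \<Longrightarrow> C_k k f"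
proof (induction k arbitrary: f)
  case 0
  then show ?case by (auto simp: differentiable_imp_continuous_on)
next
  case (Suc k)
  then show ?case by (metis C_k.simps(2))
qed

lemma partial_const [simp]: "partial i (\<lambda>x. c) = (\<lambda>x. 0)"
  by (rule ext, subst partial_eq[where D="\<lambda>_. 0"]) auto

lemma partial_add:
  "f differentiable (at x) \<Longrightarrow> g differentiable (at x) \<Longrightarrow>
   partial i (\<lambda>x. f x + g x) x = partial i f x + partial i g x"
  unfolding partial_def frechet_derivative_works
  by (subst partial_eq[unfolded partial_def, OF has_derivative_add]) auto

lemma partial_mult:
  "f differentiable (at x) \<Longrightarrow> g differentiable (at x) \<Longrightarrow>
   partial i (\<lambda>x. f x * g x) x = f x * partial i g x + partial i f x * g x"
  unfolding partial_def frechet_derivative_works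
  by (subst partial_eq[unfolded partial_def, OF has_derivative_mult]) auto

lemma C_k_const: "C_k k (\<lambda>x. c)"
  by (induction k arbitrary: c) auto

lemma C_k_add: "C_k k f \<Longrightarrow> C_k k g \<Longrightarrow> C_k k (\<lambda>x. f x + g x)"
proof (induction k arbitrary: f g)
  case (Suc k)
  then have d: "f differentiable (at x)" "g differentiable (at x)" for x
    by (auto simp: differentiable_on_def)
  have "partial i (\<lambda>x. f x + g x) = (\<lambda>x. partial i f x + partial i g x)" for i
    using partial_add[OF d] by auto
  with Suc show ?case by (auto simp: differentiable_on_add)
qed (auto intro: continuous_on_add)

lemma C_k_mult: "C_k k f \<Longrightarrow> C_k k g \<Longrightarrow> C_k k (\<lambda>x. f x * g x)"
proof (induction k arbitrary: f g)
  case (Suc k)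
  then have d: "f differentiable (at x)" "g differentiable (at x)" for x
    by (auto simp: differentiable_on_def)
  have "partial i (\<lambda>x. f x * g x) = (\<lambda>x. f x * partial i g x + partial i f x * g x)" for i
    using partial_mult[OF d] by auto
  moreover have "C_k k (\<lambda>x. f x * partial i g x + partial i f x * g x)" for i
    using Suc.prems by (intro C_k_add Suc.IH) (auto dest: C_k_Suc_D simp del: C_k.simps, auto)
  ultimately show ?case using Suc.prems by (auto simp: differentiable_on_mult)
qed (auto intro: continuous_on_mult)

lemma partial_coord: "partial i (\<lambda>x. x $ j) = (\<lambda>x. if i = j then 1 else 0)"
proof
  fix x :: vec3
  have "((\<lambda>x::vec3. x $ j) has_derivative (\<lambda>h. h $ j)) (at x)"
    by (simp add: bounded_linear_imp_has_derivative bounded_linear_vec_nth)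
  from partial_eq[OF this] show "partial i (\<lambda>x. x $ j) x = (if i = j then 1 else 0)"
    by (auto simp: axis_def)
qed

lemma differentiable_coord: "(\<lambda>x::vec3. x $ j) differentiable (at x)"
  by (simp add: bounded_linear_imp_differentiable bounded_linear_vec_nth)

lemma C_k_coord: "C_k k (\<lambda>x. x $ j)"
  by (cases k) (auto simp: partial_coord C_k_const differentiable_on_def
      differentiable_coord intro!: continuous_intros differentiable_at_withinI)

lemma smooth_const: "smooth (\<lambda>x. c)"
  and smooth_add: "smooth f \<Longrightarrow> smooth g \<Longrightarrow> smooth (\<lambda>x. f x + g x)"
  and smooth_mult: "smooth f \<Longrightarrow> smooth g \<Longrightarrow> smooth (\<lambda>x. f x * g x)"
  and smooth_coord: "smooth (\<lambda>x. x $ j)"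
  by (auto simp: smooth_def C_k_const C_k_add C_k_mult C_k_coord)

lemma smooth_minus: "smooth f \<Longrightarrow> smooth (\<lambda>x. - f x)"
  using smooth_mult[OF smooth_const[of "-1"]] by simp

lemma smooth_diff: "smooth f \<Longrightarrow> smooth g \<Longrightarrow> smooth (\<lambda>x. f x - g x)"
  using smooth_add[OF _ smooth_minus] by simp

lemma smooth_prod: "(\<And>i. i \<in> I \<Longrightarrow> smooth (f i)) \<Longrightarrow> smooth (\<lambda>x. \<Prod>i\<in>I. f i x)"
  by (induction I rule: infinite_finite_induct) (auto intro: smooth_const smooth_mult)

lemma smooth_imp_differentiable: "smooth f \<Longrightarrow> f differentiable (at x)"
  unfolding smooth_def by (metis C_k.simps(2) UNIV_I differentiable_on_def)

lemma smooth_imp_continuous: "smooth f \<Longrightarrow> continuous_on S f"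
  unfolding smooth_def using C_k_imp_continuous continuous_on_subset by blast

lemma smooth_partial: "smooth f \<Longrightarrow> smooth (partial i f)"
  unfolding smooth_def by (metis C_k.simps(2))

text \<open>The functions \<open>p(1/t) exp(-1/t)\<close>, extended by zero, for polynomials \<open>p\<close>. Carrying the polynomial
  along makes the family closed under differentiation, so that smoothness is a plain induction.\<close>

definition flat :: "real poly \<Rightarrow> real \<Rightarrow> real" where
  "flat p t = (if t > 0 then poly p (1 / t) * exp (- (1 / t)) else 0)"

lemma poly_times_exp_minus_tendsto_0:
  fixes p :: "real poly"
  shows "((\<lambda>x. poly p x * exp (- x)) \<longlongrightarrow> 0) at_top"
proof -
  have "((\<lambda>x. (\<Sum>i\<le>degree p. coeff p i * (x ^ i / exp x))) \<longlongrightarrow> (\<Sum>i\<le>degree p. coeff p i * 0)) at_top"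
    by (intro tendsto_intros tendsto_power_div_exp_0)
  moreover have "(\<lambda>x. (\<Sum>i\<le>degree p. coeff p i * (x ^ i / exp x))) = (\<lambda>x. poly p x * exp (- x))"
    by (auto simp: poly_altdef sum_distrib_right exp_minus divide_inverse mult.assoc)
  ultimately show ?thesis by simp
qed

lemma flat_tendsto_0: "(flat p \<longlongrightarrow> 0) (at 0)"
proof -
  have "((\<lambda>t. poly p (inverse t) * exp (- inverse t)) \<longlongrightarrow> 0) (at_right 0)"
    using filterlim_compose[OF poly_times_exp_minus_tendsto_0 filterlim_inverse_at_top_right] .
  then have 1: "(flat p \<longlongrightarrow> 0) (at_right 0)"
    by (rule Lim_transform_eventually)
       (auto simp: eventually_at_filter flat_def inverse_eq_divide)
  have 2: "(flat p \<longlongrightarrow> 0) (at_left 0)"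
    by (rule Lim_transform_eventually[OF tendsto_const]) (auto simp: eventually_at_filter flat_def)
  show ?thesis using 1 2 by (simp add: filterlim_at_split)
qed

lemma flat_has_derivative:
  "(flat p has_real_derivative flat ([:0, 0, 1:] * (p - pderiv p)) t) (at t)"
proof -
  consider "t > 0" | "t < 0" | "t = 0" by linarith
  then show ?thesis
  proof cases
    case 1
    have "((\<lambda>t. poly p (1 / t) * exp (- (1 / t))) has_real_derivative
           flat ([:0, 0, 1:] * (p - pderiv p)) t) (at t)"
      using 1 by (auto intro!: derivative_eq_intros DERIV_compose_FDERIV
          simp: flat_def field_simps power2_eq_square)
    then show ?thesis
      by (rule has_field_derivative_transform_within_open[where S="{0<..}"])
         (use 1 in \<open>auto simp: flat_def\<close>)
  next
    case 2
    have "((\<lambda>t. 0) has_real_derivative flat ([:0, 0, 1:] * (p - pderiv p)) t) (at t)"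
      using 2 by (auto simp: flat_def)
    then show ?thesis
      by (rule has_field_derivative_transform_within_open[where S="{..<0}"])
         (use 2 in \<open>auto simp: flat_def\<close>)
  next
    case 3
    have "((\<lambda>h. flat (pCons 0 p) h) \<longlongrightarrow> 0) (at 0)" by (rule flat_tendsto_0)
    then have "((\<lambda>h. (flat p (0 + h) - flat p 0) / h) \<longlongrightarrow> 0) (at 0)"
      by (rule Lim_transform_eventually) (auto simp: eventually_at_filter flat_def)
    then show ?thesis using 3 by (simp add: DERIV_def flat_def)
  qed
qed

lemma C_k_flat: "C_k k (\<lambda>x. a * flat p (c * x $ i + e))"
proof (induction k arbitrary: a p)
  case 0
  have "continuous_on UNIV (flat p)"
    by (meson flat_has_derivative DERIV_continuous_on has_field_derivative_at_within)
  then show ?case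
    by (auto intro!: continuous_intros continuous_on_compose2[where g="flat p" and t=UNIV])
next
  case (Suc k)
  have D: "((\<lambda>x::vec3. a * flat p (c * x $ i + e)) has_derivative
     (\<lambda>h. a * (flat ([:0, 0, 1:] * (p - pderiv p)) (c * x $ i + e) * (c * h $ i)))) (at x)" for x
  proof -
    have "((\<lambda>x::vec3. c * x $ i + e) has_derivative (\<lambda>h. c * h $ i)) (at x)"
      by (auto intro!: derivative_eq_intros bounded_linear_imp_has_derivative[OF bounded_linear_vec_nth])
    from has_derivative_mult_right[OF DERIV_compose_FDERIV[OF flat_has_derivative this], of a]
    show ?thesis by (simp add: mult.commute)
  qed
  have "partial j (\<lambda>x. a * flat p (c * x $ i + e)) =
    (\<lambda>x. (a * (if i = j then c else 0)) * flat ([:0, 0, 1:] * (p - pderiv p)) (c * x $ i + e))" for j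
    by (rule ext, subst partial_eq[OF D]) (auto simp: axis_def)
  then show ?case using D Suc by (auto simp: differentiable_on_def differentiable_def
        intro: has_derivative_at_withinI)
qed

lemma smooth_flat: "smooth (\<lambda>x. flat 1 (c * x $ i + e))"
  using C_k_flat[of _ 1] by (simp add: smooth_def)

text \<open>For \<open>n > 0\<close> this is positive exactly on the open box, and since \<open>exp (-1/(n t))\<close> increases to 1 for
  \<open>t > 0\<close> it increases to the indicator function of the box.\<close>

definition box_bump :: "vec3 \<Rightarrow> vec3 \<Rightarrow> nat \<Rightarrow> scalar_field" where
  "box_bump a b n x = (\<Prod>i\<in>UNIV. flat 1 (real n * (x $ i - a $ i)) * flat 1 (real n * (b $ i - x $ i)))"

lemma flat_1_bounds: "0 \<le> flat 1 t" "flat 1 t \<le> 1"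
  by (auto simp: flat_def)

lemma box_bump_bounds: "0 \<le> box_bump a b n x" "box_bump a b n x \<le> 1"
  unfolding box_bump_def
  by (auto intro!: prod_nonneg prod_le_1 mult_nonneg_nonneg mult_le_one flat_1_bounds)

lemma smooth_box_bump: "smooth (box_bump a b n)"
proof -
  have "smooth (\<lambda>x. flat 1 (real n * x $ i + (- real n * a $ i)) * flat 1 ((- real n) * x $ i + real n * b $ i))" for i
    by (intro smooth_mult smooth_flat)
  then have "smooth (\<lambda>x. \<Prod>i\<in>UNIV. flat 1 (real n * x $ i + (- real n * a $ i)) * flat 1 ((- real n) * x $ i + real n * b $ i))"
    by (intro smooth_prod)
  then show ?thesis unfolding box_bump_def by (simp add: algebra_simps)
qed

lemma box_bump_nonzero_imp: "box_bump a b n x \<noteq> 0 \<Longrightarrow> x \<in> box a b"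
  by (auto simp: box_bump_def mem_box_cart flat_def zero_less_mult_iff split: if_splits)

lemma test_function_box_bump:
  assumes "cbox a b \<subseteq> U"
  shows "test_function U (box_bump a b n)"
proof -
  have *: "closure {x. box_bump a b n x \<noteq> 0} \<subseteq> cbox a b"
    by (rule closure_minimal) (auto dest: box_bump_nonzero_imp box_subset_cbox[THEN subsetD])
  then have "compact (closure {x. box_bump a b n x \<noteq> 0})"
    by (meson bounded_cbox bounded_subset closed_closure compact_eq_bounded_closed)
  with * assms show ?thesis by (auto simp: test_function_def smooth_box_bump)
qed

lemma flat_1_scaled_tendsto: "(\<lambda>n. flat 1 (real n * t)) \<longlonglongrightarrow> (if t > 0 then 1 else 0)"
proof (cases "t > 0")
  case True
  have "(\<lambda>n. exp (- ((1 / t) * (1 / real n)))) \<longlonglongrightarrow> exp (- ((1 / t) * 0))"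
    by (intro tendsto_intros lim_1_over_n)
  then have "(\<lambda>n. flat 1 (real n * t)) \<longlonglongrightarrow> 1"
    by (rule_tac Lim_transform_eventually)
       (use True in \<open>auto simp: flat_def field_simps eventually_at_top_linorder intro!: exI[of _ 1]\<close>)
  with True show ?thesis by simp
next
  case False
  then have "flat 1 (real n * t) = 0" for n by (auto simp: flat_def zero_less_mult_iff)
  with False show ?thesis by simp
qed

lemma box_bump_tendsto: "(\<lambda>n. box_bump a b n x) \<longlonglongrightarrow> indicator (box a b) x"
proof -
  have "(\<lambda>n. box_bump a b n x) \<longlonglongrightarrow>
    (\<Prod>i\<in>UNIV. (if x $ i - a $ i > 0 then 1 else 0) * (if b $ i - x $ i > 0 then 1 else 0))"
    unfolding box_bump_def by (intro tendsto_intros flat_1_scaled_tendsto)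
  also have "(\<Prod>i\<in>(UNIV::3 set). (if x $ i - a $ i > 0 then 1 else 0) * (if b $ i - x $ i > 0 then 1 else 0))
     = (indicator (box a b) x :: real)"
    by (auto simp: indicator_def mem_box_cart prod_eq_1_iff intro!: prod_zero)
  finally show ?thesis .
qed

section \<open>Weak partial derivatives\<close>

text \<open>A one-dimensional derivative along a coordinate line. It can be verified by calculus in one variable,
  and also at points where total differentiability would be awkward to establish.\<close>

definition has_pd :: "scalar_field \<Rightarrow> 3 \<Rightarrow> real \<Rightarrow> vec3 \<Rightarrow> bool" where
  "has_pd u i D x \<longleftrightarrow> ((\<lambda>t. u (x + t *\<^sub>R axis i 1)) has_real_derivative D) (at 0)"

lemma has_derivative_imp_has_pd:
  assumes "(u has_derivative D) (at x)"
  shows "has_pd u i (D (axis i 1)) x"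
proof -
  have "((\<lambda>t. x + t *\<^sub>R axis i 1) has_derivative (\<lambda>t. t *\<^sub>R axis i 1)) (at 0)"
    by (auto intro!: derivative_eq_intros)
  moreover have "(u has_derivative D) (at (x + 0 *\<^sub>R axis i 1))" using assms by simp
  ultimately have "((\<lambda>t. u (x + t *\<^sub>R axis i 1)) has_derivative (\<lambda>t. D (t *\<^sub>R axis i 1))) (at 0)"
    by (rule has_derivative_compose)
  moreover have "(\<lambda>t. D (t *\<^sub>R axis i 1)) = (*) (D (axis i 1))"
    using assms has_derivative_linear linear_scale by (fastforce simp: mult.commute)
  ultimately show ?thesis by (simp add: has_pd_def has_field_derivative_def)
qed

lemma has_pd_partial: "u differentiable (at x) \<Longrightarrow> has_pd u i (partial i u x) x"
  unfolding partial_def frechet_derivative_works by (rule has_derivative_imp_has_pd)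

lemma has_pd_mult:
  "has_pd u i a x \<Longrightarrow> has_pd v i b x \<Longrightarrow> has_pd (\<lambda>x. u x * v x) i (u x * b + a * v x) x"
  unfolding has_pd_def by (auto intro!: derivative_eq_intros)

lemma has_pd_transform:
  assumes "has_pd u i a x" "open S" "x \<in> S" "\<And>y. y \<in> S \<Longrightarrow> u y = v y"
  shows "has_pd v i a x"
proof -
  have "open ((\<lambda>t. x + t *\<^sub>R axis i 1) -` S)"
    by (intro continuous_open_vimage assms continuous_intros)
  with assms show ?thesis unfolding has_pd_def
    by (elim has_field_derivative_transform_within_open) auto
qed

lemma has_pd_at:
  assumes "has_pd u i D (x + s *\<^sub>R axis i 1)"
  shows "((\<lambda>t. u (x + t *\<^sub>R axis i 1)) has_real_derivative D) (at s)"
proof -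
  have "((\<lambda>t. u (x + (t + s) *\<^sub>R axis i 1)) has_real_derivative D) (at 0)"
    using assms by (simp add: has_pd_def algebra_simps)
  then show ?thesis using DERIV_shift[of "\<lambda>t. u (x + t *\<^sub>R axis i 1)" D 0 s] by simp
qed

lemma lborel_translation_integral:
  fixes f :: "vec3 \<Rightarrow> real"
  assumes "f \<in> borel_measurable borel"
  shows "(LINT x|lborel. f (x + a)) = (LINT x|lborel. f x)"
proof -
  have "(LINT x|lborel. f x) = (LINT x|distr lborel borel ((+) a). f x)"
    by (simp add: lborel_distr_plus)
  also have "\<dots> = (LINT x|lborel. f (a + x))" using assms by (subst integral_distr) auto
  finally show ?thesis by (simp add: add.commute)
qed

lemma continuous_compact_support_integrable:
  fixes f :: "vec3 \<Rightarrow> real"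
  assumes "continuous_on UNIV f" "\<And>x. x \<notin> K \<Longrightarrow> f x = 0" "compact K"
  shows "integrable lborel f"
proof -
  have "set_integrable lborel K f"
    unfolding set_integrable_def
    using assms by (intro borel_integrable_compact) (auto intro: continuous_on_subset)
  moreover have "(\<lambda>x. indicator K x *\<^sub>R f x) = f"
    using assms(2) by (auto simp: fun_eq_iff split: split_indicator)
  ultimately show ?thesis by (simp add: set_integrable_def)
qed

text \<open>Difference quotients integrate to zero by translation invariance, and converge boundedly.\<close>

lemma integral_pd_eq_0:
  fixes h h' :: scalar_field
  assumes h: "continuous_on UNIV h" and h': "continuous_on UNIV h'"
    and K: "compact K" "\<And>x. x \<notin> K \<Longrightarrow> h x = 0" "\<And>x. x \<notin> K \<Longrightarrow> h' x = 0"
    and pd: "\<And>x. has_pd h i (h' x) x"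
  shows "(LINT x|lborel. h' x) = 0"
proof -
  define e :: vec3 where "e = axis i 1"
  have ne: "norm e = 1" by (simp add: e_def)
  define t where "t = (\<lambda>n. 1 / real (Suc n))"
  define q where "q = (\<lambda>n x. (h (x + t n *\<^sub>R e) - h x) / t n)"
  obtain r where r: "K \<subseteq> cball 0 r"
    using compact_imp_bounded[OF K(1)] by (auto simp: bounded_iff subset_iff)
  have "compact (h' ` K)" by (intro compact_continuous_image K continuous_on_subset[OF h']) auto
  then obtain B0 where "\<forall>y\<in>h' ` K. norm y \<le> B0"
    using bounded_iff compact_imp_bounded by metis
  then have B0: "\<And>x. x \<in> K \<Longrightarrow> norm (h' x) \<le> B0" by simp
  define B where "B = max B0 0"
  have B: "\<bar>h' x\<bar> \<le> B" for x using B0[of x] K(3)[of x] by (cases "x \<in> K") (auto simp: B_def)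
  have t0: "t n > 0" "t n \<le> 1" for n by (auto simp: t_def)
  have qb: "\<bar>q n x\<bar> \<le> B * indicator (cball 0 (r + 1)) x" for n x
  proof (cases "x \<in> cball 0 (r + 1)")
    case True
    have "((\<lambda>s. h (x + s *\<^sub>R e)) has_real_derivative h' (x + s *\<^sub>R e)) (at s)" for s
      using has_pd_at[OF pd] by (simp add: e_def)
    then obtain z where "h (x + t n *\<^sub>R e) - h (x + 0 *\<^sub>R e) = (t n - 0) * h' (x + z *\<^sub>R e)"
      using MVT2[OF t0(1)[of n], of "\<lambda>s. h (x + s *\<^sub>R e)" "\<lambda>s. h' (x + s *\<^sub>R e)"] by blast
    then have "q n x = h' (x + z *\<^sub>R e)" using t0[of n] by (simp add: q_def)
    then show ?thesis using True B by simp
  next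
    case False
    then have "norm x > r + 1" by (auto simp: dist_norm)
    moreover have "norm (x + t n *\<^sub>R e) \<ge> norm x - norm (t n *\<^sub>R e)"
      using norm_triangle_ineq2[of x "- (t n *\<^sub>R e)"] by simp
    ultimately have "norm (x + t n *\<^sub>R e) > r" using t0[of n] by (simp add: ne)
    then have "x + t n *\<^sub>R e \<notin> K" "x \<notin> K" using r \<open>norm x > r + 1\<close> by auto
    then show ?thesis using False K(2) by (simp add: q_def)
  qed
  have hm: "h \<in> borel_measurable borel" "h' \<in> borel_measurable borel"
    using h h' by (auto intro: borel_measurable_continuous_onI)
  have hi: "integrable lborel h" by (rule continuous_compact_support_integrable[OF h K(2,1)])
  have qm: "q n \<in> borel_measurable borel" for n unfolding q_def using hm(1) by measurable
  have t_lim: "t \<longlonglongrightarrow> 0" unfolding t_def by (rule LIMSEQ_Suc[OF lim_1_over_n])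
  have "(\<lambda>n. LINT x|lborel. q n x) \<longlonglongrightarrow> (LINT x|lborel. h' x)"
  proof (rule integral_dominated_convergence[where w="\<lambda>x::vec3. B * indicator (cball 0 (r + 1)) x"])
    show "AE x in lborel. (\<lambda>n. q n x) \<longlonglongrightarrow> h' x"
    proof (rule AE_I2)
      fix x :: vec3
      have "((\<lambda>s. (h (x + (0 + s) *\<^sub>R e) - h (x + 0 *\<^sub>R e)) / s) \<longlongrightarrow> h' x) (at 0)"
        using pd[of x] by (simp only: has_pd_def e_def DERIV_def)
      moreover have "filterlim t (at 0) sequentially"
        using t_lim t0(1) by (auto simp: filterlim_at intro!: always_eventually less_imp_neq[THEN not_sym])
      ultimately have "(\<lambda>n. (h (x + (0 + t n) *\<^sub>R e) - h (x + 0 *\<^sub>R e)) / t n) \<longlonglongrightarrow> h' x"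
        by (rule filterlim_compose)
      then show "(\<lambda>n. q n x) \<longlonglongrightarrow> h' x" by (simp add: q_def)
    qed
    show "integrable lborel (\<lambda>x::vec3. B * indicator (cball 0 (r + 1)) x)"
      by (intro integrable_mult_right integrable_real_indicator)
         (use emeasure_bounded_finite[OF bounded_cball, of "0::vec3" "r + 1"] in \<open>auto simp: less_top\<close>)
  qed (use qb qm hm in auto)
  moreover have "(LINT x|lborel. q n x) = 0" for n
  proof -
    have "integrable lborel (\<lambda>x. h (x + t n *\<^sub>R e))"
    proof (rule continuous_compact_support_integrable)
      show "continuous_on UNIV (\<lambda>x. h (x + t n *\<^sub>R e))"
        by (intro continuous_on_compose2[OF h] continuous_intros) auto
      show "compact ((\<lambda>x. - (t n *\<^sub>R e) + x) ` K)" using K(1) by (rule compact_translation)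
      show "h (x + t n *\<^sub>R e) = 0" if "x \<notin> (\<lambda>x. - (t n *\<^sub>R e) + x) ` K" for x
      proof (rule K(2), rule notI)
        assume "x + t n *\<^sub>R e \<in> K"
        then have "- (t n *\<^sub>R e) + (x + t n *\<^sub>R e) \<in> (\<lambda>x. - (t n *\<^sub>R e) + x) ` K" by blast
        with that show False by simp
      qed
    qed
    then show ?thesis using hi lborel_translation_integral[OF hm(1), of "t n *\<^sub>R e"]
      by (simp add: q_def)
  qed
  ultimately have "(\<lambda>n. 0) \<longlonglongrightarrow> (LINT x|lborel. h' x)" by simp
  then show ?thesis by (simp add: LIMSEQ_const_iff)
qed

lemma test_functionD:
  assumes "test_function U \<phi>"
  obtains K where "compact K" "K \<subseteq> U" "\<And>x. x \<notin> K \<Longrightarrow> \<phi> x = 0" "\<And>x i. x \<notin> K \<Longrightarrow> partial i \<phi> x = 0"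
    "smooth \<phi>"
proof
  let ?K = "closure {x. \<phi> x \<noteq> 0}"
  show *: "\<phi> x = 0" if "x \<notin> ?K" for x
    using that closure_subset[of "{x. \<phi> x \<noteq> 0}"] by (auto dest: subsetD)
  show "partial i \<phi> x = 0" if "x \<notin> ?K" for x i
  proof -
    have "(\<phi> has_derivative (\<lambda>_. 0)) (at x)"
    proof (rule has_derivative_transform_within_open[where f="\<lambda>_. 0" and s="- ?K"])
      show "x \<in> - ?K" using that by simp
      show "0 = \<phi> y" if "y \<in> - ?K" for y using *[of y] that by auto
    qed (simp_all add: open_Compl)
    from partial_eq[OF this] show ?thesis .
  qed
qed (use assms in \<open>auto simp: test_function_def\<close>)

lemma locally_integrable_times:
  assumes g: "locally_integrable U g" and K: "compact K" "K \<subseteq> U" "\<And>x. x \<notin> K \<Longrightarrow> \<psi> x = 0"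
    and \<psi>: "continuous_on UNIV \<psi>"
  shows "integrable lebesgue (\<lambda>x. g x * \<psi> x)"
proof -
  have gi: "integrable lebesgue (\<lambda>x. indicator K x * g x)"
    using g K by (auto simp: locally_integrable_def set_integrable_def)
  have \<psi>m: "\<psi> \<in> borel_measurable lebesgue"
    using \<psi> by (auto intro!: measurable_completion borel_measurable_continuous_onI)
  have "bounded (\<psi> ` K)"
    by (intro compact_imp_bounded compact_continuous_image K(1) continuous_on_subset[OF \<psi>]) auto
  then obtain B where "\<forall>y\<in>\<psi> ` K. norm y \<le> B"
    unfolding bounded_iff by (rule exE)
  then have B: "\<And>x. x \<in> K \<Longrightarrow> norm (\<psi> x) \<le> B" by simp
  have bd: "norm (\<psi> x) \<le> max B 0" for x
    using K(3)[of x] B[of x] by (cases "x \<in> K") (auto simp: max.coboundedI1)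
  have "integrable lebesgue (\<lambda>x. (indicator K x * g x) * \<psi> x)"
  proof (rule Bochner_Integration.integrable_bound)
    show "integrable lebesgue (\<lambda>x. (max B 0) * \<bar>indicator K x * g x\<bar>)"
      using gi by (intro integrable_mult_right integrable_abs)
    show "(\<lambda>x. (indicator K x * g x) * \<psi> x) \<in> borel_measurable lebesgue"
      using gi \<psi>m by auto
    show "AE x in lebesgue. norm ((indicator K x * g x) * \<psi> x) \<le> norm (max B 0 * \<bar>indicator K x * g x\<bar>)"
    proof (rule AE_I2)
      fix x
      show "norm ((indicator K x * g x) * \<psi> x) \<le> norm (max B 0 * \<bar>indicator K x * g x\<bar>)"
        using mult_right_mono[OF bd[of x], of "\<bar>indicator K x * g x\<bar>"]
        by (simp add: abs_mult ac_simps)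
    qed
  qed
  moreover have "(\<lambda>x. (indicator K x * g x) * \<psi> x) = (\<lambda>x. g x * \<psi> x)"
    using K(3) by (auto simp: fun_eq_iff split: split_indicator)
  ultimately show ?thesis by simp
qed

lemma LINT_lebesgue_on_supported:
  fixes f :: scalar_field
  assumes "U \<in> sets lebesgue" "\<And>x. x \<notin> U \<Longrightarrow> f x = 0"
  shows "(LINT x|lebesgue_on U. f x) = (LINT x|lebesgue. f x)"
  using assms by (subst integral_restrict_space) (auto intro!: Bochner_Integration.integral_cong simp: indicator_def)

lemma LINT_lebesgue_on_test:
  fixes f :: scalar_field
  assumes "U \<in> sets lebesgue" "\<And>x. x \<notin> U \<Longrightarrow> \<psi> x = 0"
  shows "(LINT x|lebesgue_on U. f x * \<psi> x) = (LINT x|lebesgue. f x * \<psi> x)"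
  using assms by (intro LINT_lebesgue_on_supported) auto

lemma continuous_imp_locally_integrable:
  "continuous_on U u \<Longrightarrow> locally_integrable U u"
  unfolding locally_integrable_def
proof (intro allI impI)
  fix C assume "continuous_on U u" "compact C \<and> C \<subseteq> U"
  then have *: "integrable lborel (\<lambda>x. indicator C x *\<^sub>R u x)"
    by (intro borel_integrable_compact) (auto intro: continuous_on_subset)
  then show "u absolutely_integrable_on C"
    unfolding set_integrable_def by (subst integrable_completion) (use * in \<open>auto dest: borel_measurable_integrable\<close>)
qed

text \<open>The product of \<open>u\<close> with a test function extends by zero to a continuously differentiable function with
  compact support, whose derivative has integral zero.\<close>

theorem C1_imp_has_weak_partial:
  assumes U: "open U" and u: "continuous_on U u" and g: "continuous_on U g"
    and pd: "\<And>x. x \<in> U \<Longrightarrow> has_pd u i (g x) x"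
  shows "has_weak_partial U i u g"
  unfolding has_weak_partial_def
proof (intro conjI allI impI)
  show "locally_integrable U u" "locally_integrable U g"
    using u g by (auto intro: continuous_imp_locally_integrable)
  then have li: "locally_integrable U u" "locally_integrable U g" .
  fix \<phi> assume "test_function U \<phi>"
  then obtain K where K: "compact K" "K \<subseteq> U" "\<And>x. x \<notin> K \<Longrightarrow> \<phi> x = 0"
    "\<And>x i. x \<notin> K \<Longrightarrow> partial i \<phi> x = 0" and \<phi>: "smooth \<phi>" by (rule test_functionD) blast
  define ext where "ext = (\<lambda>(f::scalar_field) x. if x \<in> U then f x else 0)"
  have cont_ext: "continuous_on UNIV (ext f)" if "continuous_on U f" "\<And>x. x \<notin> K \<Longrightarrow> f x = 0" for f
  proof -
    have "continuous_on U (ext f)" using that(1) by (simp add: ext_def cong: continuous_on_cong)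
    moreover have "continuous_on (- K) (ext f)"
    proof (rule continuous_on_eq[where f="\<lambda>_. 0"])
      show "0 = ext f x" if "x \<in> - K" for x using \<open>\<And>x. x \<notin> K \<Longrightarrow> f x = 0\<close> that by (auto simp: ext_def)
    qed auto
    ultimately have "continuous_on (U \<union> - K) (ext f)"
      using U K(1) by (intro continuous_on_open_Un) (auto simp: compact_imp_closed)
    moreover have "U \<union> - K = UNIV" using K(2) by blast
    ultimately show ?thesis by simp
  qed
  have c\<phi>: "continuous_on S \<phi>" "continuous_on S (partial i \<phi>)" for S
    using smooth_imp_continuous smooth_partial \<phi> by blast+
  have "(LINT x|lborel. ext (\<lambda>x. u x * partial i \<phi> x + g x * \<phi> x) x) = 0"
  proof (rule integral_pd_eq_0[where h="ext (\<lambda>x. u x * \<phi> x)" and K=K and i=i])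
    show "continuous_on UNIV (ext (\<lambda>x. u x * \<phi> x))"
      "continuous_on UNIV (ext (\<lambda>x. u x * partial i \<phi> x + g x * \<phi> x))"
      using K by (auto intro!: cont_ext continuous_intros u g c\<phi>)
    show "has_pd (ext (\<lambda>x. u x * \<phi> x)) i (ext (\<lambda>x. u x * partial i \<phi> x + g x * \<phi> x) x) x" for x
    proof (cases "x \<in> U")
      case True
      have "has_pd (\<lambda>x. u x * \<phi> x) i (u x * partial i \<phi> x + g x * \<phi> x) x"
        by (intro has_pd_mult pd True has_pd_partial smooth_imp_differentiable \<phi>)
      then show ?thesis using True
        by (auto simp: ext_def intro: has_pd_transform[where S=U] U)
    next
      case False
      have "has_pd (\<lambda>_. 0) i 0 x" by (simp add: has_pd_def)
      then have "has_pd (ext (\<lambda>x. u x * \<phi> x)) i 0 x"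
        using K False by (elim has_pd_transform[where S="- K"]) (auto simp: ext_def compact_imp_closed)
      then show ?thesis using False by (simp add: ext_def)
    qed
  qed (use K in \<open>auto simp: ext_def\<close>)
  also have ext_eq: "(\<lambda>x. ext (\<lambda>x. u x * partial i \<phi> x + g x * \<phi> x) x) = (\<lambda>x. u x * partial i \<phi> x + g x * \<phi> x)"
    unfolding ext_def using K(2-4) by (intro ext) (metis add_0 mult_zero_right subsetD)
  finally have 0: "(LINT x|lborel. u x * partial i \<phi> x + g x * \<phi> x) = 0" .
  have m: "(\<lambda>x. u x * partial i \<phi> x + g x * \<phi> x) \<in> borel_measurable borel"
  proof -
    have "continuous_on UNIV (ext (\<lambda>x. u x * partial i \<phi> x + g x * \<phi> x))"
      using K by (auto intro!: cont_ext continuous_intros u g c\<phi>)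
    from borel_measurable_continuous_onI[OF this] show ?thesis using ext_eq by simp
  qed
  have "(LINT x|lebesgue. u x * partial i \<phi> x + g x * \<phi> x) = 0"
    using 0 m by (subst integral_completion) auto
  moreover have "integrable lebesgue (\<lambda>x. u x * partial i \<phi> x)" "integrable lebesgue (\<lambda>x. g x * \<phi> x)"
    using K by (auto intro!: locally_integrable_times[OF li(1), where K=K]
        locally_integrable_times[OF li(2), where K=K] c\<phi>)
  ultimately have "(LINT x|lebesgue. u x * partial i \<phi> x) + (LINT x|lebesgue. g x * \<phi> x) = 0" by simp
  moreover have Us: "U \<in> sets lebesgue" using U by simp
  moreover have out: "partial i \<phi> x = 0" "\<phi> x = 0" if "x \<notin> U" for x
    using that K(2) K(3)[of x] K(4)[of x i] by auto
  ultimately show "(LINT x|lebesgue_on U. u x * partial i \<phi> x) = - (LINT x|lebesgue_on U. g x * \<phi> x)"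
    using LINT_lebesgue_on_test[where U=U and \<psi>="partial i \<phi>" and f=u]
      LINT_lebesgue_on_test[where U=U and \<psi>=\<phi> and f=g] by simp
qed

lemma AE_lebesgue_on_iff:
  "U \<in> sets lebesgue \<Longrightarrow> (AE x in lebesgue_on U. P x) \<longleftrightarrow> (AE x in lebesgue. x \<in> U \<longrightarrow> P x)"
  by (simp add: AE_restrict_space_iff)

lemma locally_integrable_cong_AE:
  assumes U: "open U" and u: "locally_integrable U u" and ae: "AE x in lebesgue_on U. u x = u' x"
  shows "locally_integrable U u'"
  unfolding locally_integrable_def
proof (intro allI impI)
  fix C assume C: "compact C \<and> C \<subseteq> U"
  have "AE x in lebesgue. x \<in> U \<longrightarrow> u x = u' x" using ae U by (simp add: AE_lebesgue_on_iff)
  then obtain N where "N \<in> null_sets lebesgue" "{x. \<not> (x \<in> U \<longrightarrow> u x = u' x)} \<subseteq> N"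
    by (elim AE_E3) (fastforce simp: subset_iff)
  then have N: "negligible N" "\<And>x. x \<in> C - N \<Longrightarrow> u' x = u x"
    using C by (auto simp: negligible_iff_null_sets)
  have "u absolutely_integrable_on C" using u C unfolding locally_integrable_def by blast
  from absolutely_integrable_spike[OF this N] show "u' absolutely_integrable_on C" .
qed

theorem has_weak_partial_cong_AE:
  assumes U: "open U" and w: "has_weak_partial U i u g"
    and u: "AE x in lebesgue_on U. u x = u' x" and g: "AE x in lebesgue_on U. g x = g' x"
  shows "has_weak_partial U i u' g'"
  unfolding has_weak_partial_def
proof (intro conjI allI impI)
  have li: "locally_integrable U u" "locally_integrable U g" using w by (auto simp: has_weak_partial_def)
  show li': "locally_integrable U u'" "locally_integrable U g'"
    using locally_integrable_cong_AE[OF U li(1) u] locally_integrable_cong_AE[OF U li(2) g] .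
  fix \<phi> assume t: "test_function U \<phi>"
  then obtain K where K: "compact K" "K \<subseteq> U" "\<And>x. x \<notin> K \<Longrightarrow> \<phi> x = 0"
    "\<And>x i. x \<notin> K \<Longrightarrow> partial i \<phi> x = 0" and \<phi>: "smooth \<phi>" by (rule test_functionD) blast
  have Us: "U \<in> sets lebesgue" using U by simp
  have ae: "(LINT x|lebesgue_on U. f x * \<psi> x) = (LINT x|lebesgue_on U. f' x * \<psi> x)"
    if "locally_integrable U f" "locally_integrable U f'" "AE x in lebesgue_on U. f x = f' x"
      "continuous_on UNIV \<psi>" "\<And>x. x \<notin> K \<Longrightarrow> \<psi> x = 0" for f f' \<psi> :: scalar_field
  proof -
    have "(LINT x|lebesgue. f x * \<psi> x) = (LINT x|lebesgue. f' x * \<psi> x)"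
    proof (rule integral_cong_AE)
      show "AE x in lebesgue. f x * \<psi> x = f' x * \<psi> x"
        using that(3) unfolding AE_lebesgue_on_iff[OF Us]
        by (rule AE_mp) (use that(5) K(2) in auto)
      show "(\<lambda>x. f x * \<psi> x) \<in> borel_measurable lebesgue"
        by (rule borel_measurable_integrable[OF locally_integrable_times[OF that(1) K(1,2) that(5,4)]])
      show "(\<lambda>x. f' x * \<psi> x) \<in> borel_measurable lebesgue"
        by (rule borel_measurable_integrable[OF locally_integrable_times[OF that(2) K(1,2) that(5,4)]])
    qed
    note this
    moreover have out: "\<psi> x = 0" if "x \<notin> U" for x using that \<open>\<And>x. x \<notin> K \<Longrightarrow> \<psi> x = 0\<close>[of x] K(2) by blast
    moreover have "(LINT x|lebesgue_on U. k x * \<psi> x) = (LINT x|lebesgue. k x * \<psi> x)" for k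
      by (rule LINT_lebesgue_on_test[OF Us]) (rule out)
    ultimately show ?thesis by simp
  qed
  have "(LINT x|lebesgue_on U. u x * partial i \<phi> x) = - (LINT x|lebesgue_on U. g x * \<phi> x)"
    using w t by (auto simp: has_weak_partial_def)
  then show "(LINT x|lebesgue_on U. u' x * partial i \<phi> x) = - (LINT x|lebesgue_on U. g' x * \<phi> x)"
    using ae[OF li(1) li'(1) u, of "partial i \<phi>"] ae[OF li(2) li'(2) g, of \<phi>] K \<phi>
    by (auto simp: smooth_imp_continuous smooth_partial)
qed

lemma locally_integrable_add:
  "locally_integrable U f \<Longrightarrow> locally_integrable U g \<Longrightarrow> locally_integrable U (\<lambda>x. f x + g x)"
  by (auto simp: locally_integrable_def)

lemma has_weak_partial_add:
  assumes U: "open U" and 1: "has_weak_partial U i u g" and 2: "has_weak_partial U i v h"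
  shows "has_weak_partial U i (\<lambda>x. u x + v x) (\<lambda>x. g x + h x)"
  unfolding has_weak_partial_def
proof (intro conjI allI impI locally_integrable_add)
  show li: "locally_integrable U u" "locally_integrable U v" "locally_integrable U g" "locally_integrable U h"
    using 1 2 by (auto simp: has_weak_partial_def)
  fix \<phi> assume t: "test_function U \<phi>"
  then obtain K where K: "compact K" "K \<subseteq> U" "\<And>x. x \<notin> K \<Longrightarrow> \<phi> x = 0"
    "\<And>x. x \<notin> K \<Longrightarrow> partial i \<phi> x = 0" and \<phi>: "smooth \<phi>" by (rule test_functionD) blast
  have Us: "U \<in> sets lebesgue" using U by simp
  have add: "(LINT x|lebesgue_on U. (f x + g x) * \<psi> x) =
      (LINT x|lebesgue_on U. f x * \<psi> x) + (LINT x|lebesgue_on U. g x * \<psi> x)"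
    if f: "locally_integrable U f" and g: "locally_integrable U g"
      and \<psi>: "continuous_on UNIV \<psi>" "\<And>x. x \<notin> K \<Longrightarrow> \<psi> x = 0" for f g \<psi> :: scalar_field
  proof -
    have o: "\<psi> x = 0" if "x \<notin> U" for x using that \<psi>(2)[of x] K(2) by blast
    have T: "(LINT x|lebesgue_on U. k x * \<psi> x) = (LINT x|lebesgue. k x * \<psi> x)" for k
      by (rule LINT_lebesgue_on_test[OF Us]) (rule o)
    have "(LINT x|lebesgue. (f x + g x) * \<psi> x) = (LINT x|lebesgue. f x * \<psi> x) + (LINT x|lebesgue. g x * \<psi> x)"
      unfolding distrib_right
      by (rule Bochner_Integration.integral_add[OF locally_integrable_times[OF f K(1,2) \<psi>(2,1)]
          locally_integrable_times[OF g K(1,2) \<psi>(2,1)]])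
    then show ?thesis by (simp only: T)
  qed
  have c: "continuous_on UNIV \<phi>" "continuous_on UNIV (partial i \<phi>)"
    using \<phi> by (auto intro: smooth_imp_continuous smooth_partial)
  have "(LINT x|lebesgue_on U. u x * partial i \<phi> x) = - (LINT x|lebesgue_on U. g x * \<phi> x)"
    "(LINT x|lebesgue_on U. v x * partial i \<phi> x) = - (LINT x|lebesgue_on U. h x * \<phi> x)"
    using 1 2 t unfolding has_weak_partial_def by blast+
  then show "(LINT x|lebesgue_on U. (u x + v x) * partial i \<phi> x) = - (LINT x|lebesgue_on U. (g x + h x) * \<phi> x)"
    using add[OF li(1,2) c(2) K(4)] add[OF li(3,4) c(1) K(3)] by linarith
qed

text \<open>By Lebesgue differentiation over cubes, almost every value is a limit of averages, all of which are zero.\<close>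

lemma null_integrals_imp_AE_0:
  assumes U: "open U" and h: "locally_integrable U h"
    and 0: "\<And>a b. cbox a b \<subseteq> U \<Longrightarrow> (LINT x|lebesgue. h x * indicator (box a b) x) = 0"
  shows "AE x in lebesgue_on U. h x = 0"
proof -
  have box: "AE x in lebesgue. x \<in> cbox a b \<longrightarrow> h x = 0" if ab: "cbox a b \<subseteq> U" for a b
  proof -
    define F where "F = (\<lambda>x. if x \<in> cbox a b then h x else 0)"
    have hc: "h absolutely_integrable_on cbox c d" if "cbox c d \<subseteq> U" for c d
      using h that by (auto simp: locally_integrable_def)
    have "F absolutely_integrable_on UNIV"
      unfolding F_def using hc[OF ab] absolutely_integrable_restrict_UNIV by blast
    then have "F integrable_on cbox c d" for c d
      by (meson set_lebesgue_integral_eq_integral(1) absolutely_integrable_on_subcbox subset_UNIV)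
    then obtain N where N: "negligible N" "\<And>x e. \<lbrakk>x \<notin> N; 0 < e\<rbrakk> \<Longrightarrow>
       \<exists>d>0. \<forall>h. 0 < h \<and> h < d \<longrightarrow> norm (integral (cbox x (x + h *\<^sub>R One)) F /\<^sub>R h ^ DIM(vec3) - F x) < e"
      using integrable_ccontinuous_explicit[of F] by blast
    have "h x = 0" if x: "x \<in> box a b" "x \<notin> N" for x
    proof (rule ccontr)
      assume "h x \<noteq> 0"
      have xc: "x \<in> cbox a b" using x box_subset_cbox by blast
      from N(2)[OF x(2), of "\<bar>h x\<bar>"] \<open>h x \<noteq> 0\<close> obtain d where d: "d > 0"
        "\<And>s. 0 < s \<Longrightarrow> s < d \<Longrightarrow> norm (integral (cbox x (x + s *\<^sub>R One)) F /\<^sub>R s ^ DIM(vec3) - F x) < \<bar>h x\<bar>"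
        by auto
      have "\<exists>s>0. s < d \<and> x + s *\<^sub>R One \<in> box a b"
      proof -
        have "((\<lambda>s. x + s *\<^sub>R One) \<longlongrightarrow> x + 0 *\<^sub>R One) (at_right (0::real))"
          by (intro tendsto_intros)
        then have "eventually (\<lambda>s. x + s *\<^sub>R One \<in> box a b) (at_right (0::real))"
          using x(1) topological_tendstoD[OF _ open_box] by simp
        moreover have "eventually (\<lambda>s. 0 < s \<and> s < d) (at_right (0::real))"
          using d(1) eventually_at_right_field by blast
        ultimately have "eventually (\<lambda>s. x + s *\<^sub>R One \<in> box a b \<and> 0 < s \<and> s < d) (at_right (0::real))"
          by (rule eventually_conj)
        from eventually_happens'[OF trivial_limit_at_right_real this] show ?thesis by blast
      qed
      then obtain s where s: "s > 0" "s < d" "x + s *\<^sub>R One \<in> box a b" by blast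
      have sub: "cbox x (x + s *\<^sub>R One) \<subseteq> cbox a b"
        using xc box_subset_cbox[THEN subsetD, OF s(3)] unfolding subset_box mem_box by blast
      have "integral (cbox x (x + s *\<^sub>R One)) F = integral (cbox x (x + s *\<^sub>R One)) h"
        by (rule Henstock_Kurzweil_Integration.integral_cong) (use sub in \<open>auto simp: F_def\<close>)
      also have "\<dots> = integral (box x (x + s *\<^sub>R One)) h"
        by (rule integral_open_interval[symmetric])
      also have "\<dots> = (LINT y:box x (x + s *\<^sub>R One)|lebesgue. h y)"
      proof (rule set_lebesgue_integral_eq_integral(2)[symmetric])
        show "h absolutely_integrable_on box x (x + s *\<^sub>R One)"
          by (rule set_integrable_subset[OF hc[OF order_trans[OF sub ab]] _ box_subset_cbox]) simp
      qed
      also have "\<dots> = (LINT y|lebesgue. h y * indicator (box x (x + s *\<^sub>R One)) y)"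
        by (simp add: set_lebesgue_integral_def mult.commute)
      also have "\<dots> = 0" using 0 sub ab by blast
      finally have "norm (F x) < \<bar>h x\<bar>" using d(2)[OF s(1,2)] by simp
      then show False using xc by (simp add: F_def)
    qed
    then have "{x. \<not> (x \<in> cbox a b \<longrightarrow> h x = 0)} \<subseteq> N \<union> (cbox a b - box a b)" by auto
    moreover have "negligible (N \<union> (cbox a b - box a b))"
      using N(1) negligible_frontier_interval by (intro negligible_Un)
    ultimately show ?thesis
      by (intro AE_I'[of "N \<union> (cbox a b - box a b)"]) (auto simp: negligible_iff_null_sets)
  qed
  obtain \<D> where \<D>: "countable \<D>" "\<D> \<subseteq> Pow U" "\<And>X. X \<in> \<D> \<Longrightarrow> \<exists>a b. X = cbox a b" "\<Union>\<D> = U"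
    using open_countable_Union_open_cbox[OF U] by blast
  have "AE x in lebesgue. \<forall>X\<in>\<D>. x \<in> X \<longrightarrow> h x = 0"
  proof (subst AE_ball_countable[OF \<D>(1)], rule ballI)
    fix X assume X: "X \<in> \<D>"
    then obtain a b where "X = cbox a b" using \<D>(3) by blast
    then show "AE x in lebesgue. x \<in> X \<longrightarrow> h x = 0" using box[of a b] X \<D>(2) by blast
  qed
  then have "AE x in lebesgue. x \<in> U \<longrightarrow> h x = 0"
    by (rule AE_mp) (use \<D>(4) in \<open>auto intro!: AE_I2\<close>)
  then show ?thesis using U by (simp add: AE_lebesgue_on_iff)
qed

text \<open>The difference of two weak derivatives annihilates all test functions, hence, by letting bumps increase
  to the indicator of a box, has zero integral over every box. This uniqueness is what gives the
  arbitrarily chosen representative \<open>weak_partial\<close> a definite value almost everywhere.\<close>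

theorem has_weak_partial_unique:
  assumes U: "open U" and 1: "has_weak_partial U i u g" and 2: "has_weak_partial U i u g'"
  shows "AE x in lebesgue_on U. g x = g' x"
proof -
  define h where "h = (\<lambda>x. g x - g' x)"
  have li: "locally_integrable U g" "locally_integrable U g'" using 1 2 by (auto simp: has_weak_partial_def)
  then have lh: "locally_integrable U h"
    by (auto simp: locally_integrable_def h_def intro: set_integral_diff(1))
  have "(LINT x|lebesgue. h x * indicator (box a b) x) = 0" if ab: "cbox a b \<subseteq> U" for a b
  proof -
    have out: "box_bump a b n x = 0" if "x \<notin> cbox a b" for n x
      using that box_bump_nonzero_imp box_subset_cbox by blast
    have c: "continuous_on UNIV (box_bump a b n)" for n
      by (simp add: smooth_box_bump smooth_imp_continuous)
    have i: "integrable lebesgue (\<lambda>x. f x * box_bump a b n x)" if "locally_integrable U f" for f n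
      using locally_integrable_times[OF that compact_cbox ab out c] .
    have "(LINT x|lebesgue. h x * box_bump a b n x) = 0" for n
    proof -
      have "(LINT x|lebesgue_on U. g x * box_bump a b n x) = (LINT x|lebesgue_on U. g' x * box_bump a b n x)"
      proof -
        have "(LINT x|lebesgue_on U. u x * partial i (box_bump a b n) x) =
          - (LINT x|lebesgue_on U. k x * box_bump a b n x)" if "has_weak_partial U i u k" for k
          using that test_function_box_bump[OF ab, of n] unfolding has_weak_partial_def by blast
        from this[OF 1] this[OF 2] show ?thesis by simp
      qed
      moreover have "(LINT x|lebesgue_on U. k x * box_bump a b n x) = (LINT x|lebesgue. k x * box_bump a b n x)" for k
        using ab out U by (intro LINT_lebesgue_on_test) auto
      ultimately have "(LINT x|lebesgue. g x * box_bump a b n x) = (LINT x|lebesgue. g' x * box_bump a b n x)"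
        by simp
      then show ?thesis using i[OF li(1)] i[OF li(2)] by (simp add: h_def left_diff_distrib)
    qed
    moreover have "(\<lambda>n. LINT x|lebesgue. h x * box_bump a b n x) \<longlonglongrightarrow> (LINT x|lebesgue. h x * indicator (box a b) x)"
    proof (rule integral_dominated_convergence[where w="\<lambda>x. \<bar>indicator (cbox a b) x * h x\<bar>"])
      have hi: "integrable lebesgue (\<lambda>x. indicator (cbox a b) x * h x)"
        using lh ab by (auto simp: locally_integrable_def set_integrable_def)
      then show "integrable lebesgue (\<lambda>x. \<bar>indicator (cbox a b) x * h x\<bar>)" by (rule integrable_abs)
      have "(\<lambda>x. h x * indicator (box a b) x) = (\<lambda>x. (indicator (cbox a b) x * h x) * indicator (box a b) x)"
        using box_subset_cbox[of a b] by (auto simp: fun_eq_iff split: split_indicator)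
      show "(\<lambda>x. h x * indicator (box a b) x) \<in> borel_measurable lebesgue"
      proof (subst \<open>(\<lambda>x. h x * indicator (box a b) x) = _\<close>, rule borel_measurable_times)
        show "(\<lambda>x. indicator (cbox a b) x * h x) \<in> borel_measurable lebesgue"
          by (rule borel_measurable_integrable[OF hi])
        show "(indicator (box a b) :: vec3 \<Rightarrow> real) \<in> borel_measurable lebesgue"
          by (rule borel_measurable_indicator[OF fmeasurableD[OF lmeasurable_box]])
      qed
      show "AE x in lebesgue. (\<lambda>n. h x * box_bump a b n x) \<longlonglongrightarrow> h x * indicator (box a b) x"
        by (intro AE_I2 tendsto_intros box_bump_tendsto)
      show "AE x in lebesgue. norm (h x * box_bump a b n x) \<le> \<bar>indicator (cbox a b) x * h x\<bar>" for n
        using out box_bump_bounds[of a b n]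
        by (intro AE_I2) (auto simp: indicator_def abs_mult mult_left_le)
    qed (use i[OF lh] in auto)
    ultimately show ?thesis by (simp add: LIMSEQ_const_iff)
  qed
  from null_integrals_imp_AE_0[OF U lh this] show ?thesis by (simp add: h_def)
qed

lemma weak_partial_AE:
  assumes "open U" "has_weak_partial U i u g"
  shows "AE x in lebesgue_on U. weak_partial U i u x = g x"
  unfolding weak_partial_def
  by (rule has_weak_partial_unique[OF assms(1) someI[of "has_weak_partial U i u"] assms(2)]) (rule assms(2))

section \<open>Traces on the sphere\<close>

lemma has_derivative_partials:
  assumes "f differentiable (at y)"
  shows "(f has_derivative (\<lambda>h. \<Sum>i\<in>UNIV. h $ i * partial i f y)) (at y)"
proof -
  obtain D where D: "(f has_derivative D) (at y)" using assms differentiable_def by blast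
  have lin: "linear D" using D by (rule has_derivative_linear)
  have "D h = (\<Sum>i\<in>UNIV. h $ i * partial i f y)" for h
  proof -
    have "D h = D (\<Sum>i\<in>UNIV. h $ i *s axis i 1)" by (simp only: basis_expansion)
    also have "\<dots> = (\<Sum>i\<in>UNIV. D (h $ i *s axis i 1))" by (rule linear_sum[OF lin])
    also have "\<dots> = (\<Sum>i\<in>UNIV. h $ i * partial i f y)"
      by (simp only: scalar_mult_eq_scaleR linear_scale[OF lin] real_scaleR_def partial_eq[OF D])
    finally show ?thesis .
  qed
  from D[unfolded ext[of D, OF this]] show ?thesis .
qed

text \<open>The divergence of the vector field \<open>w\<^sup>2 x\<close>. It satisfies \<open>(t\<^sup>3 w(t x)\<^sup>2)' = t\<^sup>2 radial_flux w (t x)\<close>, which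
  turns a boundary value of \<open>w\<^sup>2\<close> into an integral along a ray.\<close>

definition radial_flux :: "scalar_field \<Rightarrow> scalar_field" where
  "radial_flux w y = 3 * (w y)\<^sup>2 + 2 * w y * (\<Sum>i\<in>UNIV. y $ i * partial i w y)"

lemma continuous_radial_flux: "smooth w \<Longrightarrow> continuous_on S (radial_flux w)"
  unfolding radial_flux_def
  by (intro continuous_intros smooth_imp_continuous smooth_partial)

lemma radial_flux_measurable: "smooth w \<Longrightarrow> radial_flux w \<in> borel_measurable borel"
  by (intro borel_measurable_continuous_onI continuous_radial_flux)

lemma radial_FTC:
  assumes w: "smooth w" and T: "0 \<le> T"
  shows "ennreal (T ^ 3 * (w (T *\<^sub>R x))\<^sup>2) \<le>
    (\<integral>\<^sup>+t. ennreal (t\<^sup>2 * \<bar>radial_flux w (t *\<^sub>R x)\<bar>) * indicator {0..T} t \<partial>lborel)"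
proof -
  let ?f = "\<lambda>t. t\<^sup>2 * radial_flux w (t *\<^sub>R x)"
  have D: "((\<lambda>t. t ^ 3 * (w (t *\<^sub>R x))\<^sup>2) has_real_derivative ?f t) (at t)" for t
  proof -
    have d: "((\<lambda>t. t *\<^sub>R x) has_derivative (\<lambda>s. s *\<^sub>R x)) (at t)"
      by (auto intro!: derivative_eq_intros)
    have lin: "(\<lambda>s. \<Sum>i\<in>UNIV. (s *\<^sub>R x) $ i * p i) = (*) (\<Sum>i\<in>UNIV. x $ i * p i)" for p :: "3 \<Rightarrow> real"
      by (auto simp: fun_eq_iff sum_distrib_left mult_ac)
    from has_derivative_compose[OF d has_derivative_partials[OF smooth_imp_differentiable[OF w]]]
    have "((\<lambda>t. w (t *\<^sub>R x)) has_real_derivative (\<Sum>i\<in>UNIV. x $ i * partial i w (t *\<^sub>R x))) (at t)"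
      by (simp only: has_field_derivative_def lin)
    then show ?thesis
      by (auto intro!: derivative_eq_intros
          simp: radial_flux_def power2_eq_square power3_eq_cube algebra_simps sum_distrib_left)
  qed
  have c: "continuous_on S ?f" for S
    by (intro continuous_intros continuous_on_compose2[OF continuous_radial_flux[OF w]]) auto
  have "has_bochner_integral lborel (\<lambda>t. ?f t * indicator {0..T} t) (T ^ 3 * (w (T *\<^sub>R x))\<^sup>2 - 0 ^ 3 * (w (0 *\<^sub>R x))\<^sup>2)"
    by (rule has_bochner_integral_FTC_Icc_real[OF T D])
       (use c[of UNIV] in \<open>simp add: continuous_on_eq_continuous_at\<close>)
  then have hb: "has_bochner_integral lborel (\<lambda>t. ?f t * indicator {0..T} t) (T ^ 3 * (w (T *\<^sub>R x))\<^sup>2)" by simp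
  have "ennreal (T ^ 3 * (w (T *\<^sub>R x))\<^sup>2) = ennreal (norm (LINT t|lborel. ?f t * indicator {0..T} t))"
    using T by (simp add: has_bochner_integral_integral_eq[OF hb] abs_mult)
  also have "\<dots> \<le> (\<integral>\<^sup>+t. ennreal (norm (?f t * indicator {0..T} t)) \<partial>lborel)"
    using hb by (intro integral_norm_bound_ennreal) (auto simp: has_bochner_integral_iff)
  also have "\<dots> = (\<integral>\<^sup>+t. ennreal (t\<^sup>2 * \<bar>radial_flux w (t *\<^sub>R x)\<bar>) * indicator {0..T} t \<partial>lborel)"
    by (intro nn_integral_cong) (auto simp: abs_mult split: split_indicator)
  finally show ?thesis .
qed

lemma nn_integral_scale_lborel:
  fixes f :: "vec3 \<Rightarrow> ennreal"
  assumes "f \<in> borel_measurable borel" "t > 0"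
  shows "(\<integral>\<^sup>+x. f x \<partial>lborel) = ennreal (t ^ 3) * (\<integral>\<^sup>+x. f (t *\<^sub>R x) \<partial>lborel)"
proof -
  have "(\<integral>\<^sup>+x. f x \<partial>lborel) =
    (\<integral>\<^sup>+x. f x \<partial>density (distr lborel borel (\<lambda>x. 0 + t *\<^sub>R x)) (\<lambda>_. \<bar>t\<bar> ^ DIM(vec3)))"
    using lborel_affine[of t "0::vec3"] assms(2) by simp
  also have "\<dots> = ennreal (t ^ 3) * (\<integral>\<^sup>+x. f (t *\<^sub>R x) \<partial>lborel)"
    using assms by (subst nn_integral_density) (auto simp: nn_integral_distr nn_integral_cmult)
  finally show ?thesis .
qed

lemma nn_integral_inverse_4:
  assumes "a > 0"
  shows "(\<integral>\<^sup>+t. ennreal (1 / t ^ 4) * indicator {a..} t \<partial>lborel) = ennreal (1 / (3 * a ^ 3))"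
proof -
  have "(\<integral>\<^sup>+t. ennreal (1 / t ^ 4) * indicator {a..} t \<partial>lborel) = 0 - (- 1 / (3 * a ^ 3))"
  proof (rule nn_integral_FTC_atLeast)
    show "((\<lambda>t. - 1 / (3 * t ^ 3)) has_real_derivative 1 / t ^ 4) (at t)" if "a \<le> t" for t
      using that assms by (auto intro!: derivative_eq_intros simp: field_simps power_numeral_reduce)
    show "((\<lambda>t::real. - 1 / (3 * t ^ 3)) \<longlongrightarrow> 0) at_top" by real_asymp
  qed (use assms in auto)
  then show ?thesis by simp
qed

text \<open>A substitute for polar coordinates. For \<open>x\<close> in the ball the value of \<open>w\<^sup>2\<close> at the projection \<open>T x\<close>, where
  \<open>T = R / \<bar>x\<bar>\<close>, is at most \<open>T^(-3)\<close> times the integral of \<open>t\<^sup>2 \<bar>radial_flux w (t x)\<bar>\<close> over \<open>0 < t < T\<close>. Integrating over \<open>x\<close>,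
  exchanging the integrals and substituting \<open>y = t x\<close> leaves the weight
  \<open>(\<bar>y\<bar> / R)\<^sup>3\<close> times the integral of \<open>t^(-4)\<close> over \<open>t > \<bar>y\<bar> / R\<close>, which is the constant \<open>1/3\<close>.\<close>

lemma nn_integral_radial_projection:
  assumes w: "smooth w" and R: "R > 0"
  shows "(\<integral>\<^sup>+x. ennreal ((w ((R / norm x) *\<^sub>R x))\<^sup>2) * indicator (ball 0 R) x \<partial>lborel) \<le>
    ennreal (1 / 3) * (\<integral>\<^sup>+y. ennreal \<bar>radial_flux w y\<bar> * indicator (ball 0 R) y \<partial>lborel)"
proof -
  note [measurable] = radial_flux_measurable[OF w]
  have [measurable]: "ball (0::vec3) R \<in> sets borel" by simp
  \<comment> \<open>\<open>k t (t x)\<close> is \<open>t ^ (-3)\<close> times the integrand on the ray through \<open>x\<close>; the factor compensates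
      for the Jacobian of \<open>y = t x\<close>.\<close>
  define k where "k = (\<lambda>t (y::vec3). ennreal (1 / t ^ 4 * (norm y / R) ^ 3 * \<bar>radial_flux w y\<bar>)
      * indicator {0<..} t * of_bool (norm y < t * R) * of_bool (norm y < R))"
  have k_meas [measurable]: "(\<lambda>(t, y). k t y) \<in> borel_measurable (lborel \<Otimes>\<^sub>M lborel)"
    unfolding k_def by measurable
  have "(\<integral>\<^sup>+x. ennreal ((w ((R / norm x) *\<^sub>R x))\<^sup>2) * indicator (ball 0 R) x \<partial>lborel) \<le>
     (\<integral>\<^sup>+x. (\<integral>\<^sup>+t. ennreal (t ^ 3) * k t (t *\<^sub>R x) \<partial>lborel) \<partial>lborel)"
  proof (rule nn_integral_mono_AE)
    have "AE x in (lborel::vec3 measure). x \<noteq> 0" by (rule AE_lborel_singleton)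
    then show "AE x in lborel. ennreal ((w ((R / norm x) *\<^sub>R x))\<^sup>2) * indicator (ball 0 R) x
      \<le> (\<integral>\<^sup>+t. ennreal (t ^ 3) * k t (t *\<^sub>R x) \<partial>lborel)"
    proof (rule AE_mp, intro AE_I2 impI)
      fix x :: vec3 assume x: "x \<noteq> 0"
      show "ennreal ((w ((R / norm x) *\<^sub>R x))\<^sup>2) * indicator (ball 0 R) x
        \<le> (\<integral>\<^sup>+t. ennreal (t ^ 3) * k t (t *\<^sub>R x) \<partial>lborel)"
      proof (cases "norm x < R")
        case True
        define T where "T = R / norm x"
        have T: "T > 0" "T > 1" using x R True by (auto simp: T_def)
        have "ennreal ((w (T *\<^sub>R x))\<^sup>2) = ennreal (1 / T ^ 3) * ennreal (T ^ 3 * (w (T *\<^sub>R x))\<^sup>2)"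
          using T by (simp add: ennreal_mult'[symmetric])
        also have "\<dots> \<le> ennreal (1 / T ^ 3) *
            (\<integral>\<^sup>+t. ennreal (t\<^sup>2 * \<bar>radial_flux w (t *\<^sub>R x)\<bar>) * indicator {0..T} t \<partial>lborel)"
          using T by (intro mult_left_mono radial_FTC w) auto
        also have "\<dots> = (\<integral>\<^sup>+t. ennreal (1 / T ^ 3) * (ennreal (t\<^sup>2 * \<bar>radial_flux w (t *\<^sub>R x)\<bar>) * indicator {0..T} t) \<partial>lborel)"
          by (subst nn_integral_cmult) auto
        also have "\<dots> = (\<integral>\<^sup>+t. ennreal (t ^ 3) * k t (t *\<^sub>R x) \<partial>lborel)"
        proof (rule nn_integral_cong_AE)
          have "AE t in lborel. t \<noteq> 0" "AE t in lborel. t \<noteq> T" "AE t in lborel. t \<noteq> 1"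
            by (rule AE_lborel_singleton)+
          then show "AE t in lborel. ennreal (1 / T ^ 3) * (ennreal (t\<^sup>2 * \<bar>radial_flux w (t *\<^sub>R x)\<bar>) * indicator {0..T} t)
              = ennreal (t ^ 3) * k t (t *\<^sub>R x)"
          proof eventually_elim
            case (elim t)
            show ?case
            proof (cases "0 < t \<and> t < T")
              case t: True
              have "norm (t *\<^sub>R x) < R" using t x R by (simp add: T_def field_simps)
              moreover have "norm (t *\<^sub>R x) < t * R" using t True by simp
              ultimately have "k t (t *\<^sub>R x) = ennreal (1 / t ^ 4 * (norm (t *\<^sub>R x) / R) ^ 3 * \<bar>radial_flux w (t *\<^sub>R x)\<bar>)"
                using t by (simp add: k_def)
              moreover have "t ^ 3 * (1 / t ^ 4 * (norm (t *\<^sub>R x) / R) ^ 3 * \<bar>radial_flux w (t *\<^sub>R x)\<bar>)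
                 = 1 / T ^ 3 * (t\<^sup>2 * \<bar>radial_flux w (t *\<^sub>R x)\<bar>)"
                using t x R by (simp add: T_def field_simps power_numeral_reduce)
              ultimately show ?thesis using t T R
                by (auto simp: ennreal_mult'[symmetric] simp del: times_divide_eq_left times_divide_eq_right)
            next
              case t: False
              then have "t < 0 \<or> t > T" using elim by auto
              then show ?thesis
              proof
                assume "t > T"
                then have "t > 0" using T by simp
                moreover have "R < t * norm x" using \<open>t > T\<close> x R by (simp add: T_def field_simps)
                ultimately have "\<not> norm (t *\<^sub>R x) < R" by simp
                then show ?thesis using \<open>t > T\<close> by (simp only: k_def) simp
              qed (simp add: k_def)
            qed
          qed
        qed
        finally show ?thesis using True by (simp add: T_def)
      qed simp
    qed
  qed
  also have "\<dots> = (\<integral>\<^sup>+t. (\<integral>\<^sup>+x. ennreal (t ^ 3) * k t (t *\<^sub>R x) \<partial>lborel) \<partial>lborel)"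
    unfolding k_def by (rule lborel_pair.Fubini') measurable
  also have "\<dots> = (\<integral>\<^sup>+t. (\<integral>\<^sup>+y. k t y \<partial>lborel) \<partial>lborel)"
  proof (rule nn_integral_cong)
    fix t :: real
    show "(\<integral>\<^sup>+x. ennreal (t ^ 3) * k t (t *\<^sub>R x) \<partial>lborel) = (\<integral>\<^sup>+y. k t y \<partial>lborel)"
    proof (cases "t > 0")
      case True
      have [measurable]: "k t \<in> borel_measurable borel" unfolding k_def by measurable
      show ?thesis using True
        by (subst nn_integral_cmult) (auto simp: nn_integral_scale_lborel[of "k t" t])
    qed (simp add: k_def)
  qed
  also have "\<dots> = (\<integral>\<^sup>+y. (\<integral>\<^sup>+t. k t y \<partial>lborel) \<partial>lborel)"
    by (rule lborel_pair.Fubini') (simp add: k_meas)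
  also have "\<dots> = (\<integral>\<^sup>+y. ennreal (1 / 3) * (ennreal \<bar>radial_flux w y\<bar> * indicator (ball 0 R) y) \<partial>lborel)"
  proof (rule nn_integral_cong_AE)
    have "AE y in (lborel::vec3 measure). y \<noteq> 0" by (rule AE_lborel_singleton)
    then show "AE y in lborel. (\<integral>\<^sup>+t. k t y \<partial>lborel) = ennreal (1 / 3) * (ennreal \<bar>radial_flux w y\<bar> * indicator (ball 0 R) y)"
    proof (rule AE_mp, intro AE_I2 impI)
      fix y :: vec3 assume y: "y \<noteq> 0"
      define a where "a = norm y / R"
      have a: "a > 0" using y R by (simp add: a_def)
      have "(\<integral>\<^sup>+t. k t y \<partial>lborel) = (\<integral>\<^sup>+t. (ennreal (a ^ 3 * \<bar>radial_flux w y\<bar>) * indicator (ball 0 R) y) *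
          (ennreal (1 / t ^ 4) * indicator {a..} t) \<partial>lborel)"
      proof (rule nn_integral_cong_AE)
        have "AE t in lborel. t \<noteq> a" by (rule AE_lborel_singleton)
        then show "AE t in lborel. k t y = (ennreal (a ^ 3 * \<bar>radial_flux w y\<bar>) * indicator (ball 0 R) y) *
          (ennreal (1 / t ^ 4) * indicator {a..} t)"
        proof (rule AE_mp, intro AE_I2 impI)
          fix t assume "t \<noteq> a"
          moreover have "norm y < t * R \<longleftrightarrow> a < t" using R by (simp add: a_def field_simps)
          ultimately show "k t y = (ennreal (a ^ 3 * \<bar>radial_flux w y\<bar>) * indicator (ball 0 R) y) *
            (ennreal (1 / t ^ 4) * indicator {a..} t)"
            using a by (auto simp: k_def a_def[symmetric] ennreal_mult'[symmetric] mult_ac split: split_indicator)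
        qed
      qed
      also have "\<dots> = (ennreal (a ^ 3 * \<bar>radial_flux w y\<bar>) * indicator (ball 0 R) y) * ennreal (1 / (3 * a ^ 3))"
        by (subst nn_integral_cmult) (auto simp: nn_integral_inverse_4[OF a])
      also have "\<dots> = ennreal (1 / 3) * (ennreal \<bar>radial_flux w y\<bar> * indicator (ball 0 R) y)"
        using a by (auto simp: ennreal_mult'[symmetric] split: split_indicator)
      finally show "(\<integral>\<^sup>+t. k t y \<partial>lborel) = ennreal (1 / 3) * (ennreal \<bar>radial_flux w y\<bar> * indicator (ball 0 R) y)" .
    qed
  qed
  also have "\<dots> = ennreal (1 / 3) * (\<integral>\<^sup>+y. ennreal \<bar>radial_flux w y\<bar> * indicator (ball 0 R) y \<partial>lborel)"
    by (rule nn_integral_cmult) measurable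
  finally show ?thesis .
qed

lemma borel_radial_projection [measurable]:
  "(\<lambda>x. (R / norm x) *\<^sub>R x) \<in> measurable borel (borel :: vec3 measure)"
  by measurable

lemma sets_sphere_measure [simp, measurable_cong]: "sets (sphere_measure R) = sets borel"
  by (simp add: sphere_measure_def)

lemma space_sphere_measure [simp]: "space (sphere_measure R) = UNIV"
  by (simp add: sphere_measure_def space_scale_measure)

lemma nn_integral_lebesgue_on:
  fixes f :: "vec3 \<Rightarrow> ennreal"
  assumes "f \<in> borel_measurable borel" "U \<in> sets borel"
  shows "(\<integral>\<^sup>+x. f x \<partial>lebesgue_on U) = (\<integral>\<^sup>+x. f x * indicator U x \<partial>lborel)"
  using assms by (subst nn_integral_restrict_space) (auto simp: nn_integral_completion)

lemma nn_integral_sphere_measure: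
  assumes f: "f \<in> borel_measurable borel"
  shows "(\<integral>\<^sup>+z. f z \<partial>sphere_measure R) =
    ennreal (3 / R) * (\<integral>\<^sup>+x. f ((R / norm x) *\<^sub>R x) * indicator (ball 0 R) x \<partial>lborel)"
proof -
  have p: "(\<lambda>x::vec3. (R / norm x) *\<^sub>R x) \<in> measurable (lebesgue_on (ball 0 R)) borel"
    by (intro measurable_restrict_space1 measurable_completion) simp
  show ?thesis unfolding sphere_measure_def using f
    by (subst nn_integral_scale_measure, simp, subst nn_integral_distr[OF p], simp)
       (simp add: nn_integral_lebesgue_on)
qed

lemma AE_sphere_measure: "AE z in sphere_measure R. norm z = \<bar>R\<bar>"
proof -
  have "(\<integral>\<^sup>+z. indicator {z. norm z \<noteq> \<bar>R\<bar>} z \<partial>sphere_measure R) = 0"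
  proof (subst nn_integral_sphere_measure)
    show "indicator {z. norm z \<noteq> \<bar>R\<bar>} \<in> borel_measurable (borel :: vec3 measure)" by measurable
    have "AE x in (lborel::vec3 measure). x \<noteq> 0" by (rule AE_lborel_singleton)
    then have "AE x in (lborel::vec3 measure). indicator {z::vec3. norm z \<noteq> \<bar>R\<bar>} ((R / norm x) *\<^sub>R x) * indicator (ball 0 R) x = (0::ennreal)"
      by (rule AE_mp) (auto intro!: AE_I2)
    then have "(\<integral>\<^sup>+x. indicator {z::vec3. norm z \<noteq> \<bar>R\<bar>} ((R / norm x) *\<^sub>R x) * indicator (ball 0 R) x \<partial>lborel) = (\<integral>\<^sup>+x. 0 \<partial>(lborel::vec3 measure))"
      by (intro nn_integral_cong_AE)
    then show "ennreal (3 / R) * (\<integral>\<^sup>+x. indicator {z::vec3. norm z \<noteq> \<bar>R\<bar>} ((R / norm x) *\<^sub>R x) * indicator (ball 0 R) x \<partial>lborel) = 0"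
      by simp
  qed
  then have "emeasure (sphere_measure R) {z. norm z \<noteq> \<bar>R\<bar>} = 0" by simp
  then show ?thesis by (intro AE_I[where N="{z. norm z \<noteq> \<bar>R\<bar>}"]) auto
qed

lemma finite_measure_sphere_measure: "finite_measure (sphere_measure R)"
proof
  have "(\<integral>\<^sup>+z. 1 \<partial>sphere_measure R) = ennreal (3 / R) * (\<integral>\<^sup>+x. 1 * indicator (ball 0 R) x \<partial>(lborel::vec3 measure))"
    by (rule nn_integral_sphere_measure) simp
  also have "\<dots> \<noteq> \<infinity>"
    using emeasure_lborel_ball_finite[of "0::vec3" R] by (simp add: ennreal_mult_eq_top_iff less_top)
  finally show "emeasure (sphere_measure R) (space (sphere_measure R)) \<noteq> \<infinity>" by simp
qed

lemma continuous_integrable_sphere: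
  fixes f :: scalar_field
  assumes "continuous_on UNIV f"
  shows "integrable (sphere_measure R) f"
proof -
  interpret finite_measure "sphere_measure R" by (rule finite_measure_sphere_measure)
  have "compact (f ` cball 0 \<bar>R\<bar>)"
    by (intro compact_continuous_image compact_cball continuous_on_subset[OF assms]) auto
  then obtain B where "\<forall>y\<in>f ` cball 0 \<bar>R\<bar>. norm y \<le> B" using bounded_iff compact_imp_bounded by metis
  then have B: "norm (f z) \<le> B" if "norm z = \<bar>R\<bar>" for z using that by simp
  show ?thesis
  proof (rule integrable_const_bound[where B=B])
    show "AE z in sphere_measure R. norm (f z) \<le> B"
      using AE_sphere_measure by (rule AE_mp) (use B in \<open>auto intro!: AE_I2\<close>)
    show "f \<in> borel_measurable (sphere_measure R)"
      using borel_measurable_continuous_onI[OF assms] by (simp cong: measurable_cong_sets)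
  qed
qed

lemma continuous_integrable_ball:
  fixes f :: scalar_field
  assumes "continuous_on (cball 0 R) f"
  shows "integrable (lebesgue_on (ball 0 R)) f"
proof -
  have "integrable lborel (\<lambda>x. indicator (cball 0 R) x *\<^sub>R f x)"
    by (intro borel_integrable_compact assms compact_cball)
  then have "set_integrable lebesgue (cball 0 R) f"
    unfolding set_integrable_def by (intro integrable_completion[THEN iffD2]) auto
  then have "set_integrable lebesgue (ball 0 R) f"
    by (rule set_integrable_subset) auto
  then show ?thesis by (simp add: set_integrable_def integrable_restrict_space)
qed

text \<open>On the ball the radial flux is bounded by \<open>w\<^sup>2\<close> and the squared gradient, so the projection estimate
  controls the boundary values of \<open>w\<close> by its \<open>H\<^sup>1\<close> norm.\<close>

theorem trace_inequality:
  assumes w: "smooth w" and R: "R > 0"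
  shows "(LINT z|sphere_measure R. (w z)\<^sup>2) \<le>
     (1 / R) * (4 * (LINT x|lebesgue_on (ball 0 R). (w x)\<^sup>2) +
                3 * R\<^sup>2 * (\<Sum>i\<in>UNIV. LINT x|lebesgue_on (ball 0 R). (partial i w x)\<^sup>2))"
proof -
  let ?B = "lebesgue_on (ball (0::vec3) R)"
  have cw: "continuous_on S w" "continuous_on S (partial i w)" for i S
    using w by (auto intro: smooth_imp_continuous smooth_partial)
  have mw [measurable]: "w \<in> borel_measurable borel" by (intro borel_measurable_continuous_onI cw)
  note [measurable] = radial_flux_measurable[OF w]
  have ib: "integrable ?B f" if "continuous_on UNIV f" for f :: scalar_field
    using that continuous_on_subset by (intro continuous_integrable_ball) blast
  have i1: "integrable ?B (\<lambda>x. (w x)\<^sup>2)" "integrable ?B (\<lambda>x. (partial i w x)\<^sup>2)" for i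
    by (intro ib continuous_intros cw)+
  have i2: "integrable ?B (\<lambda>x. \<bar>radial_flux w x\<bar>)"
    by (intro ib continuous_intros continuous_radial_flux w)
  have pt: "\<bar>radial_flux w x\<bar> \<le> 4 * (w x)\<^sup>2 + 3 * R\<^sup>2 * (\<Sum>i\<in>UNIV. (partial i w x)\<^sup>2)" if "norm x < R" for x
  proof -
    let ?s = "\<Sum>i\<in>UNIV. x $ i * partial i w x"
    have "?s\<^sup>2 \<le> (\<Sum>i\<in>UNIV. (x $ i)\<^sup>2) * (\<Sum>i\<in>UNIV. (partial i w x)\<^sup>2)"
      by (rule Cauchy_Schwarz_ineq_sum)
    also have "(\<Sum>i\<in>UNIV. (x $ i)\<^sup>2) = (norm x)\<^sup>2"
      by (simp add: norm_vec_def L2_set_def sum_nonneg)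
    also have "(norm x)\<^sup>2 * (\<Sum>i\<in>UNIV. (partial i w x)\<^sup>2) \<le> R\<^sup>2 * (\<Sum>i\<in>UNIV. (partial i w x)\<^sup>2)"
      using that by (intro mult_right_mono power_mono sum_nonneg) auto
    finally have s: "?s\<^sup>2 \<le> R\<^sup>2 * (\<Sum>i\<in>UNIV. (partial i w x)\<^sup>2)" .
    have "\<bar>2 * w x * ?s\<bar> \<le> (w x)\<^sup>2 + ?s\<^sup>2"
      using sum_squares_bound[of "\<bar>w x\<bar>" "\<bar>?s\<bar>"] by (simp add: abs_mult)
    moreover have "0 \<le> R\<^sup>2 * (\<Sum>i\<in>UNIV. (partial i w x)\<^sup>2)" by (intro mult_nonneg_nonneg sum_nonneg) auto
    moreover have "\<bar>radial_flux w x\<bar> \<le> 3 * (w x)\<^sup>2 + \<bar>2 * w x * ?s\<bar>"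
      unfolding radial_flux_def by (rule order_trans[OF abs_triangle_ineq]) simp
    ultimately show ?thesis using s by linarith
  qed
  have "(\<integral>\<^sup>+z. ennreal ((w z)\<^sup>2) \<partial>sphere_measure R) =
      ennreal (3 / R) * (\<integral>\<^sup>+x. ennreal ((w ((R / norm x) *\<^sub>R x))\<^sup>2) * indicator (ball 0 R) x \<partial>lborel)"
    by (rule nn_integral_sphere_measure) measurable
  also have "\<dots> \<le> ennreal (3 / R) * (ennreal (1 / 3) * (\<integral>\<^sup>+y. ennreal \<bar>radial_flux w y\<bar> * indicator (ball 0 R) y \<partial>lborel))"
    by (intro mult_left_mono nn_integral_radial_projection w R) auto
  also have "(\<integral>\<^sup>+y. ennreal \<bar>radial_flux w y\<bar> * indicator (ball 0 R) y \<partial>lborel) = (\<integral>\<^sup>+y. ennreal \<bar>radial_flux w y\<bar> \<partial>?B)"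
    by (rule nn_integral_lebesgue_on[symmetric]) measurable
  also have "\<dots> = ennreal (LINT y|?B. \<bar>radial_flux w y\<bar>)"
    by (rule nn_integral_eq_integral[OF i2]) simp
  also have "ennreal (3 / R) * (ennreal (1 / 3) * ennreal (LINT y|?B. \<bar>radial_flux w y\<bar>)) =
      ennreal ((1 / R) * (LINT y|?B. \<bar>radial_flux w y\<bar>))"
    using R by (simp add: ennreal_mult'[symmetric])
  finally have le: "(\<integral>\<^sup>+z. ennreal ((w z)\<^sup>2) \<partial>sphere_measure R) \<le> ennreal ((1 / R) * (LINT y|?B. \<bar>radial_flux w y\<bar>))" .
  have "integrable (sphere_measure R) (\<lambda>z. (w z)\<^sup>2)"
    by (intro continuous_integrable_sphere continuous_intros cw)
  from nn_integral_eq_integral[OF this] le have "(LINT z|sphere_measure R. (w z)\<^sup>2) \<le> (1 / R) * (LINT y|?B. \<bar>radial_flux w y\<bar>)"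
    using R by (simp add: ennreal_le_iff)
  also have "\<dots> \<le> (1 / R) * (LINT x|?B. 4 * (w x)\<^sup>2 + 3 * R\<^sup>2 * (\<Sum>i\<in>UNIV. (partial i w x)\<^sup>2))"
    using R pt i1 i2 by (intro mult_left_mono integral_mono) auto
  also have "(LINT x|?B. 4 * (w x)\<^sup>2 + 3 * R\<^sup>2 * (\<Sum>i\<in>UNIV. (partial i w x)\<^sup>2)) =
     4 * (LINT x|?B. (w x)\<^sup>2) + 3 * R\<^sup>2 * (\<Sum>i\<in>UNIV. LINT x|?B. (partial i w x)\<^sup>2)"
    using i1 by simp
  finally show ?thesis .
qed

lemma borel_measurable_lebesgue_on_AE:
  fixes f g :: scalar_field
  assumes U: "U \<in> sets lebesgue" and f: "f \<in> borel_measurable (lebesgue_on U)"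
    and ae: "AE x in lebesgue_on U. f x = g x"
  shows "g \<in> borel_measurable (lebesgue_on U)"
proof -
  have "(\<lambda>x. if x \<in> U then f x else 0) \<in> borel_measurable lebesgue"
    using f U by (simp add: borel_measurable_if)
  moreover have "AE x in lebesgue. (if x \<in> U then f x else 0) = (if x \<in> U then g x else 0)"
    using ae unfolding AE_lebesgue_on_iff[OF U] by (rule AE_mp) (auto intro!: AE_I2)
  ultimately have "(\<lambda>x. if x \<in> U then g x else 0) \<in> borel_measurable lebesgue"
    by (rule borel_measurable_AE)
  then show ?thesis using U by (simp add: borel_measurable_if)
qed

lemma smooth_has_weak_partial: "open U \<Longrightarrow> smooth f \<Longrightarrow> has_weak_partial U i f (partial i f)"
  by (intro C1_imp_has_weak_partial smooth_imp_continuous smooth_partial has_pd_partial smooth_imp_differentiable)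

lemma smooth_L2: "smooth f \<Longrightarrow> L2_on (ball 0 R) f"
  unfolding L2_on_def
  by (intro conjI borel_measurable_integrable continuous_integrable_ball continuous_intros smooth_imp_continuous)

lemma smooth_sobolev_H: "smooth f \<Longrightarrow> sobolev_H k (ball 0 R) f"
  by (induction k arbitrary: f) (auto intro: smooth_L2 smooth_partial smooth_has_weak_partial[OF open_ball])

lemma smooth_weak_partial_AE:
  "smooth f \<Longrightarrow> AE x in lebesgue_on (ball 0 R). weak_partial (ball 0 R) i f x = partial i f x"
  by (intro weak_partial_AE smooth_has_weak_partial) auto

lemma smooth_has_trace:
  assumes u: "smooth u"
  shows "has_trace R u u"
  unfolding has_trace_def
proof (intro conjI exI[of _ "\<lambda>_. u"] allI)
  show "sobolev_H 1 (ball 0 R) u" by (rule smooth_sobolev_H[OF u])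
  show "u \<in> borel_measurable borel" by (intro borel_measurable_continuous_onI smooth_imp_continuous u)
  show "integrable (sphere_measure R) (\<lambda>z. (u z)\<^sup>2)"
    by (intro continuous_integrable_sphere continuous_intros smooth_imp_continuous u)
  fix i
  have "(LINT x|lebesgue_on (ball 0 R). (partial i u x - weak_partial (ball 0 R) i u x)\<^sup>2) = 0"
    by (rule integral_eq_zero_AE) (rule AE_mp[OF smooth_weak_partial_AE[OF u, of R i]], auto)
  then show "(\<lambda>n. LINT x|lebesgue_on (ball 0 R). (partial i u x - weak_partial (ball 0 R) i u x)\<^sup>2) \<longlonglongrightarrow> 0"
    by simp
qed (use u in auto)

text \<open>If \<open>w n\<close> are the smooth functions whose boundary values define the trace \<open>g\<close>, the trace inequality applied to
  \<open>w n - u\<close> shows that these boundary values also converge to \<open>u\<close> in \<open>L\<^sup>2\<close> of the sphere.\<close>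

theorem smooth_trace_unique:
  assumes u: "smooth u" and g: "has_trace R u g" and R: "R > 0"
  shows "AE z in sphere_measure R. g z = u z"
proof -
  let ?B = "lebesgue_on (ball (0::vec3) R)" and ?S = "sphere_measure R"
  obtain w where w: "\<And>n. smooth (w n)"
      and w0: "(\<lambda>n. LINT x|?B. (w n x - u x)\<^sup>2) \<longlonglongrightarrow> 0"
      and w1: "\<And>i. (\<lambda>n. LINT x|?B. (partial i (w n) x - weak_partial (ball 0 R) i u x)\<^sup>2) \<longlonglongrightarrow> 0"
      and w2: "(\<lambda>n. LINT z|?S. (w n z - g z)\<^sup>2) \<longlonglongrightarrow> 0"
    and gm: "g \<in> borel_measurable borel" and gi: "integrable ?S (\<lambda>z. (g z)\<^sup>2)"
    using g unfolding has_trace_def by blast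
  define v where "v = (\<lambda>n x. w n x - u x)"
  have v: "smooth (v n)" for n unfolding v_def by (intro smooth_diff w u)
  have pv: "partial i (v n) x = partial i (w n) x - partial i u x" for i n x
  proof -
    have "((\<lambda>x. w n x - u x) has_derivative
       (\<lambda>h. frechet_derivative (w n) (at x) h - frechet_derivative u (at x) h)) (at x)"
      using smooth_imp_differentiable[OF w[of n], of x] smooth_imp_differentiable[OF u, of x]
      unfolding frechet_derivative_works by (intro has_derivative_diff)
    from partial_eq[OF this] show ?thesis by (simp add: v_def partial_def)
  qed
  have "(LINT x|?B. (partial i (w n) x - weak_partial (ball 0 R) i u x)\<^sup>2) = (LINT x|?B. (partial i (v n) x)\<^sup>2)" for i n
  proof (rule integral_cong_AE)
    have m: "f \<in> borel_measurable ?B" if "smooth f" for f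
      by (intro borel_measurable_integrable continuous_integrable_ball smooth_imp_continuous that)
    have sy: "AE x in ?B. partial i u x = weak_partial (ball 0 R) i u x"
      using smooth_weak_partial_AE[OF u, of R i] by (rule AE_mp) auto
    have "weak_partial (ball 0 R) i u \<in> borel_measurable ?B"
      by (rule borel_measurable_lebesgue_on_AE[OF _ m[OF smooth_partial[OF u, of i]] sy]) simp
    then show "(\<lambda>x. (partial i (w n) x - weak_partial (ball 0 R) i u x)\<^sup>2) \<in> borel_measurable ?B"
      using m[OF smooth_partial[OF w]] by measurable
    show "(\<lambda>x. (partial i (v n) x)\<^sup>2) \<in> borel_measurable ?B"
      using m[OF smooth_partial[OF v]] by measurable
    show "AE x in ?B. (partial i (w n) x - weak_partial (ball 0 R) i u x)\<^sup>2 = (partial i (v n) x)\<^sup>2"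
      using sy by (rule AE_mp) (auto simp: pv intro!: AE_I2)
  qed
  with w1 have v1: "(\<lambda>n. LINT x|?B. (partial i (v n) x)\<^sup>2) \<longlonglongrightarrow> 0" for i by simp
  have ui: "integrable ?S (\<lambda>z. (u z)\<^sup>2)" "integrable ?S (\<lambda>z. (v n z)\<^sup>2)" "integrable ?S (\<lambda>z. (w n z)\<^sup>2)" for n
    by (intro continuous_integrable_sphere continuous_intros smooth_imp_continuous u v w)+
  have sm [measurable]: "u \<in> borel_measurable borel" "w n \<in> borel_measurable borel" for n
    by (intro borel_measurable_continuous_onI smooth_imp_continuous u w)+
  note gm [measurable]
  have sq: "(a - b)\<^sup>2 \<le> 2 * a\<^sup>2 + 2 * b\<^sup>2" for a b :: real
    using sum_squares_ge_zero[of "a + b" 0] by (simp add: power2_eq_square algebra_simps)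
  have idiff: "integrable ?S (\<lambda>z. (f z - g z)\<^sup>2)"
    if [measurable]: "f \<in> borel_measurable borel" and fi: "integrable ?S (\<lambda>z. (f z)\<^sup>2)" for f
  proof (rule Bochner_Integration.integrable_bound)
    show "integrable ?S (\<lambda>z. 2 * (f z)\<^sup>2 + 2 * (g z)\<^sup>2)" using fi gi by auto
    show "AE z in ?S. norm ((f z - g z)\<^sup>2) \<le> norm (2 * (f z)\<^sup>2 + 2 * (g z)\<^sup>2)"
      using sq by (intro AE_I2) simp
  qed measurable
  have i3: "integrable ?S (\<lambda>z. (u z - g z)\<^sup>2)" "integrable ?S (\<lambda>z. (w n z - g z)\<^sup>2)" for n
    by (intro idiff ui sm)+
  have "(LINT z|?S. (u z - g z)\<^sup>2) \<le> 2 * ((1 / R) * (4 * (LINT x|?B. (v n x)\<^sup>2) +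
                3 * R\<^sup>2 * (\<Sum>i\<in>UNIV. LINT x|?B. (partial i (v n) x)\<^sup>2))) + 2 * (LINT z|?S. (w n z - g z)\<^sup>2)" for n
  proof -
    have "(LINT z|?S. (u z - g z)\<^sup>2) \<le> (LINT z|?S. 2 * (v n z)\<^sup>2 + 2 * (w n z - g z)\<^sup>2)"
    proof (rule integral_mono)
      show "(u z - g z)\<^sup>2 \<le> 2 * (v n z)\<^sup>2 + 2 * (w n z - g z)\<^sup>2" for z
        using sq[of "w n z - g z" "v n z"] by (simp add: v_def)
    qed (use i3 ui in auto)
    also have "\<dots> = 2 * (LINT z|?S. (v n z)\<^sup>2) + 2 * (LINT z|?S. (w n z - g z)\<^sup>2)"
      using i3 ui by simp
    finally show ?thesis using trace_inequality[OF v[of n] R] by linarith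
  qed
  moreover have "(\<lambda>n. 2 * ((1 / R) * (4 * (LINT x|?B. (v n x)\<^sup>2) +
                3 * R\<^sup>2 * (\<Sum>i\<in>UNIV. LINT x|?B. (partial i (v n) x)\<^sup>2))) + 2 * (LINT z|?S. (w n z - g z)\<^sup>2))
       \<longlonglongrightarrow> 2 * ((1 / R) * (4 * 0 + 3 * R\<^sup>2 * (\<Sum>i\<in>(UNIV::3 set). 0))) + 2 * 0"
    using w0 by (intro tendsto_intros v1 w2) (simp add: v_def)
  ultimately have "(LINT z|?S. (u z - g z)\<^sup>2) \<le> 0"
    by (intro LIMSEQ_le_const) auto
  moreover have "0 \<le> (LINT z|?S. (u z - g z)\<^sup>2)" by (rule integral_nonneg_AE) auto
  ultimately have "AE z in ?S. (u z - g z)\<^sup>2 = 0"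
    using integral_nonneg_eq_0_iff_AE[OF i3(1)] by simp
  then show ?thesis by (rule AE_mp) auto
qed

lemma smooth_trace_on_sphere:
  assumes "smooth u" "R > 0"
  shows "AE z in sphere_measure R. trace_on_sphere R u z = u z"
    and "trace_on_sphere R u \<in> borel_measurable borel"
proof -
  have "has_trace R u (trace_on_sphere R u)"
    unfolding trace_on_sphere_def by (rule someI[of "has_trace R u"]) (rule smooth_has_trace[OF assms(1)])
  then show "AE z in sphere_measure R. trace_on_sphere R u z = u z"
    "trace_on_sphere R u \<in> borel_measurable borel"
    using smooth_trace_unique assms by (auto simp: has_trace_def)
qed

section \<open>Newtonian potentials of finite measures\<close>

lemma nn_integral_inverse_3:
  assumes "a > 0"
  shows "(\<integral>\<^sup>+t. ennreal (2 / t ^ 3) * indicator {a..} t \<partial>lborel) = ennreal (1 / a\<^sup>2)"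
proof -
  have "(\<integral>\<^sup>+t. ennreal (2 / t ^ 3) * indicator {a..} t \<partial>lborel) = 0 - (- 1 / a\<^sup>2)"
  proof (rule nn_integral_FTC_atLeast)
    show "((\<lambda>t. - 1 / t\<^sup>2) has_real_derivative 2 / t ^ 3) (at t)" if "a \<le> t" for t
      using that assms by (auto intro!: derivative_eq_intros simp: field_simps power_numeral_reduce)
    show "((\<lambda>t::real. - 1 / t\<^sup>2) \<longlongrightarrow> 0) at_top" by real_asymp
  qed (use assms in auto)
  then show ?thesis by simp
qed

text \<open>Write \<open>1 / \<bar>x\<bar>\<^sup>2\<close> as the integral of \<open>2 / t\<^sup>3\<close> over \<open>t \<ge> \<bar>x\<bar>\<close> and exchange integrals: for \<open>t < 1\<close> the ball of radius
  \<open>t\<close> has volume of order \<open>t\<^sup>3\<close>, which cancels the singularity.\<close>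

lemma nn_integral_inverse_square_unit_ball:
  "(\<integral>\<^sup>+x. ennreal (1 / (norm x)\<^sup>2) * indicator (ball 0 1) x \<partial>(lborel :: vec3 measure)) < \<infinity>"
proof -
  define c where "c = unit_ball_vol 3"
  have c: "c \<ge> 0" by (simp add: c_def)
  define k where "k = (\<lambda>t (x::vec3). ennreal (2 / t ^ 3) * (of_bool (0 < t) * of_bool (norm x \<le> t) * of_bool (norm x < 1)))"
  have km: "(\<lambda>(x, t). k t x) \<in> borel_measurable (lborel \<Otimes>\<^sub>M lborel)"
    unfolding k_def by measurable
  have "(\<integral>\<^sup>+x. ennreal (1 / (norm x)\<^sup>2) * indicator (ball 0 1) x \<partial>(lborel :: vec3 measure)) =
        (\<integral>\<^sup>+x. (\<integral>\<^sup>+t. k t x \<partial>lborel) \<partial>lborel)"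
  proof (rule nn_integral_cong_AE)
    have "AE y in (lborel::vec3 measure). y \<noteq> 0" by (rule AE_lborel_singleton)
    then show "AE x in (lborel :: vec3 measure). ennreal (1 / (norm x)\<^sup>2) * indicator (ball 0 1) x = (\<integral>\<^sup>+t. k t x \<partial>lborel)"
    proof (rule AE_mp, intro AE_I2 impI)
      fix x :: vec3 assume x: "x \<noteq> 0"
      have "(\<integral>\<^sup>+t. k t x \<partial>lborel) = (\<integral>\<^sup>+t. indicator (ball 0 1) x * (ennreal (2 / t ^ 3) * indicator {norm x..} t) \<partial>lborel)"
        using x by (intro nn_integral_cong) (auto simp: k_def less_le_trans[of 0 "norm x"] split: split_indicator)
      also have "\<dots> = indicator (ball 0 1) x * ennreal (1 / (norm x)\<^sup>2)"
        using x by (subst nn_integral_cmult) (auto simp: nn_integral_inverse_3)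
      finally show "ennreal (1 / (norm x)\<^sup>2) * indicator (ball 0 1) x = (\<integral>\<^sup>+t. k t x \<partial>lborel)"
        by (simp add: mult.commute)
    qed
  qed
  also have "\<dots> = (\<integral>\<^sup>+t. (\<integral>\<^sup>+x. k t x \<partial>lborel) \<partial>lborel)"
    by (rule lborel_pair.Fubini'[symmetric]) (use km in simp)
  also have "\<dots> \<le> (\<integral>\<^sup>+t. ennreal (2 * c) * indicator {0..1} t + ennreal c * (ennreal (2 / t ^ 3) * indicator {1..} t) \<partial>lborel)"
  proof (rule nn_integral_mono)
    fix t :: real
    show "(\<integral>\<^sup>+x. k t x \<partial>lborel) \<le> ennreal (2 * c) * indicator {0..1} t + ennreal c * (ennreal (2 / t ^ 3) * indicator {1..} t)"
    proof (cases "t > 0")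
      case True
      define s where "s = min t 1"
      have s: "s > 0" "s \<le> t" "s \<le> 1" using True by (auto simp: s_def)
      have "(\<integral>\<^sup>+x. k t x \<partial>lborel) \<le> (\<integral>\<^sup>+x. ennreal (2 / t ^ 3) * indicator (cball 0 s) x \<partial>(lborel::vec3 measure))"
        by (intro nn_integral_mono) (auto simp: k_def s_def split: split_indicator)
      also have "\<dots> = ennreal (2 / t ^ 3) * ennreal (c * s ^ 3)"
        using s by (subst nn_integral_cmult_indicator) (auto simp: emeasure_cball c_def)
      also have "\<dots> = ennreal (2 / t ^ 3 * (c * s ^ 3))"
        using c s True by (simp add: ennreal_mult'[symmetric])
      also have "\<dots> \<le> ennreal (2 * c) * indicator {0..1} t + ennreal c * (ennreal (2 / t ^ 3) * indicator {1..} t)"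
      proof (cases "t < 1")
        case t: True
        then have "2 / t ^ 3 * (c * s ^ 3) = 2 * c" using True by (simp add: s_def)
        then show ?thesis using t True by simp
      next
        case t: False
        then have eq: "2 / t ^ 3 * (c * s ^ 3) = c * (2 / t ^ 3)" by (simp add: s_def)
        show ?thesis unfolding eq using t True c by (simp add: ennreal_mult' del: times_divide_eq_right)
      qed
      finally show ?thesis .
    qed (simp add: k_def)
  qed
  also have "\<dots> = ennreal (2 * c) + ennreal c * ennreal (1 / 1\<^sup>2)"
    by (subst nn_integral_add) (auto simp: nn_integral_cmult nn_integral_inverse_3[of 1, simplified])
  also have "\<dots> < \<infinity>" by (simp add: ennreal_mult'[symmetric] c flip: ennreal_plus)
  finally show ?thesis .
qed

lemma lborel_translation_nn_integral:
  fixes f :: "vec3 \<Rightarrow> ennreal"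
  assumes "f \<in> borel_measurable borel"
  shows "(\<integral>\<^sup>+x. f (x - a) \<partial>lborel) = (\<integral>\<^sup>+x. f x \<partial>lborel)"
proof -
  have "(\<integral>\<^sup>+x. f x \<partial>lborel) = (\<integral>\<^sup>+x. f x \<partial>distr lborel borel ((+) (- a)))"
    by (simp add: lborel_distr_plus)
  also have "\<dots> = (\<integral>\<^sup>+x. f (- a + x) \<partial>lborel)" using assms by (subst nn_integral_distr) auto
  finally show ?thesis by simp
qed

text \<open>Both the Newton kernel and its gradient are dominated by \<open>1 + 1 / \<bar>x\<bar>\<^sup>2\<close>, whose integral over a
  ball is bounded independently of where the singularity sits.\<close>

lemma inverse_square_kernel_bound:
  obtains C where "C \<ge> 0"
    "\<And>y::vec3. (\<integral>\<^sup>+x. ennreal (1 + 1 / (norm (x - y))\<^sup>2) * indicator (ball 0 R) x \<partial>lborel) \<le> ennreal C"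
proof -
  let ?k = "\<lambda>x::vec3. ennreal (1 / (norm x)\<^sup>2) * indicator (ball 0 1) x"
  have [measurable]: "ball (0::vec3) r \<in> sets borel" for r by simp
  have km [measurable]: "?k \<in> borel_measurable borel" by measurable
  define D where "D = 2 * emeasure lborel (ball (0::vec3) R) + (\<integral>\<^sup>+x. ?k x \<partial>lborel)"
  have D: "D < \<infinity>" unfolding D_def
    using nn_integral_inverse_square_unit_ball emeasure_lborel_ball_finite[of "0::vec3" R]
    by (auto simp: ennreal_add_less_top ennreal_mult_less_top)
  have "(\<integral>\<^sup>+x. ennreal (1 + 1 / (norm (x - y))\<^sup>2) * indicator (ball 0 R) x \<partial>lborel) \<le> D" for y :: vec3
  proof -
    have "(\<integral>\<^sup>+x. ennreal (1 + 1 / (norm (x - y))\<^sup>2) * indicator (ball 0 R) x \<partial>lborel) \<le>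
      (\<integral>\<^sup>+x. 2 * indicator (ball 0 R) x + ?k (x - y) \<partial>lborel)"
    proof (rule nn_integral_mono)
      fix x :: vec3
      show "ennreal (1 + 1 / (norm (x - y))\<^sup>2) * indicator (ball 0 R) x \<le> 2 * indicator (ball 0 R) x + ?k (x - y)"
      proof (cases "norm (x - y) < 1")
        case True
        have "ennreal (1 + 1 / (norm (x - y))\<^sup>2) \<le> 2 + ennreal (1 / (norm (x - y))\<^sup>2)"
          by (subst ennreal_plus) (auto intro!: add_right_mono simp: one_le_numeral)
        then show ?thesis using True by (auto split: split_indicator)
      next
        case False
        then have "1 \<le> (norm (x - y))\<^sup>2" by simp
        then have "1 + 1 / (norm (x - y))\<^sup>2 \<le> 2" by (simp add: divide_le_eq)
        then have "ennreal (1 + 1 / (norm (x - y))\<^sup>2) \<le> ennreal 2" by (rule ennreal_leI)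
        then show ?thesis using False by (auto split: split_indicator)
      qed
    qed
    also have "\<dots> = (\<integral>\<^sup>+x. 2 * indicator (ball 0 R) x \<partial>(lborel::vec3 measure)) + (\<integral>\<^sup>+x. ?k (x - y) \<partial>lborel)"
      by (rule nn_integral_add) measurable
    also have "\<dots> = D" unfolding D_def
      by (subst lborel_translation_nn_integral[OF km], subst nn_integral_cmult) auto
    finally show ?thesis .
  qed
  moreover have "D = ennreal (enn2real D)" using D by (simp add: less_top)
  ultimately show ?thesis by (intro that[of "enn2real D"]) auto
qed

lemma test_function_bounded:
  assumes "test_function U \<phi>"
  obtains B where "B \<ge> 0" "\<And>x. \<bar>\<phi> x\<bar> \<le> B" "\<And>x. \<bar>partial i \<phi> x\<bar> \<le> B"
proof -
  obtain K where K: "compact K" "\<And>x. x \<notin> K \<Longrightarrow> \<phi> x = 0" "\<And>x i. x \<notin> K \<Longrightarrow> partial i \<phi> x = 0"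
    and s: "smooth \<phi>" using test_functionD[OF assms] by metis
  have "bounded (f ` K)" if "continuous_on UNIV f" for f :: scalar_field
    by (intro compact_imp_bounded compact_continuous_image K continuous_on_subset[OF that]) auto
  then obtain B1 B2 where "\<forall>y\<in>\<phi> ` K. norm y \<le> B1" "\<forall>y\<in>partial i \<phi> ` K. norm y \<le> B2"
    using smooth_imp_continuous[OF s] smooth_imp_continuous[OF smooth_partial[OF s]] unfolding bounded_iff by metis
  then have "\<bar>\<phi> x\<bar> \<le> max 0 (max B1 B2)" "\<bar>partial i \<phi> x\<bar> \<le> max 0 (max B1 B2)" for x
    using K(2,3)[of x] by (cases "x \<in> K"; force simp: le_max_iff_disj)+
  then show ?thesis by (intro that[of "max 0 (max B1 B2)"]) auto
qed

lemma inverse_le_1_plus_inverse_square: "r \<ge> 0 \<Longrightarrow> 1 / r \<le> 1 + 1 / r\<^sup>2" for r :: real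
proof (cases "r \<ge> 1")
  case True
  then have "1 / r \<le> 1" by simp
  also have "1 \<le> 1 + 1 / r\<^sup>2" by simp
  finally show ?thesis .
next
  case False
  assume "r \<ge> 0"
  with False have "r\<^sup>2 \<le> r" by (simp add: power2_eq_square mult_left_le_one_le)
  then have "1 / r \<le> 1 / r\<^sup>2" using \<open>r \<ge> 0\<close> by (cases "r = 0") (auto intro!: divide_left_mono)
  then show ?thesis by simp
qed

text \<open>The Newton kernel and its gradient for \<open>e = 0\<close>; for \<open>e > 0\<close> a mollified pair that is smooth
  across the singularity.\<close>

definition newton_kernel :: "real \<Rightarrow> scalar_field" where
  "newton_kernel e v = 1 / sqrt (e\<^sup>2 + (norm v)\<^sup>2)"

definition newton_grad :: "real \<Rightarrow> 3 \<Rightarrow> scalar_field" where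
  "newton_grad e i v = - (v $ i) / (sqrt (e\<^sup>2 + (norm v)\<^sup>2)) ^ 3"

lemma newton_kernel_measurable [measurable]: "newton_kernel e \<in> borel_measurable borel"
  unfolding newton_kernel_def by measurable

lemma newton_grad_measurable [measurable]: "newton_grad e i \<in> borel_measurable borel"
proof -
  have [measurable]: "(\<lambda>v::vec3. v $ i) \<in> borel_measurable borel"
    by (intro borel_measurable_continuous_onI continuous_intros)
  show ?thesis unfolding newton_grad_def by measurable
qed

lemma newton_kernel_0: "newton_kernel 0 v = 1 / norm v"
  by (simp add: newton_kernel_def)

lemma newton_kernels_bounded:
  assumes "v \<noteq> 0 \<or> e = 0"
  shows "\<bar>newton_kernel e v\<bar> \<le> 1 + 1 / (norm v)\<^sup>2"
    and "\<bar>newton_grad e i v\<bar> \<le> 1 + 1 / (norm v)\<^sup>2"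
proof -
  let ?s = "sqrt (e\<^sup>2 + (norm v)\<^sup>2)"
  have s: "?s \<ge> norm v" by (rule real_le_rsqrt) simp
  have "\<bar>newton_kernel e v\<bar> \<le> 1 / norm v"
    using s assms by (cases "v = 0") (auto simp: newton_kernel_def intro!: divide_left_mono mult_pos_pos order_less_le_trans[of 0 "norm v" ?s])
  then show "\<bar>newton_kernel e v\<bar> \<le> 1 + 1 / (norm v)\<^sup>2"
    using inverse_le_1_plus_inverse_square[of "norm v"] by simp
  have "\<bar>newton_grad e i v\<bar> \<le> 1 / (norm v)\<^sup>2"
  proof (cases "v = 0")
    case False
    have "\<bar>newton_grad e i v\<bar> = \<bar>v $ i\<bar> / ?s ^ 3"
      by (simp add: newton_grad_def)
    also have "\<dots> \<le> norm v / (norm v) ^ 3"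
      using False s by (intro frac_le component_le_norm_cart power_mono) auto
    also have "\<dots> = 1 / (norm v)\<^sup>2" using False by (simp add: power2_eq_square power3_eq_cube)
    finally show ?thesis .
  qed (simp add: newton_grad_def)
  then show "\<bar>newton_grad e i v\<bar> \<le> 1 + 1 / (norm v)\<^sup>2" by simp
qed

lemma has_pd_newton_kernel:
  assumes e: "e \<noteq> 0"
  shows "has_pd (\<lambda>x. newton_kernel e (x - y)) i (newton_grad e i (x - y)) x"
proof -
  let ?a = "axis i 1 :: vec3" and ?v = "x - y"
  have sq: "(norm (x + t *\<^sub>R ?a - y))\<^sup>2 = (norm ?v)\<^sup>2 + 2 * t * (?v $ i) + t\<^sup>2" for t
  proof -
    have "x + t *\<^sub>R ?a - y = ?v + t *\<^sub>R ?a" by simp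
    then show ?thesis
      by (simp only: power2_norm_eq_inner inner_simps)
         (simp add: inner_axis inner_axis' power2_eq_square algebra_simps)
  qed
  have pos: "e\<^sup>2 + (norm ?v)\<^sup>2 > 0" using e by (simp add: add_pos_nonneg)
  have "((\<lambda>t. 1 / sqrt (e\<^sup>2 + ((norm ?v)\<^sup>2 + 2 * t * (?v $ i) + t\<^sup>2))) has_real_derivative newton_grad e i ?v) (at 0)"
    using pos by (auto intro!: derivative_eq_intros
        simp: newton_grad_def divide_simps power3_eq_cube power2_eq_square)
  then show ?thesis unfolding has_pd_def newton_kernel_def sq .
qed

lemma newton_kernel_continuous:
  assumes "e \<noteq> 0"
  shows "continuous_on S (\<lambda>x. newton_kernel e (x - y))" "continuous_on S (\<lambda>x. newton_grad e i (x - y))"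
proof -
  have nz: "sqrt (e\<^sup>2 + (norm v)\<^sup>2) \<noteq> 0" for v :: vec3 using assms by (simp add: add_nonneg_eq_0_iff)
  show "continuous_on S (\<lambda>x. newton_kernel e (x - y))"
    unfolding newton_kernel_def by (intro continuous_intros ballI nz)
  show "continuous_on S (\<lambda>x. newton_grad e i (x - y))"
    unfolding newton_grad_def by (intro continuous_intros ballI power_not_zero nz)
qed

text \<open>The mollified kernel can be integrated by parts; the domination above lets \<open>e \<rightarrow> 0\<close>.\<close>

lemma newton_kernel_integration_by_parts:
  assumes \<phi>: "test_function (ball 0 R) \<phi>"
  shows "(LINT x|lborel. partial i \<phi> x * newton_kernel 0 (x - y)) =
       - (LINT x|lborel. \<phi> x * newton_grad 0 i (x - y))"
proof -
  obtain B where B: "B \<ge> 0" "\<And>x. \<bar>\<phi> x\<bar> \<le> B" "\<And>x. \<bar>partial i \<phi> x\<bar> \<le> B"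
    by (rule test_function_bounded[OF \<phi>, of i]) blast
  obtain K where K: "K \<subseteq> ball 0 R" "\<And>x. x \<notin> K \<Longrightarrow> \<phi> x = 0" "\<And>x. x \<notin> K \<Longrightarrow> partial i \<phi> x = 0"
    and s: "smooth \<phi>" using test_functionD[OF \<phi>] by metis
  have out: "\<phi> x = 0" "partial i \<phi> x = 0" if "x \<notin> ball 0 R" for x using that K by blast+
  obtain C where C: "C \<ge> 0"
    "\<And>y::vec3. (\<integral>\<^sup>+x. ennreal (1 + 1 / (norm (x - y))\<^sup>2) * indicator (ball 0 R) x \<partial>lborel) \<le> ennreal C"
    using inverse_square_kernel_bound[of R] by blast
  have m [measurable]: "\<phi> \<in> borel_measurable borel" "partial i \<phi> \<in> borel_measurable borel"
    by (intro borel_measurable_continuous_onI smooth_imp_continuous smooth_partial s)+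
  have [measurable]: "ball (0::vec3) R \<in> sets borel" by simp
  define t where "t = (\<lambda>n. 1 / real (Suc n))"
  have t: "t n \<noteq> 0" for n by (simp add: t_def)
  have t0: "t \<longlonglongrightarrow> 0" unfolding t_def by (rule LIMSEQ_Suc[OF lim_1_over_n])
  let ?w = "\<lambda>x. B * ((1 + 1 / (norm (x - y))\<^sup>2) * indicator (ball 0 R) x)"
  have w: "integrable lborel ?w"
  proof (intro integrable_mult_right integrableI_bounded)
    show "(\<integral>\<^sup>+x. ennreal (norm ((1 + 1 / (norm (x - y))\<^sup>2) * indicator (ball 0 R) x)) \<partial>lborel) < \<infinity>"
    proof (rule le_less_trans)
      show "(\<integral>\<^sup>+x. ennreal (norm ((1 + 1 / (norm (x - y))\<^sup>2) * indicator (ball 0 R) x)) \<partial>lborel) \<le> ennreal C"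
        by (rule order_trans[OF nn_integral_mono C(2)[of y]]) (auto split: split_indicator)
    qed simp
  qed measurable
  have ae: "AE x in (lborel::vec3 measure). x \<noteq> y" by (rule AE_lborel_singleton)
  have dc: "(\<lambda>n. LINT x|lborel. \<psi> x * k (t n) (x - y)) \<longlonglongrightarrow> (LINT x|lborel. \<psi> x * k 0 (x - y))"
    if [measurable]: "\<psi> \<in> borel_measurable borel" "\<And>e. k e \<in> borel_measurable borel"
      and \<psi>: "\<And>x. \<bar>\<psi> x\<bar> \<le> B" "\<And>x. x \<notin> ball 0 R \<Longrightarrow> \<psi> x = 0"
      and k: "\<And>e v. v \<noteq> 0 \<Longrightarrow> \<bar>k e v\<bar> \<le> 1 + 1 / (norm v)\<^sup>2"
      and kc: "\<And>v. v \<noteq> 0 \<Longrightarrow> (\<lambda>n. k (t n) v) \<longlonglongrightarrow> k 0 v"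
    for \<psi> :: scalar_field and k :: "real \<Rightarrow> scalar_field"
  proof (rule integral_dominated_convergence[OF _ _ w])
    show "AE x in lborel. (\<lambda>n. \<psi> x * k (t n) (x - y)) \<longlonglongrightarrow> \<psi> x * k 0 (x - y)"
      using ae by (rule AE_mp) (auto intro!: AE_I2 tendsto_intros kc)
    show "AE x in lborel. norm (\<psi> x * k (t n) (x - y)) \<le> ?w x" for n
      using ae
    proof (rule AE_mp, intro AE_I2 impI)
      fix x assume "x \<noteq> y"
      then have "\<bar>\<psi> x\<bar> * \<bar>k (t n) (x - y)\<bar> \<le> B * (1 + 1 / (norm (x - y))\<^sup>2)"
        using \<psi>(1) B(1) by (intro mult_mono k) auto
      then show "norm (\<psi> x * k (t n) (x - y)) \<le> ?w x"
        using \<psi>(2)[of x] by (cases "x \<in> ball 0 R") (auto simp: abs_mult)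
    qed
  qed measurable
  have "(\<lambda>n. sqrt ((t n)\<^sup>2 + (norm v)\<^sup>2)) \<longlonglongrightarrow> sqrt (0\<^sup>2 + (norm v)\<^sup>2)" for v :: vec3
    by (intro tendsto_intros t0)
  then have lim: "(\<lambda>n. newton_kernel (t n) v) \<longlonglongrightarrow> newton_kernel 0 v"
      "(\<lambda>n. newton_grad (t n) i v) \<longlonglongrightarrow> newton_grad 0 i v" if "v \<noteq> 0" for v :: vec3
    unfolding newton_kernel_def newton_grad_def using that by (auto intro!: tendsto_intros)
  have eq: "(LINT x|lborel. partial i \<phi> x * newton_kernel (t n) (x - y)) = - (LINT x|lborel. \<phi> x * newton_grad (t n) i (x - y))" for n
  proof -
    have "has_weak_partial (ball 0 R) i (\<lambda>x. newton_kernel (t n) (x - y)) (\<lambda>x. newton_grad (t n) i (x - y))"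
      by (intro C1_imp_has_weak_partial newton_kernel_continuous has_pd_newton_kernel t open_ball)
    then have "(LINT x|lebesgue_on (ball 0 R). newton_kernel (t n) (x - y) * partial i \<phi> x) =
        - (LINT x|lebesgue_on (ball 0 R). newton_grad (t n) i (x - y) * \<phi> x)"
      using \<phi> unfolding has_weak_partial_def by blast
    moreover have "(LINT x|lebesgue_on (ball 0 R). f x * \<psi> x) = (LINT x|lborel. \<psi> x * f x)"
      if [measurable]: "f \<in> borel_measurable borel" "\<psi> \<in> borel_measurable borel"
        and o: "\<And>x. x \<notin> ball 0 R \<Longrightarrow> \<psi> x = 0" for f \<psi> :: scalar_field
    proof -
      have "(LINT x|lebesgue_on (ball 0 R). f x * \<psi> x) = (LINT x|lebesgue. f x * \<psi> x)"
        by (rule LINT_lebesgue_on_test) (use o in auto)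
      also have "\<dots> = (LINT x|lborel. f x * \<psi> x)"
        by (rule integral_completion) measurable
      finally show ?thesis by (simp add: mult.commute)
    qed
    ultimately show ?thesis using out by simp
  qed
  have lim1: "(\<lambda>n. LINT x|lborel. partial i \<phi> x * newton_kernel (t n) (x - y)) \<longlonglongrightarrow> (LINT x|lborel. partial i \<phi> x * newton_kernel 0 (x - y))"
    by (rule dc) (use B out newton_kernels_bounded lim in auto)
  have "(\<lambda>n. - (LINT x|lborel. \<phi> x * newton_grad (t n) i (x - y))) \<longlonglongrightarrow> - (LINT x|lborel. \<phi> x * newton_grad 0 i (x - y))"
    by (rule tendsto_minus, rule dc[where k="\<lambda>e. newton_grad e i"]) (use B out newton_kernels_bounded lim in auto)
  from LIMSEQ_unique[OF lim1 this[folded eq]] show ?thesis .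
qed

text \<open>Integrating first in \<open>x\<close>, where the kernel bound is uniform in \<open>y\<close>, shows absolute integrability on the
  product; this is all that the \<open>L\<^sup>1\<close> bound and the exchange of integrals need, whatever the finite measure
  is.\<close>

lemma finite_measure_convolution:
  fixes \<mu> :: "vec3 measure" and h k :: scalar_field
  assumes \<mu>: "finite_measure \<mu>" and sets: "sets \<mu> = sets borel"
    and h: "h \<in> borel_measurable borel" "\<And>y. \<bar>h y\<bar> \<le> H"
    and k: "k \<in> borel_measurable borel" "\<And>v. \<bar>k v\<bar> \<le> 1 + 1 / (norm v)\<^sup>2"
    and C: "C \<ge> 0" "\<And>y::vec3. (\<integral>\<^sup>+x. ennreal (1 + 1 / (norm (x - y))\<^sup>2) * indicator (ball 0 R) x \<partial>lborel) \<le> ennreal C"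
  shows "integrable lborel (\<lambda>x. indicator (ball 0 R) x * (LINT y|\<mu>. h y * k (x - y)))"
    and "(LINT x|lborel. \<bar>indicator (ball 0 R) x * (LINT y|\<mu>. h y * k (x - y))\<bar>) \<le> H * C * measure \<mu> UNIV"
    and "\<And>\<psi>. \<psi> \<in> borel_measurable borel \<Longrightarrow> (\<And>x. \<bar>\<psi> x\<bar> \<le> B) \<Longrightarrow> (\<And>x. x \<notin> ball 0 R \<Longrightarrow> \<psi> x = 0) \<Longrightarrow>
      (LINT x|lborel. \<psi> x * (LINT y|\<mu>. h y * k (x - y))) = (LINT y|\<mu>. h y * (LINT x|lborel. \<psi> x * k (x - y)))"
proof -
  interpret m: finite_measure \<mu> by (rule \<mu>)
  interpret P: pair_sigma_finite "lborel :: vec3 measure" \<mu>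
    by (intro pair_sigma_finite.intro sigma_finite_lborel m.sigma_finite_measure_axioms)
  note [measurable] = h(1) k(1)
  note [measurable_cong] = sets
  have [measurable]: "ball (0::vec3) R \<in> sets borel" by simp
  have H: "H \<ge> 0" using h(2)[of 0] by linarith
  have U: "space \<mu> = UNIV" using sets_eq_imp_space_eq[OF sets] by simp
  have bound: "(\<integral>\<^sup>+x. (\<integral>\<^sup>+y. ennreal \<bar>indicator (ball 0 R) x * (h y * k (x - y))\<bar> \<partial>\<mu>) \<partial>lborel) \<le> ennreal (H * C * measure \<mu> UNIV)"
  proof -
    have "(\<integral>\<^sup>+x. (\<integral>\<^sup>+y. ennreal \<bar>indicator (ball 0 R) x * (h y * k (x - y))\<bar> \<partial>\<mu>) \<partial>lborel) =
       (\<integral>\<^sup>+y. (\<integral>\<^sup>+x. ennreal \<bar>indicator (ball 0 R) x * (h y * k (x - y))\<bar> \<partial>lborel) \<partial>\<mu>)"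
      by (rule P.Fubini'[symmetric]) measurable
    also have "\<dots> \<le> (\<integral>\<^sup>+y. ennreal (H * C) \<partial>\<mu>)"
    proof (rule nn_integral_mono)
      fix y
      have "(\<integral>\<^sup>+x. ennreal \<bar>indicator (ball 0 R) x * (h y * k (x - y))\<bar> \<partial>lborel) \<le>
         (\<integral>\<^sup>+x. ennreal H * (ennreal (1 + 1 / (norm (x - y))\<^sup>2) * indicator (ball 0 R) x) \<partial>lborel)"
      proof (rule nn_integral_mono)
        fix x
        have "\<bar>h y\<bar> * \<bar>k (x - y)\<bar> \<le> H * (1 + 1 / (norm (x - y))\<^sup>2)"
          using h(2) k(2) H by (intro mult_mono) auto
        then show "ennreal \<bar>indicator (ball 0 R) x * (h y * k (x - y))\<bar> \<le>
            ennreal H * (ennreal (1 + 1 / (norm (x - y))\<^sup>2) * indicator (ball 0 R) x)"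
          using H by (auto simp: abs_mult ennreal_mult[symmetric] simp del: ennreal_plus split: split_indicator intro!: ennreal_leI)
      qed
      also have "\<dots> = ennreal H * (\<integral>\<^sup>+x. ennreal (1 + 1 / (norm (x - y))\<^sup>2) * indicator (ball 0 R) x \<partial>lborel)"
        by (rule nn_integral_cmult) measurable
      also have "\<dots> \<le> ennreal H * ennreal C" by (intro mult_left_mono C) auto
      finally show "(\<integral>\<^sup>+x. ennreal \<bar>indicator (ball 0 R) x * (h y * k (x - y))\<bar> \<partial>lborel) \<le> ennreal (H * C)"
        using H C(1) by (simp add: ennreal_mult)
    qed
    also have "\<dots> = ennreal (H * C * measure \<mu> UNIV)"
      using H C(1) U by (simp add: m.emeasure_eq_measure ennreal_mult)
    finally show ?thesis .
  qed
  have int: "integrable (lborel \<Otimes>\<^sub>M \<mu>) (\<lambda>(x, y). indicator (ball 0 R) x * (h y * k (x - y)))"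
  proof (rule integrableI_bounded)
    show "(\<integral>\<^sup>+p. ennreal (norm (case p of (x, y) \<Rightarrow> indicator (ball 0 R) x * (h y * k (x - y)))) \<partial>(lborel \<Otimes>\<^sub>M \<mu>)) < \<infinity>"
      by (subst m.nn_integral_fst[symmetric]) (use bound in \<open>auto simp: le_less_trans\<close>)
  qed measurable
  have pull: "(LINT y|\<mu>. \<psi> x * (h y * k (x - y))) = \<psi> x * (LINT y|\<mu>. h y * k (x - y))" for \<psi> :: scalar_field and x
    by simp
  show i1: "integrable lborel (\<lambda>x. indicator (ball 0 R) x * (LINT y|\<mu>. h y * k (x - y)))"
    using P.integrable_fst'[OF int] by simp
  have "ennreal (LINT x|lborel. \<bar>indicator (ball 0 R) x * (LINT y|\<mu>. h y * k (x - y))\<bar>) =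
      (\<integral>\<^sup>+x. ennreal \<bar>indicator (ball 0 R) x * (LINT y|\<mu>. h y * k (x - y))\<bar> \<partial>lborel)"
    using i1 by (intro nn_integral_eq_integral[symmetric]) auto
  also have "\<dots> \<le> (\<integral>\<^sup>+x. (\<integral>\<^sup>+y. ennreal \<bar>indicator (ball 0 R) x * (h y * k (x - y))\<bar> \<partial>\<mu>) \<partial>lborel)"
  proof (rule nn_integral_mono_AE)
    have "AE x in lborel. integrable \<mu> (\<lambda>y. indicator (ball 0 R) x * (h y * k (x - y)))"
      using P.AE_integrable_fst'[OF int] by simp
    then show "AE x in lborel. ennreal \<bar>indicator (ball 0 R) x * (LINT y|\<mu>. h y * k (x - y))\<bar> \<le>
       (\<integral>\<^sup>+y. ennreal \<bar>indicator (ball 0 R) x * (h y * k (x - y))\<bar> \<partial>\<mu>)"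
    proof (rule AE_mp, intro AE_I2 impI)
      fix x assume "integrable \<mu> (\<lambda>y. indicator (ball 0 R) x * (h y * k (x - y)))"
      from integral_norm_bound_ennreal[OF this]
      show "ennreal \<bar>indicator (ball 0 R) x * (LINT y|\<mu>. h y * k (x - y))\<bar> \<le>
       (\<integral>\<^sup>+y. ennreal \<bar>indicator (ball 0 R) x * (h y * k (x - y))\<bar> \<partial>\<mu>)" by simp
    qed
  qed
  also note bound
  finally show "(LINT x|lborel. \<bar>indicator (ball 0 R) x * (LINT y|\<mu>. h y * k (x - y))\<bar>) \<le> H * C * measure \<mu> UNIV"
    using H C(1) by (subst (asm) ennreal_le_iff) auto
  fix \<psi> :: scalar_field
  assume [measurable]: "\<psi> \<in> borel_measurable borel" and \<psi>: "\<And>x. \<bar>\<psi> x\<bar> \<le> B" "\<And>x. x \<notin> ball 0 R \<Longrightarrow> \<psi> x = 0"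
  have int2: "integrable (lborel \<Otimes>\<^sub>M \<mu>) (\<lambda>(x, y). \<psi> x * (h y * k (x - y)))"
  proof (rule Bochner_Integration.integrable_bound[OF integrable_mult_right[OF integrable_abs[OF int], of B]])
    show "AE p in lborel \<Otimes>\<^sub>M \<mu>. norm (case p of (x, y) \<Rightarrow> \<psi> x * (h y * k (x - y))) \<le>
        norm (B * \<bar>case p of (x, y) \<Rightarrow> indicator (ball 0 R) x * (h y * k (x - y))\<bar>)"
    proof (intro AE_I2)
      fix p :: "vec3 \<times> vec3"
      obtain x y where p: "p = (x, y)" by force
      have "\<bar>\<psi> x\<bar> * \<bar>h y * k (x - y)\<bar> \<le> \<bar>B\<bar> * \<bar>h y * k (x - y)\<bar>"
        using \<psi>(1)[of x] by (intro mult_right_mono) auto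
      then show "norm (case p of (x, y) \<Rightarrow> \<psi> x * (h y * k (x - y))) \<le>
        norm (B * \<bar>case p of (x, y) \<Rightarrow> indicator (ball 0 R) x * (h y * k (x - y))\<bar>)"
        using \<psi>(2)[of x] by (cases "x \<in> ball 0 R") (auto simp: p abs_mult)
    qed
  qed measurable
  have "(LINT x|lborel. \<psi> x * (LINT y|\<mu>. h y * k (x - y))) = (LINT x|lborel. LINT y|\<mu>. \<psi> x * (h y * k (x - y)))"
    by simp
  also have "\<dots> = (LINT y|\<mu>. LINT x|lborel. \<psi> x * (h y * k (x - y)))"
    by (rule P.Fubini_integral[symmetric]) (use int2 in simp)
  also have "\<dots> = (LINT y|\<mu>. h y * (LINT x|lborel. \<psi> x * k (x - y)))"
    by (intro Bochner_Integration.integral_cong refl, subst integral_mult_right_zero[symmetric])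
       (simp add: ac_simps)
  finally show "(LINT x|lborel. \<psi> x * (LINT y|\<mu>. h y * k (x - y))) = (LINT y|\<mu>. h y * (LINT x|lborel. \<psi> x * k (x - y)))" .
qed

lemma integrable_ball_imp_locally_integrable:
  assumes "integrable lborel (\<lambda>x. indicator (ball 0 R) x * f x)"
  shows "locally_integrable (ball 0 R) f" "integrable (lebesgue_on (ball 0 R)) f"
proof -
  have "set_integrable lebesgue (ball 0 R) f"
    using assms unfolding set_integrable_def by (intro integrable_completion[THEN iffD2]) auto
  then show "integrable (lebesgue_on (ball 0 R)) f" by (simp add: set_integrable_def integrable_restrict_space)
  show "locally_integrable (ball 0 R) f" unfolding locally_integrable_def
    using \<open>set_integrable lebesgue (ball 0 R) f\<close>
    by (auto intro: set_integrable_subset simp: compact_imp_closed)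
qed

text \<open>The potential of a bounded density against any finite measure, volume or surface, is weakly
  differentiable, with a gradient that is bounded in \<open>L\<^sup>1\<close> by the total mass alone.\<close>

theorem potential_has_weak_partial:
  fixes \<mu> :: "vec3 measure"
  assumes \<mu>: "finite_measure \<mu>" and sets: "sets \<mu> = sets borel"
    and h: "h \<in> borel_measurable borel" "\<And>y. \<bar>h y\<bar> \<le> H"
    and C: "C \<ge> 0" "\<And>y::vec3. (\<integral>\<^sup>+x. ennreal (1 + 1 / (norm (x - y))\<^sup>2) * indicator (ball 0 R) x \<partial>lborel) \<le> ennreal C"
  obtains W where
    "\<And>i. has_weak_partial (ball 0 R) i (\<lambda>x. LINT y|\<mu>. h y / norm (x - y)) (W i)"
    "\<And>i. integrable (lebesgue_on (ball 0 R)) (W i)"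
    "\<And>i. (LINT x|lebesgue_on (ball 0 R). \<bar>W i x\<bar>) \<le> H * C * measure \<mu> UNIV"
proof -
  define V where "V x = (LINT y|\<mu>. h y * newton_kernel 0 (x - y))" for x
  define W where "W i x = (LINT y|\<mu>. h y * newton_grad 0 i (x - y))" for i x
  note cn = finite_measure_convolution[OF \<mu> sets h newton_kernel_measurable newton_kernels_bounded(1)[OF disjI2[OF refl]] C]
  note cg = finite_measure_convolution[OF \<mu> sets h newton_grad_measurable newton_kernels_bounded(2)[OF disjI2[OF refl]] C]
  note iV = cn(1)[folded V_def] and iW = cg(1)[folded W_def]
  have V: "V = (\<lambda>x. LINT y|\<mu>. h y / norm (x - y))"
    by (simp add: fun_eq_iff V_def newton_kernel_0)
  have conv: "(LINT x|lebesgue_on (ball 0 R). f x * \<psi> x) = (LINT x|lborel. \<psi> x * f x)"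
    if i: "integrable lborel (\<lambda>x. indicator (ball 0 R) x * f x)" and [measurable]: "\<psi> \<in> borel_measurable borel"
      and o: "\<And>x. x \<notin> ball 0 R \<Longrightarrow> \<psi> x = 0" for f \<psi> :: scalar_field
  proof -
    have eq: "(\<lambda>x. \<psi> x * f x) = (\<lambda>x. (indicator (ball 0 R) x * f x) * \<psi> x)"
      using o by (auto simp: fun_eq_iff split: split_indicator)
    have eq': "(\<lambda>x. f x * \<psi> x) = (\<lambda>x. (indicator (ball 0 R) x * f x) * \<psi> x)"
      using o by (auto simp: fun_eq_iff split: split_indicator)
    have "(LINT x|lebesgue_on (ball 0 R). f x * \<psi> x) = (LINT x|lebesgue. f x * \<psi> x)"
      by (rule LINT_lebesgue_on_test) (use o in auto)
    also have "\<dots> = (LINT x|lebesgue. (indicator (ball 0 R) x * f x) * \<psi> x)"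
      by (simp only: eq')
    also have "\<dots> = (LINT x|lborel. (indicator (ball 0 R) x * f x) * \<psi> x)"
      by (rule integral_completion) (use i in measurable)
    finally show ?thesis by (simp only: eq)
  qed
  have wp: "has_weak_partial (ball 0 R) i V (W i)" for i
    unfolding has_weak_partial_def
  proof (intro conjI allI impI integrable_ball_imp_locally_integrable(1) iV iW)
    fix \<phi> assume \<phi>: "test_function (ball 0 R) \<phi>"
    obtain B where B: "B \<ge> 0" "\<And>x. \<bar>\<phi> x\<bar> \<le> B" "\<And>x. \<bar>partial i \<phi> x\<bar> \<le> B"
      by (rule test_function_bounded[OF \<phi>, of i]) blast
    obtain K where K: "K \<subseteq> ball 0 R" "\<And>x. x \<notin> K \<Longrightarrow> \<phi> x = 0" "\<And>x. x \<notin> K \<Longrightarrow> partial i \<phi> x = 0"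
      and s: "smooth \<phi>" using test_functionD[OF \<phi>] by metis
    have out: "\<phi> x = 0" "partial i \<phi> x = 0" if "x \<notin> ball 0 R" for x using that K by blast+
    have m: "\<phi> \<in> borel_measurable borel" "partial i \<phi> \<in> borel_measurable borel"
      by (intro borel_measurable_continuous_onI smooth_imp_continuous smooth_partial s)+
    have "(LINT x|lebesgue_on (ball 0 R). V x * partial i \<phi> x) = (LINT x|lborel. partial i \<phi> x * V x)"
      by (rule conv[OF iV m(2) out(2)])
    also have "\<dots> = (LINT y|\<mu>. h y * (LINT x|lborel. partial i \<phi> x * newton_kernel 0 (x - y)))"
      unfolding V_def by (rule cn(3)[OF m(2) B(3) out(2)])
    also have "\<dots> = - (LINT y|\<mu>. h y * (LINT x|lborel. \<phi> x * newton_grad 0 i (x - y)))"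
      by (simp add: newton_kernel_integration_by_parts[OF \<phi>])
    also have "(LINT y|\<mu>. h y * (LINT x|lborel. \<phi> x * newton_grad 0 i (x - y))) = (LINT x|lborel. \<phi> x * W i x)"
      unfolding W_def by (rule cg(3)[OF m(1) B(2) out(1), symmetric])
    also have "\<dots> = (LINT x|lebesgue_on (ball 0 R). W i x * \<phi> x)"
      by (rule conv[OF iW m(1) out(1), symmetric])
    finally show "(LINT x|lebesgue_on (ball 0 R). V x * partial i \<phi> x) = - (LINT x|lebesgue_on (ball 0 R). W i x * \<phi> x)" .
  qed
  have "(LINT x|lebesgue_on (ball 0 R). \<bar>W i x\<bar>) \<le> H * C * measure \<mu> UNIV" for i
  proof -
    have "(LINT x|lebesgue_on (ball 0 R). \<bar>W i x\<bar>) = (LINT x|lebesgue. \<bar>indicator (ball 0 R) x * W i x\<bar>)"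
      by (subst integral_restrict_space) (auto simp: abs_mult)
    also have "\<dots> = (LINT x|lborel. \<bar>indicator (ball 0 R) x * W i x\<bar>)"
      by (rule integral_completion) (use iW[of i] in measurable)
    also have "\<dots> \<le> H * C * measure \<mu> UNIV"
      unfolding W_def by (rule cg(2))
    finally show ?thesis .
  qed
  with wp[unfolded V] integrable_ball_imp_locally_integrable(2)[OF iW] show ?thesis
    by (rule that)
qed

section \<open>Liquid Lane--Emden profiles\<close>

lemma enthalpy_has_derivative:
  assumes f: "(f has_real_derivative f') (at r)" "f r > 0"
  shows "(enthalpy \<gamma> f has_real_derivative \<gamma> * f r powr (\<gamma> - 2) * f') (at r)"
proof (cases "\<gamma> = 1")
  case True
  have "((\<lambda>s. ln (f s)) has_real_derivative \<gamma> * f r powr (\<gamma> - 2) * f') (at r)"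
    using f True by (auto intro!: derivative_eq_intros simp: powr_minus_divide)
  then show ?thesis using True by (simp add: enthalpy_def[abs_def])
next
  case False
  have "((\<lambda>s. \<gamma> / (\<gamma> - 1) * f s powr (\<gamma> - 1)) has_real_derivative
        \<gamma> / (\<gamma> - 1) * ((\<gamma> - 1) * f r powr (\<gamma> - 1 - 1) * f')) (at r)"
    using DERIV_fun_powr[OF f, of "\<gamma> - 1"] by (intro DERIV_cmult) simp
  then show ?thesis using False by (simp add: enthalpy_def[abs_def] mult.assoc)
qed

text \<open>\<open>r\<^sup>3 M(r)\<close> is the mass inside radius \<open>r\<close>, up to the factor \<open>4\<pi>\<close>. Integrating the Lane--Emden
  equation once gives the stated formula for \<open>\<rho>'\<close>; the constant of integration vanishes because
  \<open>\<rho>'\<close> is zero at the centre.\<close>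

theorem liquid_lane_emden_profile:
  assumes le: "liquid_lane_emden \<gamma> \<rho>\<^sub>0 R \<rho>" and \<gamma>: "\<gamma> \<ge> 1"
  obtains M where "R > 0" "\<rho>\<^sub>0 > 0"
    "\<And>r. 0 \<le> r \<Longrightarrow> r \<le> R \<Longrightarrow> 0 < \<rho> r \<and> \<rho> r \<le> \<rho>\<^sub>0"
    "continuous_on {0..R} \<rho>"
    "\<And>r. 0 < r \<Longrightarrow> r < R \<Longrightarrow> 0 \<le> M r \<and> 3 * M r \<le> \<rho>\<^sub>0"
    "\<And>r. 0 < r \<Longrightarrow> r < R \<Longrightarrow> (M has_real_derivative (\<rho> r - 3 * M r) / r) (at r)"
    "\<And>r. 0 < r \<Longrightarrow> r < R \<Longrightarrow> (\<rho> has_real_derivative - (4 * pi * r * M r * \<rho> r powr (2 - \<gamma>) / \<gamma>)) (at r)"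
proof -
  from le obtain f S where R: "R > 0" "R < S" and f: "lane_emden_solution \<gamma> \<rho>\<^sub>0 S f"
    and \<rho>: "\<rho> = (\<lambda>r. f r * indicator {0..R} r)" unfolding liquid_lane_emden_def by blast
  have f0: "f 0 = \<rho>\<^sub>0" and d0: "(f has_real_derivative 0) (at 0 within {0..})"
    and pos: "\<And>r. 0 \<le> r \<Longrightarrow> r < S \<Longrightarrow> f r > 0"
    and anti: "strict_antimono_on {0..<S} f"
    and diff: "\<And>r. 0 < r \<Longrightarrow> r < S \<Longrightarrow> f differentiable (at r)"
    and diff2: "\<And>r. 0 < r \<Longrightarrow> r < S \<Longrightarrow> (\<lambda>s. s\<^sup>2 * deriv (enthalpy \<gamma> f) s) differentiable (at r)"
    and ode: "\<And>r. 0 < r \<Longrightarrow> r < S \<Longrightarrow> radial_laplacian (enthalpy \<gamma> f) r + 4 * pi * f r = 0"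
    using f unfolding lane_emden_solution_def by auto
  have le0: "f r \<le> \<rho>\<^sub>0" if "0 \<le> r" "r < S" for r
  proof (cases "r = 0")
    case False
    then have "f r < f 0" using that R anti by (intro monotone_onD[OF anti]) auto
    then show ?thesis by (simp add: f0)
  qed (simp add: f0)
  have \<rho>f: "\<rho> r = f r" if "0 \<le> r" "r \<le> R" for r using that by (simp add: \<rho>)
  have \<rho>0: "\<rho>\<^sub>0 > 0" using pos[of 0] R f0 by simp
  have fcont: "continuous_on {0..R} f"
    unfolding continuous_on_eq_continuous_within
  proof
    fix r assume r: "r \<in> {0..R}"
    show "continuous (at r within {0..R}) f"
    proof (cases "r = 0")
      case True
      have "continuous (at 0 within {0..}) f" using d0 by (rule DERIV_continuous)
      then show ?thesis using True by (auto intro: continuous_within_subset)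
    next
      case False
      then have "isCont f r" using diff[of r] r R by (auto intro: differentiable_imp_continuous_within)
      then show ?thesis by (rule continuous_at_imp_continuous_within)
    qed
  qed
  define P where "P = (\<lambda>r. integral {0..r} (\<lambda>s. s\<^sup>2 * f s))"
  define M where "M = (\<lambda>r. P r / r ^ 3)"
  have gcont: "continuous_on {0..R} (\<lambda>s. s\<^sup>2 * f s)" by (intro continuous_intros fcont)
  have P': "(P has_real_derivative r\<^sup>2 * f r) (at r)" if "0 < r" "r < R" for r
  proof -
    have "(P has_real_derivative r\<^sup>2 * f r) (at r within {0..R})"
      unfolding P_def using that by (intro integral_has_real_derivative gcont) auto
    then show ?thesis using that by (simp add: at_within_Icc_at)
  qed
  have Pb: "0 \<le> P r" "P r \<le> \<rho>\<^sub>0 * r ^ 3 / 3" if "0 \<le> r" "r \<le> R" for r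
  proof -
    have i: "(\<lambda>s. s\<^sup>2 * f s) integrable_on {0..r}"
      using that by (intro integrable_continuous_real continuous_on_subset[OF gcont]) auto
    have j: "((\<lambda>s. s\<^sup>2 * \<rho>\<^sub>0) has_integral (r ^ 3 / 3 * \<rho>\<^sub>0 - 0 ^ 3 / 3 * \<rho>\<^sub>0)) {0..r}"
      using that by (intro fundamental_theorem_of_calculus)
        (auto intro!: derivative_eq_intros simp flip: has_real_derivative_iff_has_vector_derivative)
    show "0 \<le> P r" unfolding P_def
      using that R pos by (intro Henstock_Kurzweil_Integration.integral_nonneg i) (auto intro!: mult_nonneg_nonneg less_imp_le[OF pos])
    have "P r \<le> integral {0..r} (\<lambda>s. s\<^sup>2 * \<rho>\<^sub>0)" unfolding P_def
      using that R le0 j by (intro integral_le i) (auto intro!: mult_left_mono)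
    also have "\<dots> = \<rho>\<^sub>0 * r ^ 3 / 3" using integral_unique[OF j] by simp
    finally show "P r \<le> \<rho>\<^sub>0 * r ^ 3 / 3" .
  qed
  define G where "G = (\<lambda>s. s\<^sup>2 * deriv (enthalpy \<gamma> f) s)"
  have G': "(G has_real_derivative - (4 * pi * (r\<^sup>2 * f r))) (at r)" if "0 < r" "r < R" for r
  proof -
    have "(G has_real_derivative deriv G r) (at r)"
      using diff2[of r] that R unfolding G_def by (simp add: DERIV_deriv_iff_real_differentiable)
    moreover have "deriv G r / r\<^sup>2 + 4 * pi * f r = 0"
      using ode[of r] that R unfolding G_def radial_laplacian_def by simp
    then have "deriv G r = - (4 * pi * (r\<^sup>2 * f r))" using that by (simp add: field_simps)
    ultimately show ?thesis by simp
  qed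
  have E': "deriv (enthalpy \<gamma> f) r = \<gamma> * f r powr (\<gamma> - 2) * deriv f r" if "0 < r" "r < R" for r
    using that R pos[of r] diff[of r]
    by (intro DERIV_imp_deriv enthalpy_has_derivative) (auto simp: DERIV_deriv_iff_real_differentiable)
  obtain K where K: "\<And>r. 0 < r \<Longrightarrow> r < R \<Longrightarrow> G r + 4 * pi * P r = K"
  proof -
    have "\<exists>c. \<forall>x\<in>{0<..<R}. (\<lambda>r. G r + 4 * pi * P r) x = c"
    proof (rule has_derivative_zero_constant)
      fix r assume r: "r \<in> {0<..<R}"
      have "((\<lambda>r. G r + 4 * pi * P r) has_real_derivative - (4 * pi * (r\<^sup>2 * f r)) + 4 * pi * (r\<^sup>2 * f r)) (at r)"
        using r by (intro DERIV_add DERIV_cmult G' P') auto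
      then show "((\<lambda>r. G r + 4 * pi * P r) has_derivative (\<lambda>h. 0)) (at r within {0<..<R})"
        by (simp add: has_field_derivative_def lambda_zero has_derivative_at_withinI)
    qed simp
    then show ?thesis using that by auto
  qed
  have "K = 0"
  proof -
    \<comment> \<open>By the mean value theorem on \<open>[0, t n]\<close>, the derivative of \<open>f\<close> tends to zero along a sequence
        \<open>z n\<close> that tends to zero, so the conserved quantity does as well.\<close>
    define t where "t = (\<lambda>n. R / real (Suc (Suc n)))"
    have t: "0 < t n" "t n < R" for n using R by (auto simp: t_def field_simps add_pos_nonneg)
    have t0: "t \<longlonglongrightarrow> 0" unfolding t_def by real_asymp
    have "\<exists>z l. 0 < z \<and> z < t n \<and> DERIV f z :> l \<and> f (t n) - f 0 = t n * l" for n
    proof -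
      have "continuous_on {0..t n} f" using t[of n] by (intro continuous_on_subset[OF fcont]) auto
      moreover have "f differentiable (at x)" if "0 < x" "x < t n" for x
        using that t[of n] R by (intro diff) auto
      ultimately have "\<exists>l z. 0 < z \<and> z < t n \<and> DERIV f z :> l \<and> f (t n) - f 0 = (t n - 0) * l"
        by (intro MVT t)
      then show ?thesis by auto
    qed
    then obtain z l where z: "\<And>n. 0 < z n" "\<And>n. z n < t n" and l: "\<And>n. DERIV f (z n) :> l n"
        "\<And>n. f (t n) - f 0 = t n * l n" by metis
    have zR: "z n < R" for n using z(2)[of n] t[of n] by simp
    have z0: "z \<longlonglongrightarrow> 0"
      by (rule tendsto_sandwich[OF _ _ tendsto_const t0]) (use z in \<open>auto intro!: always_eventually less_imp_le\<close>)
    have "((\<lambda>y. (f y - f 0) / (y - 0)) \<longlongrightarrow> 0) (at 0 within {0..})"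
      using d0 by (simp add: has_field_derivative_iff)
    moreover have "filterlim t (at 0 within {0..}) sequentially"
      using t0 t(1) by (auto simp: filterlim_at intro!: always_eventually less_imp_le less_imp_neq[THEN not_sym])
    ultimately have "(\<lambda>n. (f (t n) - f 0) / (t n - 0)) \<longlonglongrightarrow> 0"
      by (rule filterlim_compose)
    moreover have "(\<lambda>n. (f (t n) - f 0) / (t n - 0)) = l"
      using l(2) t(1) by (auto simp: fun_eq_iff less_imp_neq[THEN not_sym])
    ultimately have l0: "l \<longlonglongrightarrow> 0" by simp
    have fz: "(\<lambda>n. f (z n)) \<longlonglongrightarrow> f 0"
      by (rule continuous_on_tendsto_compose[OF fcont z0]) (use R z zR in \<open>auto intro!: always_eventually less_imp_le\<close>)
    have "(\<lambda>n. (z n)\<^sup>2 * (\<gamma> * f (z n) powr (\<gamma> - 2) * l n)) \<longlonglongrightarrow> 0\<^sup>2 * (\<gamma> * f 0 powr (\<gamma> - 2) * 0)"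
      using \<rho>0 by (intro tendsto_intros z0 fz l0) (simp add: f0)
    moreover have "G (z n) = (z n)\<^sup>2 * (\<gamma> * f (z n) powr (\<gamma> - 2) * l n)" for n
      using E'[OF z(1) zR] DERIV_imp_deriv[OF l(1)] by (simp add: G_def)
    ultimately have "(\<lambda>n. G (z n)) \<longlonglongrightarrow> 0" by simp
    moreover have "(\<lambda>n. P (z n)) \<longlonglongrightarrow> 0"
    proof (rule tendsto_sandwich[OF _ _ tendsto_const])
      show "(\<lambda>n. \<rho>\<^sub>0 * z n ^ 3 / 3) \<longlonglongrightarrow> 0"
        using z0 by (auto intro!: tendsto_eq_intros)
    qed (use Pb less_imp_le[OF z(1)] less_imp_le[OF zR] in \<open>auto intro!: always_eventually\<close>)
    ultimately have "(\<lambda>n. G (z n) + 4 * pi * P (z n)) \<longlonglongrightarrow> 0 + 4 * pi * 0"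
      by (intro tendsto_intros)
    then have "(\<lambda>n. K) \<longlonglongrightarrow> 0" using K[OF z(1) zR] by simp
    then show ?thesis by (simp add: LIMSEQ_const_iff)
  qed
  have f': "(f has_real_derivative - (4 * pi * r * M r * f r powr (2 - \<gamma>) / \<gamma>)) (at r)"
    if r: "0 < r" "r < R" for r
  proof -
    have "r\<^sup>2 * (\<gamma> * f r powr (\<gamma> - 2) * deriv f r) = - (4 * pi * P r)"
      using K[OF r] \<open>K = 0\<close> E'[OF r] by (simp add: G_def)
    moreover have "f r powr (\<gamma> - 2) = 1 / f r powr (2 - \<gamma>)"
      using pos[of r] r R by (simp flip: powr_minus_divide)
    moreover have "f r powr (2 - \<gamma>) > 0" using pos[of r] r R by simp
    ultimately have "deriv f r = - (4 * pi * r * M r * f r powr (2 - \<gamma>) / \<gamma>)"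
      using r \<gamma> by (simp add: M_def field_simps power2_eq_square power3_eq_cube)
    moreover have "(f has_real_derivative deriv f r) (at r)"
      using diff[of r] r R by (simp add: DERIV_deriv_iff_real_differentiable)
    ultimately show ?thesis by simp
  qed
  show ?thesis
  proof (rule that)
    show "R > 0" "\<rho>\<^sub>0 > 0" by fact+
    show "0 < \<rho> r \<and> \<rho> r \<le> \<rho>\<^sub>0" if "0 \<le> r" "r \<le> R" for r
      using \<rho>f[OF that] pos[of r] le0[of r] that R by auto
    show "continuous_on {0..R} \<rho>"
      using fcont by (rule continuous_on_eq) (simp add: \<rho>f)
    fix r assume r: "0 < r" "r < R"
    show "0 \<le> M r \<and> 3 * M r \<le> \<rho>\<^sub>0"
      using Pb[of r] r by (simp add: M_def field_simps)
    have "((\<lambda>r. P r / r ^ 3) has_real_derivative (f r - 3 * (P r / r ^ 3)) / r) (at r)"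
      using r by (auto intro!: derivative_eq_intros P' simp: field_simps power_numeral_reduce)
    then show "(M has_real_derivative (\<rho> r - 3 * M r) / r) (at r)"
      using r by (simp add: M_def[abs_def] \<rho>f)
    show "(\<rho> has_real_derivative - (4 * pi * r * M r * \<rho> r powr (2 - \<gamma>) / \<gamma>)) (at r)"
      using f'[OF r] r
      by (subst \<rho>f, simp, simp)
         (rule has_field_derivative_transform_within_open[where S="{0<..<R}"], auto simp: \<rho>f)
  qed
qed

section \<open>Radial factors\<close>

lemma has_pd_compose:
  assumes "(F has_real_derivative F') (at (u x))" "has_pd u i a x"
  shows "has_pd (\<lambda>x. F (u x)) i (F' * a) x"
proof -
  have "(F has_real_derivative F') (at (u (x + 0 *\<^sub>R axis i 1)))" using assms(1) by simp
  from DERIV_chain2[OF this assms(2)[unfolded has_pd_def]] show ?thesis by (simp add: has_pd_def)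
qed

lemma has_pd_norm: "x \<noteq> 0 \<Longrightarrow> has_pd norm i (x $ i / norm x) x"
  using has_derivative_imp_has_pd[OF has_derivative_norm, of x i]
  by (simp add: sgn_div_norm inner_axis' divide_inverse mult.commute)

text \<open>A radial factor may have an unbounded derivative \<open>G\<close> at the origin, as long as \<open>r G(r)\<close> is
  bounded and the other factor vanishes to second order there.\<close>

theorem radial_times_smooth_has_weak_partial:
  assumes p: "smooth p" and pc: "c \<ge> 0" "\<And>x. norm x < R \<Longrightarrow> \<bar>p x\<bar> \<le> c * (norm x)\<^sup>2"
    and F: "\<And>r. 0 < r \<Longrightarrow> r < R \<Longrightarrow> (F has_real_derivative G r) (at r)" and G: "continuous_on {0<..<R} G"
    and A: "\<And>r. 0 < r \<Longrightarrow> r < R \<Longrightarrow> \<bar>F r\<bar> \<le> A" "\<And>r. 0 < r \<Longrightarrow> r < R \<Longrightarrow> \<bar>r * G r\<bar> \<le> A"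
    and R: "R > 0"
  shows "has_weak_partial (ball 0 R) i (\<lambda>x. F (norm x) * p x)
    (\<lambda>x. G (norm x) * (x $ i / norm x) * p x + F (norm x) * partial i p x)"
proof (rule C1_imp_has_weak_partial)
  let ?u = "\<lambda>x. F (norm x) * p x" and ?g = "\<lambda>x. G (norm x) * (x $ i / norm x) * p x + F (norm x) * partial i p x"
  have A0: "A \<ge> 0" using A(1)[of "R / 2"] R by linarith
  have p0: "p 0 = 0" using pc(2)[of 0] R by simp
  have cp: "isCont p x" "isCont (partial i p) x" for x
    using smooth_imp_continuous[OF p, of UNIV] smooth_imp_continuous[OF smooth_partial[OF p], of UNIV i]
    by (auto simp: continuous_on_eq_continuous_at)
  have ev: "\<forall>\<^sub>F x in at (0::vec3). x \<noteq> 0 \<and> norm x < R"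
    using R by (auto simp: eventually_at dist_norm intro!: exI[of _ R])
  have pp0: "has_pd p i 0 0"
    unfolding has_pd_def DERIV_def
  proof (rule Lim_null_comparison)
    show "((\<lambda>t. c * \<bar>t\<bar>) \<longlongrightarrow> 0) (at 0)" by (auto intro!: tendsto_eq_intros)
    show "\<forall>\<^sub>F t in at 0. norm ((p (0 + (0 + t) *\<^sub>R axis i 1) - p (0 + 0 *\<^sub>R axis i 1)) / t) \<le> c * \<bar>t\<bar>"
      unfolding eventually_at
    proof (intro exI[of _ R] conjI R ballI impI)
      fix t :: real assume t: "t \<noteq> 0 \<and> dist t 0 < R"
      then have "\<bar>p (t *\<^sub>R axis i 1)\<bar> \<le> c * t\<^sup>2" using pc(2)[of "t *\<^sub>R axis i 1"] by simp
      then show "norm ((p (0 + (0 + t) *\<^sub>R axis i 1) - p (0 + 0 *\<^sub>R axis i 1)) / t) \<le> c * \<bar>t\<bar>"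
        using t by (simp add: p0 divide_le_eq power2_eq_square abs_mult_self_eq mult.assoc flip: abs_mult)
    qed
  qed
  have dp0: "partial i p 0 = 0"
    using DERIV_unique pp0 has_pd_partial[OF smooth_imp_differentiable[OF p]] unfolding has_pd_def by blast
  have u0: "isCont ?u 0"
    unfolding isCont_def
  proof -
    have "(?u \<longlongrightarrow> 0) (at 0)"
    proof (rule Lim_null_comparison)
      show "\<forall>\<^sub>F x in at 0. norm (?u x) \<le> A * \<bar>p x\<bar>"
        using ev by eventually_elim (auto simp: abs_mult intro!: mult_right_mono A)
      have "((\<lambda>x. A * \<bar>p x\<bar>) \<longlongrightarrow> A * \<bar>p 0\<bar>) (at 0)"
        using cp(1)[of 0] unfolding isCont_def by (intro tendsto_intros)
      then show "((\<lambda>x. A * \<bar>p x\<bar>) \<longlongrightarrow> 0) (at 0)" by (simp add: p0)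
    qed
    then show "(?u \<longlongrightarrow> ?u 0) (at 0)" by (simp add: p0)
  qed
  have g0: "isCont ?g 0"
    unfolding isCont_def
  proof -
    have "(?g \<longlongrightarrow> 0) (at 0)"
    proof (rule Lim_null_comparison)
      show "\<forall>\<^sub>F x in at 0. norm (?g x) \<le> A * (c * norm x) + A * \<bar>partial i p x\<bar>"
        using ev
      proof eventually_elim
        case (elim x)
        then have x: "norm x > 0" "norm x < R" by auto
        have "\<bar>G (norm x) * (x $ i / norm x) * p x\<bar> \<le> (A / norm x) * 1 * (c * (norm x)\<^sup>2)"
          unfolding abs_mult
        proof (intro mult_mono)
          show "\<bar>G (norm x)\<bar> \<le> A / norm x" using A(2)[OF x] x by (simp add: field_simps abs_mult)
          show "\<bar>x $ i / norm x\<bar> \<le> 1" using component_le_norm_cart[of x i] x by (simp add: divide_le_eq)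
        qed (use x A0 pc in auto)
        also have "\<dots> = A * (c * norm x)" using x by (simp add: power2_eq_square)
        finally have "\<bar>G (norm x) * (x $ i / norm x) * p x\<bar> \<le> A * (c * norm x)" .
        moreover have "\<bar>F (norm x) * partial i p x\<bar> \<le> A * \<bar>partial i p x\<bar>"
          using A(1)[OF x] by (simp add: abs_mult mult_right_mono)
        ultimately show ?case unfolding real_norm_def by linarith
      qed
      have "((\<lambda>x. A * (c * norm x) + A * \<bar>partial i p x\<bar>) \<longlongrightarrow> A * (c * norm (0::vec3)) + A * \<bar>partial i p 0\<bar>) (at 0)"
        using cp(2)[of 0] unfolding isCont_def by (intro tendsto_intros)
      then show "((\<lambda>x. A * (c * norm x) + A * \<bar>partial i p x\<bar>) \<longlongrightarrow> 0) (at 0)" by (simp add: dp0)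
    qed
    then show "(?g \<longlongrightarrow> ?g 0) (at 0)" by (simp add: p0 dp0)
  qed
  have FG: "isCont (\<lambda>x. F (norm x)) x" "isCont (\<lambda>x. G (norm x)) x" if "x \<noteq> 0" "norm x < R" for x :: vec3
  proof -
    have "isCont F (norm x)" using F[of "norm x"] that by (intro DERIV_isCont) auto
    then show "isCont (\<lambda>x. F (norm x)) x" by (rule isCont_o2[OF isCont_norm[OF continuous_ident]])
    have "isCont G (norm x)" using G that by (simp add: continuous_on_eq_continuous_at)
    then show "isCont (\<lambda>x. G (norm x)) x" by (rule isCont_o2[OF isCont_norm[OF continuous_ident]])
  qed
  show "continuous_on (ball 0 R) ?u"
    unfolding continuous_on_eq_continuous_at[OF open_ball]
  proof
    fix x :: vec3 assume "x \<in> ball 0 R"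
    then show "isCont ?u x" using u0 FG[of x] cp[of x] by (cases "x = 0") (auto intro!: continuous_intros)
  qed
  show "continuous_on (ball 0 R) ?g"
    unfolding continuous_on_eq_continuous_at[OF open_ball]
  proof
    fix x :: vec3 assume x: "x \<in> ball 0 R"
    have "isCont (\<lambda>x::vec3. x $ i) x" by (intro continuous_intros)
    then show "isCont ?g x" using g0 FG[of x] cp[of x] x
      by (cases "x = 0") (auto intro!: continuous_intros)
  qed
  show "has_pd ?u i (?g x) x" if x: "x \<in> ball 0 R" for x
  proof (cases "x = 0")
    case False
    have "has_pd (\<lambda>x. F (norm x)) i (G (norm x) * (x $ i / norm x)) x"
      using False x by (intro has_pd_compose F has_pd_norm) auto
    from has_pd_mult[OF this has_pd_partial[OF smooth_imp_differentiable[OF p]]]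
    show ?thesis by (simp add: add.commute)
  next
    case True
    have "has_pd ?u i 0 0" unfolding has_pd_def DERIV_def
    proof (rule Lim_null_comparison)
      show "((\<lambda>t. A * (c * \<bar>t\<bar>)) \<longlongrightarrow> 0) (at 0)" by (auto intro!: tendsto_eq_intros)
      show "\<forall>\<^sub>F t in at 0. norm ((?u (0 + (0 + t) *\<^sub>R axis i 1) - ?u (0 + 0 *\<^sub>R axis i 1)) / t) \<le> A * (c * \<bar>t\<bar>)"
        unfolding eventually_at
      proof (intro exI[of _ R] conjI R ballI impI)
        fix t :: real assume t: "t \<noteq> 0 \<and> dist t 0 < R"
        then have "\<bar>F \<bar>t\<bar>\<bar> * \<bar>p (t *\<^sub>R axis i 1)\<bar> \<le> A * (c * t\<^sup>2)"
          using pc(2)[of "t *\<^sub>R axis i 1"] A(1)[of "\<bar>t\<bar>"] A0 by (intro mult_mono) auto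
        also have "A * (c * t\<^sup>2) = A * (c * \<bar>t\<bar>) * \<bar>t\<bar>" by (simp add: power2_eq_square abs_mult_self_eq mult.assoc flip: abs_mult)
        finally show "norm ((?u (0 + (0 + t) *\<^sub>R axis i 1) - ?u (0 + 0 *\<^sub>R axis i 1)) / t) \<le> A * (c * \<bar>t\<bar>)"
          using t by (simp add: p0 divide_le_eq abs_mult)
      qed
    qed
    then show ?thesis using True by (simp add: p0 dp0)
  qed
qed simp

section \<open>Gradients of planar harmonic polynomials\<close>

definition planar :: "vec3 \<Rightarrow> complex" where
  "planar x = Complex (x $ 1) (x $ 2)"

text \<open>The partial derivatives of \<open>planar\<close>. Their squares sum to zero, which is why every power of
  \<open>planar\<close> is harmonic.\<close>

definition dir :: "3 \<Rightarrow> complex" where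
  "dir i = (if i = 1 then 1 else if i = 2 then \<i> else 0)"

lemma dir_simps [simp]: "dir 1 = 1" "dir 2 = \<i>" "dir 3 = 0"
  by (auto simp: dir_def)

definition re_power :: "complex \<Rightarrow> nat \<Rightarrow> scalar_field" where
  "re_power a n x = Re (a * planar x ^ n)"

lemma planar_norm: "cmod (planar x) \<le> norm x"
proof -
  have "(cmod (planar x))\<^sup>2 \<le> (norm x)\<^sup>2"
    by (simp add: planar_def cmod_power2 norm_vec_def L2_set_def sum_nonneg sum_3)
  then show ?thesis by (rule power2_le_imp_le) simp
qed

lemma re_power_bound: "\<bar>re_power a n x\<bar> \<le> cmod a * cmod (planar x) ^ n"
  unfolding re_power_def using abs_Re_le_cmod[of "a * planar x ^ n"] by (simp add: norm_mult norm_power)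

lemma re_power_Suc: "re_power a (Suc n) x = x $ 1 * re_power a n x + x $ 2 * re_power (a * \<i>) n x"
proof -
  have "planar x = of_real (x $ 1) + \<i> * of_real (x $ 2)"
    by (simp add: planar_def complex_eq_iff)
  then have "a * planar x ^ Suc n = of_real (x $ 1) * (a * planar x ^ n) + of_real (x $ 2) * (a * \<i> * planar x ^ n)"
    by (simp only: power_Suc) (simp only: algebra_simps)
  then show ?thesis by (simp add: re_power_def)
qed

lemma smooth_re_power: "smooth (re_power a n)"
proof (induction n arbitrary: a)
  case 0
  show ?case using smooth_const[of "Re a"] by (simp add: re_power_def[abs_def])
next
  case (Suc n)
  have "re_power a (Suc n) = (\<lambda>x. x $ 1 * re_power a n x + x $ 2 * re_power (a * \<i>) n x)"
    by (simp add: re_power_Suc fun_eq_iff)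
  then show ?case by (simp only:) (intro smooth_add smooth_mult smooth_coord Suc)
qed

lemma partial_re_power: "partial i (re_power a n) x = re_power (of_nat n * dir i * a) (n - 1) x"
proof -
  have pl: "planar (x + t *\<^sub>R axis i 1) = planar x + of_real t * dir i" for t
    using exhaust_3[of i] by (auto simp: planar_def complex_eq_iff axis_def)
  have "((\<lambda>t. planar x + of_real t * dir i) has_vector_derivative dir i) (at 0)"
    by (auto intro!: derivative_eq_intros simp: has_vector_derivative_def scaleR_conv_of_real)
  moreover have "((\<lambda>z. z ^ n) has_field_derivative of_nat n * (planar x + of_real 0 * dir i) ^ (n - 1)) (at (planar x + of_real 0 * dir i))"
    by (auto intro!: derivative_eq_intros)
  ultimately have "((\<lambda>z. z ^ n) \<circ> (\<lambda>t. planar x + of_real t * dir i) has_vector_derivative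
       dir i * (of_nat n * (planar x + of_real 0 * dir i) ^ (n - 1))) (at 0)"
    by (rule field_vector_diff_chain_at)
  then have "((\<lambda>t. planar (x + t *\<^sub>R axis i 1) ^ n) has_vector_derivative
       dir i * (of_nat n * planar x ^ (n - 1))) (at 0)"
    by (simp add: pl o_def)
  then have "((\<lambda>t. Re (a * planar (x + t *\<^sub>R axis i 1) ^ n)) has_vector_derivative
       Re (a * (dir i * (of_nat n * planar x ^ (n - 1))))) (at 0)"
    by (intro bounded_linear.has_vector_derivative[OF bounded_linear_Re] has_vector_derivative_mult_right)
  then have "has_pd (re_power a n) i (re_power (of_nat n * dir i * a) (n - 1) x) x"
    by (simp add: has_pd_def re_power_def has_real_derivative_iff_has_vector_derivative mult_ac)
  with has_pd_partial[OF smooth_imp_differentiable[OF smooth_re_power[of a n]], of i x]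
  show ?thesis unfolding has_pd_def by (blast intro: DERIV_unique)
qed

lemma sum_coord_re_power: "(\<Sum>i\<in>UNIV. x $ i * re_power (dir i) m x) = re_power 1 (Suc m) x"
  by (simp add: re_power_Suc sum_3) (simp add: re_power_def)

lemma sum_re_power_square: "(\<Sum>i\<in>UNIV. (re_power (dir i) m x)\<^sup>2) = cmod (planar x) ^ (2 * m)"
proof -
  have "(\<Sum>i\<in>UNIV. (re_power (dir i) m x)\<^sup>2) = (cmod (planar x ^ m))\<^sup>2"
    by (simp add: sum_3 re_power_def cmod_power2)
  then show ?thesis by (simp add: norm_power power_mult mult.commute flip: power_mult)
qed

text \<open>The gradient of \<open>re_power 1 (m + 1)\<close> divided by \<open>m + 1\<close>, that is \<open>(Re z ^ m, - Im z ^ m, 0)\<close> with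
  \<open>z = x\<^sub>1 + i x\<^sub>2\<close>.\<close>

definition harm_grad :: "nat \<Rightarrow> vector_field" where
  "harm_grad m x = (\<chi> i. re_power (dir i) m x)"

lemma harm_grad_component: "harm_grad m x $ i = re_power (dir i) m x"
  by (simp add: harm_grad_def)

definition planar_moment :: "real \<Rightarrow> nat \<Rightarrow> real" where
  "planar_moment R k = (LINT x|lebesgue_on (ball 0 R). cmod (planar x) ^ (2 * k))"

lemma continuous_planar [continuous_intros]: "continuous_on S (\<lambda>x. cmod (planar x))"
  unfolding planar_def cmod_def by (simp, intro continuous_intros)

lemma planar_power_integrable: "integrable (lebesgue_on (ball 0 R)) (\<lambda>x. cmod (planar x) ^ k)"
  by (intro continuous_integrable_ball continuous_intros)

lemma harm_grad_weak_partial: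
  "AE x in lebesgue_on (ball 0 R). \<forall>i j. weak_partial (ball 0 R) i (\<lambda>y. harm_grad m y $ j) x =
      re_power (of_nat m * dir i * dir j) (m - 1) x"
proof -
  have *: "AE x in lebesgue_on (ball 0 R). weak_partial (ball 0 R) i (\<lambda>y. harm_grad m y $ j) x =
      re_power (of_nat m * dir i * dir j) (m - 1) x" for i j
    using smooth_weak_partial_AE[OF smooth_re_power[of "dir j" m], of R i]
    unfolding harm_grad_component partial_re_power .
  have "AE x in lebesgue_on (ball 0 R). \<forall>i\<in>UNIV. \<forall>j\<in>UNIV. weak_partial (ball 0 R) i (\<lambda>y. harm_grad m y $ j) x =
      re_power (of_nat m * dir i * dir j) (m - 1) x"
    by (intro AE_finite_allI finite * )
  then show ?thesis by simp
qed

lemma grad_norm_sq_harm_grad: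
  "grad_norm_sq (ball 0 R) (harm_grad m) = 2 * (real m)\<^sup>2 * planar_moment R (m - 1)"
proof -
  let ?B = "lebesgue_on (ball (0::vec3) R)"
  have "(LINT x|?B. (weak_partial (ball 0 R) i (\<lambda>y. harm_grad m y $ j) x)\<^sup>2) =
      (LINT x|?B. (re_power (of_nat m * dir i * dir j) (m - 1) x)\<^sup>2)" for i j
  proof (rule integral_cong_AE)
    have m: "re_power a n \<in> borel_measurable ?B" for a n
      by (intro borel_measurable_integrable continuous_integrable_ball smooth_imp_continuous smooth_re_power)
    have ae: "AE x in ?B. re_power (of_nat m * dir i * dir j) (m - 1) x = weak_partial (ball 0 R) i (\<lambda>y. harm_grad m y $ j) x"
      using harm_grad_weak_partial[where R=R and m=m] by (rule AE_mp) (auto intro!: AE_I2)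
    have m2: "weak_partial (ball 0 R) i (\<lambda>y. harm_grad m y $ j) \<in> borel_measurable ?B"
      by (rule borel_measurable_lebesgue_on_AE[OF _ m ae]) simp
    show "(\<lambda>x. (weak_partial (ball 0 R) i (\<lambda>y. harm_grad m y $ j) x)\<^sup>2) \<in> borel_measurable ?B"
      using m2 by measurable
    show "(\<lambda>x. (re_power (of_nat m * dir i * dir j) (m - 1) x)\<^sup>2) \<in> borel_measurable ?B"
      using m by measurable
    show "AE x in ?B. (weak_partial (ball 0 R) i (\<lambda>y. harm_grad m y $ j) x)\<^sup>2 = (re_power (of_nat m * dir i * dir j) (m - 1) x)\<^sup>2"
      using ae by (rule AE_mp) (auto intro!: AE_I2)
  qed
  then have "grad_norm_sq (ball 0 R) (harm_grad m) =
      (\<Sum>i\<in>UNIV. \<Sum>j\<in>UNIV. LINT x|?B. (re_power (of_nat m * dir i * dir j) (m - 1) x)\<^sup>2)"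
    by (simp add: grad_norm_sq_def)
  also have "\<dots> = (LINT x|?B. (\<Sum>i\<in>UNIV. \<Sum>j\<in>UNIV. (re_power (of_nat m * dir i * dir j) (m - 1) x)\<^sup>2))"
  proof -
    have "integrable ?B (\<lambda>x. (re_power a n x)\<^sup>2)" for a n
      by (intro continuous_integrable_ball continuous_intros smooth_imp_continuous smooth_re_power)
    then show ?thesis by simp
  qed
  also have "\<dots> = (LINT x|?B. 2 * (real m)\<^sup>2 * cmod (planar x) ^ (2 * (m - 1)))"
  proof (rule Bochner_Integration.integral_cong[OF refl])
    fix x
    have "(cmod (planar x ^ (m - 1)))\<^sup>2 = cmod (planar x) ^ (2 * (m - 1))"
      by (simp add: norm_power mult.commute flip: power_mult)
    moreover have "(\<Sum>i\<in>UNIV. \<Sum>j\<in>UNIV. (re_power (of_nat m * dir i * dir j) (m - 1) x)\<^sup>2) =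
      2 * (real m)\<^sup>2 * (cmod (planar x ^ (m - 1)))\<^sup>2"
      by (simp add: sum_3 re_power_def cmod_power2 power_mult_distrib algebra_simps)
    ultimately show "(\<Sum>i\<in>UNIV. \<Sum>j\<in>UNIV. (re_power (of_nat m * dir i * dir j) (m - 1) x)\<^sup>2) =
      2 * (real m)\<^sup>2 * cmod (planar x) ^ (2 * (m - 1))" by simp
  qed
  also have "\<dots> = 2 * (real m)\<^sup>2 * planar_moment R (m - 1)" by (simp add: planar_moment_def)
  finally show ?thesis .
qed

lemma odd_integral_eq_0:
  fixes f :: scalar_field
  assumes f: "continuous_on (ball 0 R) f" and odd: "\<And>x. f (- x) = - f x"
  shows "(LINT x|lebesgue_on (ball 0 R). f x) = 0"
proof -
  let ?g = "\<lambda>x. indicator (ball 0 R) x *\<^sub>R f x"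
  have [measurable]: "?g \<in> borel_measurable borel"
    by (intro borel_measurable_continuous_on_indicator f) simp
  have on: "(LINT x|lebesgue_on (ball 0 R). f x) = (LINT x|lborel. ?g x)"
  proof -
    have "(LINT x|lebesgue_on (ball 0 R). f x) = (LINT x|lebesgue. ?g x)"
      by (rule integral_restrict_space) simp
    also have "\<dots> = (LINT x|lborel. ?g x)" by (rule integral_completion) measurable
    finally show ?thesis .
  qed
  also have "\<dots> = (LINT x|distr lborel borel uminus. ?g x)"
    using lborel_affine[of "- 1" "0::vec3"] by (simp add: density_1)
  also have "\<dots> = (LINT x|lborel. ?g (- x))"
    by (rule integral_distr) measurable
  also have "\<dots> = (LINT x|lborel. - ?g x)"
    by (rule Bochner_Integration.integral_cong) (auto simp: odd split: split_indicator)
  also have "\<dots> = - (LINT x|lebesgue_on (ball 0 R). f x)" by (simp add: on)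
  finally show ?thesis by simp
qed

text \<open>The constant sequence zero approximates \<open>w\<close>, as \<open>w\<close> and its weak derivatives vanish almost everywhere.\<close>

lemma AE_zero_has_zero_trace:
  assumes "AE x in lebesgue_on (ball 0 R). w x = 0"
  shows "has_trace R w (\<lambda>_. 0)"
proof -
  let ?B = "lebesgue_on (ball (0::vec3) R)"
  have ae: "AE x in ?B. 0 = w x" using assms by (rule AE_mp) auto
  have "has_weak_partial (ball 0 R) i (\<lambda>_. 0) (\<lambda>_. 0)" for i
    using smooth_has_weak_partial[OF open_ball smooth_const, of 0 R i 0] by simp
  from has_weak_partial_cong_AE[OF open_ball this ae]
  have wp: "has_weak_partial (ball 0 R) i w (\<lambda>_. 0)" for i by simp
  have wae: "AE x in ?B. weak_partial (ball 0 R) i w x = 0" for i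
    by (rule weak_partial_AE[OF open_ball wp])
  have wm: "w \<in> borel_measurable ?B"
    by (rule borel_measurable_lebesgue_on_AE[OF _ _ ae]) auto
  have "integrable ?B (\<lambda>x. (w x)\<^sup>2) \<longleftrightarrow> integrable ?B (\<lambda>x. 0 :: real)"
    using wm assms by (intro integrable_cong_AE) auto
  then have L2: "L2_on (ball 0 R) w" "L2_on (ball 0 R) (\<lambda>_. 0)"
    using wm by (auto simp: L2_on_def)
  have 1: "(LINT x|?B. (0 - w x)\<^sup>2) = 0"
    by (rule integral_eq_zero_AE) (rule AE_mp[OF assms], auto)
  have 2: "(LINT x|?B. (0 - weak_partial (ball 0 R) i w x)\<^sup>2) = 0" for i
    by (rule integral_eq_zero_AE) (rule AE_mp[OF wae[of i]], auto)
  have "sobolev_H 1 (ball 0 R) w"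
    unfolding One_nat_def sobolev_H.simps using L2 wp by blast
  moreover have "(\<lambda>n::nat. LINT x|?B. (0 - w x)\<^sup>2) \<longlonglongrightarrow> 0" unfolding 1 by simp
  moreover have "\<forall>i. (\<lambda>n::nat. LINT x|?B. (partial i (\<lambda>_. 0) x - weak_partial (ball 0 R) i w x)\<^sup>2) \<longlonglongrightarrow> 0"
    unfolding partial_const 2 by simp
  ultimately show ?thesis
    unfolding has_trace_def by (auto intro!: exI[of _ "\<lambda>_ _. 0"] smooth_const)
qed

text \<open>The field is a divergence-free gradient, and for odd \<open>m\<close> it is an odd function, whence its weighted mean
  is zero.\<close>

lemma harm_grad_admissible:
  assumes m: "odd m" and \<rho>: "continuous_on {0..R} \<rho>"
  shows "harm_grad m \<in> admissible R \<rho>"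
proof -
  let ?B = "lebesgue_on (ball (0::vec3) R)"
  have "AE x in ?B. weak_div (ball 0 R) (harm_grad m) x = 0"
    using harm_grad_weak_partial[where R=R and m=m]
  proof (rule AE_mp, intro AE_I2 impI)
    fix x assume "\<forall>i j. weak_partial (ball 0 R) i (\<lambda>y. harm_grad m y $ j) x = re_power (of_nat m * dir i * dir j) (m - 1) x"
    then show "weak_div (ball 0 R) (harm_grad m) x = 0"
      by (simp add: weak_div_def sum_3) (simp add: re_power_def)
  qed
  then have div: "has_trace R (weak_div (ball 0 R) (harm_grad m)) (\<lambda>_. 0)"
    by (rule AE_zero_has_zero_trace)
  have "AE x in ?B. weak_curl (ball 0 R) (harm_grad m) x = 0"
    using harm_grad_weak_partial[where R=R and m=m]
    by (rule AE_mp) (auto intro!: AE_I2 simp: weak_curl_def Let_def vec_eq_iff forall_3 mult.commute)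
  then have curl: "irrotational R (harm_grad m)" by (simp add: irrotational_def)
  have "weighted_inner R \<rho> (harm_grad m) (\<lambda>_. axis i 1) = 0" for i
  proof -
    have "continuous_on (ball 0 R) (\<lambda>x::vec3. \<rho> (norm x))"
      by (intro continuous_on_compose2[OF \<rho>] continuous_intros) auto
    moreover have "planar (- x) ^ m = - (planar x ^ m)" for x
    proof -
      have "planar (- x) = - planar x" by (simp add: planar_def complex_eq_iff)
      then show ?thesis using m by simp
    qed
    then have "re_power (dir i) m (- x) = - re_power (dir i) m x" for x by (simp add: re_power_def)
    ultimately have "(LINT x|?B. \<rho> (norm x) * re_power (dir i) m x) = 0"
      using smooth_imp_continuous[OF smooth_re_power]
      by (intro odd_integral_eq_0 continuous_on_mult) auto
    then show ?thesis by (simp add: weighted_inner_def inner_axis harm_grad_component)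
  qed
  then show ?thesis
    using div curl by (auto simp: admissible_def H_space_def harm_grad_component intro!: smooth_sobolev_H smooth_re_power)
qed

lemma one_minus_inverse_power: "(1 - 1 / real (Suc k)) ^ k \<ge> 1 / 3"
proof (cases "k = 0")
  case False
  have "(1 + 1 / real k) ^ k \<le> exp (1 / real k) ^ k"
    by (intro power_mono) auto
  also have "\<dots> = exp 1" using False by (simp flip: exp_of_nat_mult)
  also have "\<dots> \<le> 3" by (rule exp_le)
  finally have "(1 + 1 / real k) ^ k \<le> 3" .
  moreover have "1 - 1 / real (Suc k) = real k / real (Suc k)" "1 + 1 / real k = real (Suc k) / real k"
    using False by (auto simp: field_simps)
  then have "(1 - 1 / real (Suc k)) * (1 + 1 / real k) = 1" using False by simp
  then have "(1 - 1 / real (Suc k)) ^ k * (1 + 1 / real k) ^ k = 1"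
    by (simp flip: power_mult_distrib)
  moreover have "(1 - 1 / real (Suc k)) ^ k \<ge> 0" by (intro zero_le_power) (simp add: field_simps)
  ultimately show ?thesis
    using mult_left_mono[of "(1 + 1 / real k) ^ k" 3 "(1 - 1 / real (Suc k)) ^ k"] by simp
qed simp

definition cylinder :: "real \<Rightarrow> real \<Rightarrow> vec3 set" where
  "cylinder a h = {x. cmod (planar x) < a \<and> \<bar>x $ 3\<bar> < h}"

lemma open_cylinder: "open (cylinder a h)"
  unfolding cylinder_def by (intro open_Collect_conj open_Collect_less continuous_intros)

lemma norm_cylinder:
  assumes "x \<in> cylinder a h"
  shows "(norm x)\<^sup>2 < a\<^sup>2 + h\<^sup>2"
proof -
  have "(norm x)\<^sup>2 = (cmod (planar x))\<^sup>2 + (x $ 3)\<^sup>2"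
    by (simp add: planar_def cmod_power2 norm_vec_def L2_set_def sum_nonneg sum_3)
  moreover have "(cmod (planar x))\<^sup>2 < a\<^sup>2" using assms by (intro power_strict_mono) (auto simp: cylinder_def)
  moreover have "(x $ 3)\<^sup>2 < h\<^sup>2" using assms power_strict_mono[of "\<bar>x $ 3\<bar>" h 2] by (auto simp: cylinder_def)
  ultimately show ?thesis by simp
qed

lemma cylinder_lmeasurable: "cylinder a h \<in> lmeasurable"
proof -
  have "norm x \<le> sqrt (a\<^sup>2 + h\<^sup>2)" if "x \<in> cylinder a h" for x
    using norm_cylinder[OF that] by (simp add: real_le_rsqrt)
  then have "bounded (cylinder a h)" by (auto simp: bounded_iff)
  then show ?thesis by (intro lmeasurable_open open_cylinder)
qed

lemma measure_cylinder:
  assumes "a > 0" "h > 0"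
  shows "measure lebesgue (cylinder a h) = a\<^sup>2 * h * measure lebesgue (cylinder 1 1)"
proof -
  define m :: "3 \<Rightarrow> real" where "m = (\<lambda>i. if i = 3 then h else a)"
  have pl: "planar (\<chi> k. m k * x $ k) = of_real a * planar x" for x
    by (simp add: planar_def complex_eq_iff m_def)
  have "(\<lambda>x. \<chi> k. m k * x $ k) ` cylinder 1 1 = cylinder a h"
  proof (intro equalityI subsetI)
    fix y assume "y \<in> (\<lambda>x. \<chi> k. m k * x $ k) ` cylinder 1 1"
    then show "y \<in> cylinder a h" using assms
      by (auto simp: cylinder_def pl norm_mult abs_mult) (auto simp: m_def abs_mult)
  next
    fix y assume y: "y \<in> cylinder a h"
    define x where "x = (\<chi> k. y $ k / m k)"
    have yx: "y = (\<chi> k. m k * x $ k)" using assms by (auto simp: x_def m_def vec_eq_iff)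
    then have "planar y = of_real a * planar x" using pl by simp
    moreover have "y $ 3 = h * x $ 3" using assms by (simp add: x_def m_def)
    ultimately have "x \<in> cylinder 1 1" using y assms by (auto simp: cylinder_def norm_mult abs_mult)
    then show "y \<in> (\<lambda>x. \<chi> k. m k * x $ k) ` cylinder 1 1" using yx by blast
  qed
  moreover have "\<bar>prod m UNIV\<bar> = a\<^sup>2 * h"
  proof -
    have "prod m UNIV = m 1 * m 2 * m 3" unfolding UNIV_3 by (simp add: mult.assoc)
    then show ?thesis using assms by (simp add: m_def power2_eq_square abs_mult)
  qed
  ultimately show ?thesis using measure_stretch[OF cylinder_lmeasurable, of m 1 1] by simp
qed

text \<open>With \<open>s = 1/m\<close>, the cylinder of radius \<open>a = R \<surd>(1 - s)\<close> and half height \<open>h = R \<surd>s\<close> fits into the ball. Between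
  it and the concentric cylinder of radius \<open>a (1 - s)\<close> the planar norm is at least \<open>a (1 - s)\<close>, whose powers of
  order \<open>m\<close> lose only a constant factor against those of \<open>R\<close>, and the volume of this shell is of order
  \<open>s h\<close>, that is \<open>m ^ (-3/2)\<close>.\<close>

lemma planar_moment_lower_bound:
  assumes R: "R > 0"
  obtains c where "c > 0" "\<And>m. m \<ge> 2 \<Longrightarrow> (real m)\<^sup>2 * planar_moment R (m - 1) \<ge> c * R ^ (2 * m) * sqrt (real m)"
proof -
  define v where "v = measure lebesgue (cylinder 1 1)"
  have v: "v > 0"
  proof -
    have "0 \<in> cylinder 1 1" by (simp add: cylinder_def planar_def cmod_def)
    then have "\<not> negligible (cylinder 1 1)" using open_not_negligible[OF open_cylinder] by blast
    then show ?thesis using cylinder_lmeasurable[of 1 1]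
      by (simp add: v_def negligible_iff_measure0 zero_less_measure_iff measure_nonneg order_less_le)
  qed
  define c where "c = R * v / 54"
  have c: "c > 0" using R v by (simp add: c_def)
  show ?thesis
  proof (rule that[OF c])
    fix m :: nat assume m: "m \<ge> 2"
    define k where "k = m - 1"
    define s where "s = 1 / real m"
    have mk: "m = Suc k" using m by (simp add: k_def)
    have s: "0 < s" "s \<le> 1 / 2" using m by (auto simp: s_def field_simps)
    define a where "a = R * sqrt (1 - s)"
    define h where "h = R * sqrt s"
    have a: "a > 0" and h: "h > 0" using s R by (auto simp: a_def h_def)
    have a2: "a\<^sup>2 = R\<^sup>2 * (1 - s)" and h2: "h\<^sup>2 = R\<^sup>2 * s" using s by (auto simp: a_def h_def power_mult_distrib)
    let ?b = "a * (1 - s)"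
    have b: "?b > 0" "?b < a" using a s by auto
    define A where "A = cylinder a h - cylinder ?b h"
    have sub: "cylinder ?b h \<subseteq> cylinder a h" using b by (auto simp: cylinder_def)
    have Am: "A \<in> lmeasurable" unfolding A_def by (intro fmeasurable_Diff cylinder_lmeasurable fmeasurableD)
    have AB: "A \<subseteq> ball 0 R"
    proof
      fix x assume "x \<in> A"
      then have "(norm x)\<^sup>2 < a\<^sup>2 + h\<^sup>2" by (intro norm_cylinder) (auto simp: A_def)
      also have "\<dots> = R\<^sup>2" by (simp add: a2 h2 algebra_simps)
      finally show "x \<in> ball 0 R" using R by (simp add: power2_less_imp_less)
    qed
    have "measure lebesgue A = measure lebesgue (cylinder a h) - measure lebesgue (cylinder ?b h)"
      unfolding A_def by (intro measurable_measure_Diff cylinder_lmeasurable fmeasurableD sub)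
    also have "\<dots> = v * a\<^sup>2 * h * (1 - (1 - s)\<^sup>2)"
      unfolding measure_cylinder[OF a h] measure_cylinder[OF b(1) h] v_def[symmetric] power_mult_distrib
      by (simp add: algebra_simps)
    also have "\<dots> \<ge> v * a\<^sup>2 * h * s"
    proof (rule mult_left_mono)
      show "s \<le> 1 - (1 - s)\<^sup>2" using s mult_left_mono[of s 1 s] by (simp add: power2_eq_square algebra_simps)
    qed (use v h in auto)
    finally have mA: "measure lebesgue A \<ge> v * a\<^sup>2 * h * s" .
    have "?b ^ (2 * k) * (v * a\<^sup>2 * h * s) \<le> ?b ^ (2 * k) * measure lebesgue A"
      using b mA by (intro mult_left_mono) auto
    also have "\<dots> = (LINT x|lebesgue. ?b ^ (2 * k) * indicator A x)" using Am by simp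
    also have "\<dots> \<le> (LINT x|lebesgue. indicator (ball 0 R) x * cmod (planar x) ^ (2 * k))"
    proof (rule integral_mono)
      show "integrable lebesgue (\<lambda>x. ?b ^ (2 * k) * indicator A x)"
        using Am by (intro integrable_mult_right integrable_real_indicator) (auto simp: fmeasurable_def)
      show "integrable lebesgue (\<lambda>x. indicator (ball 0 R) x * cmod (planar x) ^ (2 * k))"
        using planar_power_integrable[of R "2 * k"] by (simp add: integrable_restrict_space)
      fix x
      show "?b ^ (2 * k) * indicator A x \<le> indicator (ball 0 R) x * cmod (planar x) ^ (2 * k)"
      proof (cases "x \<in> A")
        case True
        then have "?b \<le> cmod (planar x)" by (auto simp: A_def cylinder_def)
        moreover have "indicator (ball 0 R) x = (1 :: real)" using True AB by (intro indicator_simps) blast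
        ultimately show ?thesis using True b by (simp add: power_mono)
      qed (simp split: split_indicator)
    qed
    also have "\<dots> = planar_moment R k"
      unfolding planar_moment_def by (subst integral_restrict_space) auto
    finally have I: "?b ^ (2 * k) * (v * a\<^sup>2 * h * s) \<le> planar_moment R k" .
    have q: "(1 - s) ^ k \<ge> 1 / 3" using one_minus_inverse_power[of k] by (simp add: s_def mk)
    have "?b ^ (2 * k) = (a\<^sup>2) ^ k * ((1 - s) ^ k)\<^sup>2"
      by (simp add: power_mult power_mult_distrib) (simp add: power_mult[symmetric] mult.commute)
    also have "\<dots> = R ^ (2 * k) * ((1 - s) ^ k) ^ 3"
      unfolding a2 by (simp add: power_mult_distrib power_mult power2_eq_square power3_eq_cube)
    finally have "?b ^ (2 * k) = R ^ (2 * k) * ((1 - s) ^ k) ^ 3" .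
    moreover have "((1 - s) ^ k) ^ 3 \<ge> (1 / 3) ^ 3" using q by (intro power_mono) auto
    ultimately have B: "?b ^ (2 * k) \<ge> R ^ (2 * k) * (1 / 27)"
      using R mult_left_mono[of "(1 / 3) ^ 3" "((1 - s) ^ k) ^ 3" "R ^ (2 * k)"] by (simp add: power3_eq_cube)
    have D: "v * a\<^sup>2 * h * s \<ge> v * (R\<^sup>2 * (1 / 2)) * (R * sqrt s) * s"
      unfolding a2 h_def using s v R by (intro mult_right_mono mult_left_mono) auto
    have "R ^ (2 * k) * (1 / 27) * (v * (R\<^sup>2 * (1 / 2)) * (R * sqrt s) * s) \<le> ?b ^ (2 * k) * (v * a\<^sup>2 * h * s)"
      using b v R s by (intro mult_mono B D) auto
    also note I
    also have "R ^ (2 * k) * (1 / 27) * (v * (R\<^sup>2 * (1 / 2)) * (R * sqrt s) * s) = c * R ^ (2 * m) * (sqrt s * s)"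
      by (simp add: c_def mk power2_eq_square)
    finally have J: "c * R ^ (2 * m) * (sqrt s * s) \<le> planar_moment R k" .
    have "(real m)\<^sup>2 * (sqrt s * s) = sqrt (real m)"
    proof -
      define q where "q = sqrt (real m)"
      have q: "q > 0" "real m = q * q" using m by (auto simp: q_def)
      have "s = 1 / (q * q)" by (simp only: s_def q(2))
      moreover from this have "sqrt s = 1 / q" using q(1) by (simp add: real_sqrt_divide)
      ultimately have "(real m)\<^sup>2 * (sqrt s * s) = (q * q)\<^sup>2 * (1 / q * (1 / (q * q)))" by (simp only: q(2))
      also have "\<dots> = q" using q(1) by (simp add: power2_eq_square)
      finally show ?thesis by (simp only: q_def)
    qed
    then have "c * R ^ (2 * m) * sqrt (real m) = (real m)\<^sup>2 * (c * R ^ (2 * m) * (sqrt s * s))" by (simp add: mult_ac)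
    also have "\<dots> \<le> (real m)\<^sup>2 * planar_moment R k" by (intro mult_left_mono J) simp
    finally show "(real m)\<^sup>2 * planar_moment R (m - 1) \<ge> c * R ^ (2 * m) * sqrt (real m)" by (simp add: k_def)
  qed
qed

section \<open>Failure of coercivity\<close>

text \<open>The form is only bounded above, so \<open>f\<close> is allowed to be non-integrable; its integral is then zero by
  convention.\<close>

lemma LINT_le_bound:
  fixes f g :: "'a \<Rightarrow> real"
  assumes "integrable M g" "AE x in M. f x \<le> g x" "AE x in M. 0 \<le> g x"
  shows "(LINT x|M. f x) \<le> (LINT x|M. g x)"
proof (cases "integrable M f")
  case True
  then show ?thesis using assms by (intro integral_mono_AE)
next
  case False
  then show ?thesis using integral_nonneg_AE[OF assms(3)] by (simp add: not_integrable_integral_eq)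
qed

lemma AE_ball_nonzero: "AE x in lebesgue_on (ball (0::vec3) R). x \<noteq> 0 \<and> norm x < R"
proof -
  have "AE x in (lebesgue :: vec3 measure). x \<noteq> 0"
    by (rule AE_completion) (rule AE_lborel_singleton)
  then have "AE x in (lebesgue :: vec3 measure). x \<in> ball 0 R \<longrightarrow> x \<noteq> 0 \<and> norm x < R"
    by (rule AE_mp) (auto intro!: AE_I2)
  then show ?thesis by (subst AE_lebesgue_on_iff) auto
qed

text \<open>The operator applied to \<open>harm_grad m\<close> is minus the gradient of a local part and two potentials. Since the
  field is divergence free, \<open>\<nabla>\<cdot>(\<rho> \<theta>) = \<rho>' u / \<bar>x\<bar>\<close> with \<open>u = x \<cdot> \<theta>\<close>, and the once integrated Lane--Emden equation
  makes the local part \<open>- 4 \<pi> M u\<close>, where differentiating costs only one factor \<open>m\<close>. The potentials have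
  densities of size \<open>R ^ m\<close>, so their gradients are of this size in \<open>L\<^sup>1\<close>, uniformly in \<open>m\<close>, and pairing with
  \<open>\<bar>\<theta>\<bar> \<le> R ^ m\<close> gives \<open>R ^ (2 m)\<close>.\<close>

theorem harm_grad_form_bound:
  assumes le: "liquid_lane_emden \<gamma> \<rho>\<^sub>0 R \<rho>" and \<gamma>: "1 \<le> \<gamma>" "\<gamma> \<le> 2"
  obtains a b where "a \<ge> 0" "b \<ge> 0"
    "\<And>m. odd m \<Longrightarrow> 3 \<le> m \<Longrightarrow> harm_grad m \<in> admissible R \<rho>"
    "\<And>m. odd m \<Longrightarrow> 3 \<le> m \<Longrightarrow>
      weighted_inner R \<rho> (lin_op \<gamma> R \<rho> (harm_grad m)) (harm_grad m) \<le>
        a * (real m + 2) * planar_moment R (m - 1) + b * R ^ (2 * m)"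
proof -
  obtain M where R: "R > 0" and \<rho>0: "\<rho>\<^sub>0 > 0"
    and \<rho>b: "\<And>r. 0 \<le> r \<Longrightarrow> r \<le> R \<Longrightarrow> 0 < \<rho> r \<and> \<rho> r \<le> \<rho>\<^sub>0"
    and \<rho>c: "continuous_on {0..R} \<rho>"
    and Mb: "\<And>r. 0 < r \<Longrightarrow> r < R \<Longrightarrow> 0 \<le> M r \<and> 3 * M r \<le> \<rho>\<^sub>0"
    and M': "\<And>r. 0 < r \<Longrightarrow> r < R \<Longrightarrow> (M has_real_derivative (\<rho> r - 3 * M r) / r) (at r)"
    and \<rho>': "\<And>r. 0 < r \<Longrightarrow> r < R \<Longrightarrow> (\<rho> has_real_derivative - (4 * pi * r * M r * \<rho> r powr (2 - \<gamma>) / \<gamma>)) (at r)"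
    using liquid_lane_emden_profile[OF le \<gamma>(1)] by blast
  let ?U = "ball (0::vec3) R"
  let ?B = "lebesgue_on ?U"
  obtain C where C: "C \<ge> 0"
    "\<And>y::vec3. (\<integral>\<^sup>+x. ennreal (1 + 1 / (norm (x - y))\<^sup>2) * indicator ?U x \<partial>lborel) \<le> ennreal C"
    using inverse_square_kernel_bound[of R] by blast
  define q where "q r = - (4 * pi * M r * \<rho> r powr (2 - \<gamma>) / \<gamma>)" for r
  define D where "D = 4 * pi * \<rho>\<^sub>0 * \<rho>\<^sub>0 powr (2 - \<gamma>)"
  have D0: "D \<ge> 0" using \<rho>0 by (simp add: D_def)
  have qb: "\<bar>q r\<bar> \<le> D" if r: "0 < r" "r < R" for r
  proof -
    have "\<rho> r powr (2 - \<gamma>) \<le> \<rho>\<^sub>0 powr (2 - \<gamma>)" using \<rho>b[of r] r \<gamma> by (intro powr_mono2) auto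
    moreover have "0 \<le> M r" "M r \<le> \<rho>\<^sub>0" using Mb[OF r] \<rho>0 by auto
    ultimately have "4 * pi * M r * \<rho> r powr (2 - \<gamma>) \<le> D" unfolding D_def
      by (intro mult_mono) auto
    moreover have "4 * pi * M r * \<rho> r powr (2 - \<gamma>) / \<gamma> \<le> 4 * pi * M r * \<rho> r powr (2 - \<gamma>) / 1"
      using \<open>0 \<le> M r\<close> \<gamma> by (intro divide_left_mono) auto
    moreover have "0 \<le> 4 * pi * M r * \<rho> r powr (2 - \<gamma>) / \<gamma>" using \<open>0 \<le> M r\<close> \<gamma> by simp
    ultimately show ?thesis unfolding q_def by linarith
  qed
  have Mc: "continuous_on {0<..<R} M"
    by (intro continuous_at_imp_continuous_on ballI DERIV_isCont[OF M']) auto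
  have \<rho>c': "continuous_on {0<..<R} \<rho>" by (rule continuous_on_subset[OF \<rho>c]) auto
  have qc: "continuous_on {0<..<R} q"
    unfolding q_def using \<gamma> \<rho>b by (intro continuous_intros Mc \<rho>c') (auto simp: less_imp_neq[THEN not_sym])
  have radc: "continuous_on (?U - {0}) (\<lambda>x. F (norm x))" if "continuous_on {0<..<R} F" for F :: "real \<Rightarrow> real"
    by (intro continuous_on_compose2[OF that] continuous_intros) auto
  define \<mu>1 where "\<mu>1 = density lborel (\<lambda>x. ennreal (indicator ?U x))"
  have \<mu>1: "finite_measure \<mu>1" "sets \<mu>1 = sets borel"
  proof -
    have "emeasure \<mu>1 (space \<mu>1) = emeasure lborel ?U"
    proof -
      have "emeasure \<mu>1 UNIV = (\<integral>\<^sup>+x. ennreal (indicator ?U x) * indicator UNIV x \<partial>lborel)"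
        unfolding \<mu>1_def by (rule emeasure_density) (auto intro!: measurable_compose[OF _ measurable_ennreal] borel_measurable_indicator)
      then show ?thesis by (simp add: \<mu>1_def ennreal_indicator)
    qed
    then show "finite_measure \<mu>1"
      using emeasure_lborel_ball_finite[of "0::vec3" R] by (intro finite_measureI) auto
  qed (simp add: \<mu>1_def)
  define \<mu>2 where "\<mu>2 = sphere_measure R"
  have \<mu>2: "finite_measure \<mu>2" "sets \<mu>2 = sets borel"
    by (auto simp: \<mu>2_def finite_measure_sphere_measure)
  define a where "a = 4 * pi * \<rho>\<^sub>0\<^sup>2 * R\<^sup>2"
  define b where "b = \<rho>\<^sub>0 * 3 * ((D * R * C * measure \<mu>1 UNIV) + (C * measure \<mu>2 UNIV))"
  have main: "weighted_inner R \<rho> (lin_op \<gamma> R \<rho> (harm_grad m)) (harm_grad m) \<le>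
        a * (real m + 2) * planar_moment R (m - 1) + b * R ^ (2 * m)" if m: "3 \<le> m" for m
  proof -
    define u where "u = re_power 1 (Suc m)"
    define th where "th = (\<lambda>i. re_power (dir i) m)"
    define z where "z = (\<lambda>x. cmod (planar x))"
    have z: "0 \<le> z x" "z x \<le> norm x" for x by (auto simp: z_def planar_norm)
    have ub: "\<bar>u x\<bar> \<le> z x ^ Suc m" for x using re_power_bound[of 1 "Suc m" x] by (simp add: u_def z_def)
    have dirb: "cmod (dir i) \<le> 1" for i by (simp add: dir_def)
    have thb: "\<bar>th i x\<bar> \<le> z x ^ m" for i x
    proof -
      have "\<bar>th i x\<bar> \<le> cmod (dir i) * z x ^ m" using re_power_bound[of "dir i" m x] by (simp add: th_def z_def)
      also have "\<dots> \<le> 1 * z x ^ m" using dirb z by (intro mult_right_mono) auto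
      finally show ?thesis by simp
    qed
    have usm: "smooth u" and thsm: "smooth (th i)" for i by (simp_all add: u_def th_def smooth_re_power)
    have pu: "partial i u x = (real m + 1) * th i x" for i x
      by (simp add: u_def th_def partial_re_power re_power_def algebra_simps)
    have ptr: "(\<Sum>i\<in>UNIV. partial i (th i) x) = 0" for x
      unfolding th_def partial_re_power by (simp add: sum_3) (simp add: re_power_def)
    have xth: "(\<Sum>i\<in>UNIV. x $ i * th i x) = u x" for x
      unfolding th_def u_def by (rule sum_coord_re_power)
    have th2: "(\<Sum>i\<in>UNIV. (th i x)\<^sup>2) = z x ^ (2 * m)" for x
      unfolding th_def z_def by (rule sum_re_power_square)
    have ball_power: "z x ^ n \<le> R ^ (n - 2) * (norm x)\<^sup>2" if "2 \<le> n" "norm x < R" for n x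
    proof -
      have "z x ^ n \<le> norm x ^ n" using z by (intro power_mono) auto
      also have "norm x ^ n = norm x ^ (n - 2) * (norm x)\<^sup>2" using that(1) by (metis power_add le_add_diff_inverse2)
      also have "\<dots> \<le> R ^ (n - 2) * (norm x)\<^sup>2" using that by (intro mult_right_mono power_mono) auto
      finally show ?thesis .
    qed

    define d where "d = weak_div ?U (\<lambda>y. \<rho> (norm y) *\<^sub>R harm_grad m y)"
    have wp\<rho>: "has_weak_partial ?U i (\<lambda>x. \<rho> (norm x) * th j x)
       (\<lambda>x. (norm x * q (norm x)) * (x $ i / norm x) * th j x + \<rho> (norm x) * partial i (th j) x)" for i j
    proof (rule radial_times_smooth_has_weak_partial[where A="max \<rho>\<^sub>0 (R\<^sup>2 * D)" and c="R ^ (m - 2)"])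
      show "\<bar>th j x\<bar> \<le> R ^ (m - 2) * (norm x)\<^sup>2" if "norm x < R" for x
        using thb[of j x] ball_power[of m x] m that by linarith
      show "(\<rho> has_real_derivative r * q r) (at r)" if "0 < r" "r < R" for r
        using \<rho>'[OF that] by (simp add: q_def mult_ac)
      show "\<bar>\<rho> r\<bar> \<le> max \<rho>\<^sub>0 (R\<^sup>2 * D)" if "0 < r" "r < R" for r
        using \<rho>b[of r] that by auto
      show "\<bar>r * (r * q r)\<bar> \<le> max \<rho>\<^sub>0 (R\<^sup>2 * D)" if "0 < r" "r < R" for r
      proof -
        have "r\<^sup>2 * \<bar>q r\<bar> \<le> R\<^sup>2 * D" using qb[OF that] that by (intro mult_mono power_mono) auto
        then show ?thesis by (simp add: abs_mult power2_eq_square mult.assoc)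
      qed
    qed (use R in \<open>auto intro!: thsm continuous_intros qc\<close>)
    have dae: "AE x in ?B. d x = q (norm x) * u x"
    proof -
      have "AE x in ?B. \<forall>i\<in>UNIV. weak_partial ?U i (\<lambda>y. (\<rho> (norm y) *\<^sub>R harm_grad m y) $ i) x =
         (norm x * q (norm x)) * (x $ i / norm x) * th i x + \<rho> (norm x) * partial i (th i) x"
        using weak_partial_AE[OF open_ball wp\<rho>]
        by (intro AE_finite_allI finite) (simp add: harm_grad_component th_def)
      then show ?thesis using AE_ball_nonzero
      proof eventually_elim
        case (elim x)
        then have "d x = (\<Sum>i\<in>UNIV. (norm x * q (norm x)) * (x $ i / norm x) * th i x + \<rho> (norm x) * partial i (th i) x)"
          by (simp add: d_def weak_div_def)
        also have "\<dots> = (\<Sum>i\<in>UNIV. q (norm x) * (x $ i * th i x) + \<rho> (norm x) * partial i (th i) x)"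
          using elim by (intro sum.cong refl) simp
        also have "\<dots> = q (norm x) * (\<Sum>i\<in>UNIV. x $ i * th i x) + \<rho> (norm x) * (\<Sum>i\<in>UNIV. partial i (th i) x)"
          by (simp only: sum.distrib sum_distrib_left)
        finally show ?case by (simp add: xth ptr)
      qed
    qed

    \<comment> \<open>Both potentials are put into the form of finite measures with bounded Borel densities; the cut-offs
        in \<open>h1\<close> and \<open>h2\<close> change the densities only on null sets.\<close>
    define h1 where "h1 y = - (indicator (?U - {0}) y * (q (norm y) * u y))" for y
    have h1m: "h1 \<in> borel_measurable borel"
    proof -
      have "(\<lambda>y. indicator (?U - {0}) y *\<^sub>R (q (norm y) * u y)) \<in> borel_measurable borel"
        by (intro borel_measurable_continuous_on_indicator continuous_on_mult radc[OF qc] smooth_imp_continuous usm) auto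
      then have "(\<lambda>y. - (indicator (?U - {0}) y *\<^sub>R (q (norm y) * u y))) \<in> borel_measurable borel" by (rule borel_measurable_uminus)
      then show ?thesis by (simp add: h1_def[abs_def])
    qed
    have h1b: "\<bar>h1 y\<bar> \<le> D * R ^ Suc m" for y
    proof (cases "y \<in> ?U - {0}")
      case True
      have "z y ^ Suc m \<le> R ^ Suc m" using True z[of y] by (intro power_mono) auto
      then have "\<bar>q (norm y)\<bar> * \<bar>u y\<bar> \<le> D * R ^ Suc m"
        using ub[of y] True by (intro mult_mono qb D0) auto
      then show ?thesis using True by (simp add: h1_def abs_mult)
    qed (use D0 R in \<open>simp add: h1_def\<close>)
    have K: "newton_K R d x = (LINT y|\<mu>1. h1 y / norm (x - y))" for x
    proof -
      have ae: "AE y in ?B. - h1 y = d y"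
        using dae AE_ball_nonzero by eventually_elim (auto simp: h1_def)
      have h1B: "h1 \<in> borel_measurable ?B"
        by (intro measurable_restrict_space1 measurable_completion) (use h1m in simp)
      have dm: "d \<in> borel_measurable ?B"
        by (rule borel_measurable_lebesgue_on_AE[OF _ _ ae]) (use h1B in auto)
      have nm: "(\<lambda>y. norm (x - y)) \<in> borel_measurable ?B"
        by (intro measurable_restrict_space1 measurable_completion) simp
      have "(LINT y|?B. d y / norm (x - y)) = (LINT y|?B. - h1 y / norm (x - y))"
      proof (rule integral_cong_AE)
        show "AE y in ?B. d y / norm (x - y) = - h1 y / norm (x - y)"
          using ae by (rule AE_mp) (auto intro!: AE_I2)
      qed (use dm nm h1B in measurable)
      also have "\<dots> = (LINT y|lebesgue. indicator ?U y *\<^sub>R (- h1 y / norm (x - y)))"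
        by (rule integral_restrict_space) simp
      also have "\<dots> = (LINT y|lborel. indicator ?U y *\<^sub>R (- h1 y / norm (x - y)))"
      proof (rule integral_completion)
        have [measurable]: "?U \<in> sets borel" by simp
        note h1m [measurable]
        show "(\<lambda>y. indicator ?U y *\<^sub>R (- h1 y / norm (x - y))) \<in> borel_measurable lborel" by measurable
      qed
      also have "\<dots> = (LINT y|\<mu>1. - h1 y / norm (x - y))"
        unfolding \<mu>1_def
      proof (rule integral_density[symmetric])
        have [measurable]: "?U \<in> sets borel" by simp
        note h1m [measurable]
        show "(\<lambda>y. - h1 y / norm (x - y)) \<in> borel_measurable lborel" by measurable
        show "indicat_real ?U \<in> borel_measurable lborel" by measurable
      qed simp
      also have "\<dots> = - (LINT y|\<mu>1. h1 y / norm (x - y))" by simp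
      finally show ?thesis by (simp add: newton_K_def)
    qed
    define h2 where "h2 y = indicator (cball 0 R) y * (u y / R)" for y
    have um: "u \<in> borel_measurable borel" by (intro borel_measurable_continuous_onI smooth_imp_continuous usm)
    have h2m: "h2 \<in> borel_measurable borel"
      unfolding h2_def[abs_def] by (intro borel_measurable_times borel_measurable_indicator borel_measurable_divide um) auto
    have h2b: "\<bar>h2 y\<bar> \<le> R ^ m" for y
    proof (cases "y \<in> cball 0 R")
      case True
      have "z y ^ Suc m \<le> R ^ Suc m" using True z[of y] by (intro power_mono) auto
      then have "\<bar>u y\<bar> \<le> R ^ m * R" using ub[of y] by (simp add: mult.commute)
      then show ?thesis using True R by (simp add: h2_def abs_mult divide_le_eq)
    qed (use R in \<open>simp add: h2_def\<close>)
    have S: "surface_potential R (harm_grad m) x = (LINT y|\<mu>2. h2 y / norm (x - y))" for x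
      unfolding surface_potential_def \<mu>2_def
    proof (rule integral_cong_AE)
      have t: "AE y in sphere_measure R. \<forall>i\<in>UNIV. trace_on_sphere R (\<lambda>y. harm_grad m y $ i) y = th i y"
        using smooth_trace_on_sphere(1)[OF thsm R]
        by (intro AE_finite_allI finite) (simp add: harm_grad_component th_def)
      then show "AE y in sphere_measure R. ((\<chi> i. trace_on_sphere R (\<lambda>y. harm_grad m y $ i) y) \<bullet> (y /\<^sub>R R)) / norm (x - y) = h2 y / norm (x - y)"
        using AE_sphere_measure[of R]
      proof eventually_elim
        case (elim y)
        have "(\<chi> i. trace_on_sphere R (\<lambda>y. harm_grad m y $ i) y) \<bullet> (y /\<^sub>R R) = (\<Sum>i\<in>UNIV. y $ i * th i y) / R"
          using elim by (simp add: inner_vec_def divide_inverse sum_distrib_left mult_ac)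
        then show ?case using elim R by (simp add: xth h2_def)
      qed
      have "(\<lambda>y. trace_on_sphere R (\<lambda>y. harm_grad m y $ i) y) \<in> borel_measurable borel" for i
        using smooth_trace_on_sphere(2)[OF thsm R, of i] by (simp add: harm_grad_component th_def)
      moreover have "(\<lambda>y::vec3. y $ i) \<in> borel_measurable borel" for i
        by (intro borel_measurable_continuous_onI continuous_intros)
      ultimately have "(\<lambda>y. (\<Sum>i\<in>UNIV. trace_on_sphere R (\<lambda>y. harm_grad m y $ i) y * (y $ i / R)) / norm (x - y)) \<in> borel_measurable borel"
        by measurable
      then show "(\<lambda>y. ((\<chi> i. trace_on_sphere R (\<lambda>y. harm_grad m y $ i) y) \<bullet> (y /\<^sub>R R)) / norm (x - y)) \<in> borel_measurable (sphere_measure R)"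
        by (simp add: inner_vec_def divide_inverse mult_ac cong: measurable_cong_sets)
      have "(\<lambda>y. h2 y / norm (x - y)) \<in> borel_measurable borel" using h2m by measurable
      then show "(\<lambda>y. h2 y / norm (x - y)) \<in> borel_measurable (sphere_measure R)"
        by (simp cong: measurable_cong_sets)
    qed
    obtain W1 where W1: "\<And>i. has_weak_partial ?U i (\<lambda>x. LINT y|\<mu>1. h1 y / norm (x - y)) (W1 i)"
        "\<And>i. integrable ?B (W1 i)" "\<And>i. (LINT x|?B. \<bar>W1 i x\<bar>) \<le> D * R ^ Suc m * C * measure \<mu>1 UNIV"
      using potential_has_weak_partial[OF \<mu>1 h1m h1b C] by blast
    obtain W2 where W2: "\<And>i. has_weak_partial ?U i (\<lambda>x. LINT y|\<mu>2. h2 y / norm (x - y)) (W2 i)"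
        "\<And>i. integrable ?B (W2 i)" "\<And>i. (LINT x|?B. \<bar>W2 i x\<bar>) \<le> R ^ m * C * measure \<mu>2 UNIV"
      using potential_has_weak_partial[OF \<mu>2 h2m h2b C] by blast

    \<comment> \<open>\<open>g\<close> is the gradient of \<open>- 4 \<pi> M u\<close>, written out by \<open>r M' = \<rho> - 3 M\<close>.\<close>
    define g where "g i x = - (4 * pi * ((\<rho> (norm x) - 3 * M (norm x)) / norm x)) * (x $ i / norm x) * u x
       + - (4 * pi * M (norm x)) * partial i u x" for i x
    have wpM: "has_weak_partial ?U i (\<lambda>x. - (4 * pi * M (norm x)) * u x) (g i)" for i
      unfolding g_def[abs_def]
    proof (rule radial_times_smooth_has_weak_partial[where A="4 * pi * \<rho>\<^sub>0" and c="R ^ (m - 1)"])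
      show "\<bar>u x\<bar> \<le> R ^ (m - 1) * (norm x)\<^sup>2" if "norm x < R" for x
        using ub[of x] ball_power[of "Suc m" x] m that by simp
      show "((\<lambda>r. - (4 * pi * M r)) has_real_derivative - (4 * pi * ((\<rho> r - 3 * M r) / r))) (at r)"
        if "0 < r" "r < R" for r
        by (intro DERIV_minus DERIV_cmult M' that)
      show "continuous_on {0<..<R} (\<lambda>r. - (4 * pi * ((\<rho> r - 3 * M r) / r)))"
        by (intro continuous_intros Mc \<rho>c') auto
      show "\<bar>- (4 * pi * M r)\<bar> \<le> 4 * pi * \<rho>\<^sub>0" if "0 < r" "r < R" for r
        using Mb[OF that] \<rho>0 by (simp add: abs_mult)
      show "\<bar>r * - (4 * pi * ((\<rho> r - 3 * M r) / r))\<bar> \<le> 4 * pi * \<rho>\<^sub>0" if "0 < r" "r < R" for r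
      proof -
        have "\<bar>\<rho> r - 3 * M r\<bar> \<le> \<rho>\<^sub>0" using Mb[OF that] \<rho>b[of r] that by auto
        then show ?thesis using that by (simp add: abs_mult)
      qed
    qed (use R in \<open>auto intro!: usm\<close>)
    have local_ae: "AE x in ?B. \<gamma> * \<rho> (norm x) powr (\<gamma> - 2) * d x = - (4 * pi * M (norm x)) * u x"
      using dae AE_ball_nonzero
    proof eventually_elim
      case (elim x)
      have "\<rho> (norm x) powr (\<gamma> - 2) * \<rho> (norm x) powr (2 - \<gamma>) = 1"
        using \<rho>b[of "norm x"] elim by (simp flip: powr_add)
      then have "\<gamma> * \<rho> (norm x) powr (\<gamma> - 2) * q (norm x) = - (4 * pi * M (norm x))"
        using \<gamma> by (simp add: q_def mult_ac)
      then show ?case using elim by (simp add: mult.assoc[symmetric])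
    qed

    define \<Phi> where "\<Phi> = (\<lambda>y. \<gamma> * \<rho> (norm y) powr (\<gamma> - 2) * d y + newton_K R d y + surface_potential R (harm_grad m) y)"
    have "AE x in ?B. weak_partial ?U i \<Phi> x = g i x + W1 i x + W2 i x" for i
    proof (rule weak_partial_AE[OF open_ball], rule has_weak_partial_cong_AE[OF open_ball])
      show "has_weak_partial ?U i (\<lambda>x. (- (4 * pi * M (norm x)) * u x + (LINT y|\<mu>1. h1 y / norm (x - y))) + (LINT y|\<mu>2. h2 y / norm (x - y)))
         (\<lambda>x. (g i x + W1 i x) + W2 i x)"
        by (intro has_weak_partial_add open_ball wpM W1 W2)
      show "AE x in ?B. (- (4 * pi * M (norm x)) * u x + (LINT y|\<mu>1. h1 y / norm (x - y))) + (LINT y|\<mu>2. h2 y / norm (x - y)) = \<Phi> x"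
        using local_ae by (rule AE_mp) (auto intro!: AE_I2 simp: \<Phi>_def K S)
    qed simp
    then have grad_ae: "AE x in ?B. \<forall>i\<in>UNIV. weak_partial ?U i \<Phi> x = g i x + W1 i x + W2 i x"
      by (intro AE_finite_allI finite)
    have lin: "lin_op \<gamma> R \<rho> (harm_grad m) x = - (\<chi> i. weak_partial ?U i \<Phi> x)" for x
      by (simp add: lin_op_def Let_def weak_grad_def d_def[symmetric] \<Phi>_def)

    \<comment> \<open>The factors \<open>\<bar>\<rho> - 3 M\<bar>\<close> and \<open>M\<close> are at most \<open>\<rho>\<^sub>0\<close>, and \<open>\<bar>u\<bar> \<le> \<bar>x\<bar> \<bar>\<theta>\<bar>\<close> absorbs the singular factor
        \<open>1 / \<bar>x\<bar>\<^sup>2\<close>.\<close>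
    define bnd where "bnd x = 4 * pi * \<rho>\<^sub>0\<^sup>2 * (real m + 2) * z x ^ (2 * m) + \<rho>\<^sub>0 * R ^ m * (\<Sum>i\<in>UNIV. \<bar>W1 i x\<bar> + \<bar>W2 i x\<bar>)" for x
    have pt: "AE x in ?B. \<rho> (norm x) * (lin_op \<gamma> R \<rho> (harm_grad m) x \<bullet> harm_grad m x) \<le> bnd x"
      using grad_ae AE_ball_nonzero
    proof eventually_elim
      case (elim x)
      let ?r = "norm x"
      have r: "0 < ?r" "?r < R" using elim by auto
      have Mr: "0 \<le> M ?r" "M ?r \<le> \<rho>\<^sub>0" "\<bar>\<rho> ?r - 3 * M ?r\<bar> \<le> \<rho>\<^sub>0" and \<rho>r: "0 < \<rho> ?r" "\<rho> ?r \<le> \<rho>\<^sub>0"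
        using Mb[OF r] \<rho>b[of ?r] r by auto
      have "lin_op \<gamma> R \<rho> (harm_grad m) x \<bullet> harm_grad m x = - (\<Sum>i\<in>UNIV. (g i x + W1 i x + W2 i x) * th i x)"
        using elim by (simp add: lin inner_vec_def harm_grad_component th_def sum_negf[symmetric] algebra_simps)
      also have "\<dots> = - (\<Sum>i\<in>UNIV. g i x * th i x) + (\<Sum>i\<in>UNIV. - (W1 i x + W2 i x) * th i x)"
        by (simp add: algebra_simps sum.distrib sum_negf sum_subtractf)
      also have "(\<Sum>i\<in>UNIV. g i x * th i x) =
          - (4 * pi * ((\<rho> ?r - 3 * M ?r) / ?r\<^sup>2)) * u x * (\<Sum>i\<in>UNIV. x $ i * th i x)
          + - (4 * pi * M ?r) * (real m + 1) * (\<Sum>i\<in>UNIV. (th i x)\<^sup>2)"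
        unfolding sum_distrib_left sum.distrib[symmetric]
        by (intro sum.cong refl) (simp add: g_def pu power2_eq_square divide_inverse algebra_simps)
      also have "- \<dots> = 4 * pi * (((\<rho> ?r - 3 * M ?r) * ((u x)\<^sup>2 / ?r\<^sup>2)) + M ?r * ((real m + 1) * z x ^ (2 * m)))"
        unfolding xth th2 by (simp add: power2_eq_square algebra_simps)
      also have "\<dots> \<le> 4 * pi * (\<rho>\<^sub>0 * z x ^ (2 * m) + \<rho>\<^sub>0 * ((real m + 1) * z x ^ (2 * m)))"
      proof (intro mult_left_mono add_mono)
        have "\<bar>u x\<bar> \<le> z x ^ m * ?r"
          using ub[of x] mult_left_mono[OF z(2)[of x], of "z x ^ m"] z(1)[of x] by (simp add: mult.commute)
        then have "\<bar>u x\<bar>\<^sup>2 \<le> (z x ^ m * ?r)\<^sup>2" by (intro power_mono) auto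
        then have "(u x)\<^sup>2 / ?r\<^sup>2 \<le> z x ^ (2 * m)"
          using r by (simp add: divide_le_eq power_mult_distrib power_mult mult.commute flip: power_mult)
        then have "\<bar>\<rho> ?r - 3 * M ?r\<bar> * ((u x)\<^sup>2 / ?r\<^sup>2) \<le> \<rho>\<^sub>0 * z x ^ (2 * m)"
          using Mr \<rho>0 by (intro mult_mono) auto
        moreover have "(\<rho> ?r - 3 * M ?r) * ((u x)\<^sup>2 / ?r\<^sup>2) \<le> \<bar>\<rho> ?r - 3 * M ?r\<bar> * ((u x)\<^sup>2 / ?r\<^sup>2)"
          by (intro mult_right_mono) auto
        ultimately show "(\<rho> ?r - 3 * M ?r) * ((u x)\<^sup>2 / ?r\<^sup>2) \<le> \<rho>\<^sub>0 * z x ^ (2 * m)" by linarith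
        show "M ?r * ((real m + 1) * z x ^ (2 * m)) \<le> \<rho>\<^sub>0 * ((real m + 1) * z x ^ (2 * m))"
          using Mr z(1) by (intro mult_right_mono) auto
      qed simp
      also have "4 * pi * (\<rho>\<^sub>0 * z x ^ (2 * m) + \<rho>\<^sub>0 * ((real m + 1) * z x ^ (2 * m))) = 4 * pi * \<rho>\<^sub>0 * (real m + 2) * z x ^ (2 * m)"
        by (simp add: algebra_simps)
      finally have 1: "lin_op \<gamma> R \<rho> (harm_grad m) x \<bullet> harm_grad m x \<le>
         4 * pi * \<rho>\<^sub>0 * (real m + 2) * z x ^ (2 * m) + (\<Sum>i\<in>UNIV. - (W1 i x + W2 i x) * th i x)" by simp
      have "(\<Sum>i\<in>UNIV. - (W1 i x + W2 i x) * th i x) \<le> (\<Sum>i\<in>UNIV. (\<bar>W1 i x\<bar> + \<bar>W2 i x\<bar>) * R ^ m)"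
      proof (rule sum_mono)
        fix i :: 3
        have "\<bar>th i x\<bar> \<le> R ^ m" using thb[of i x] power_mono[of "z x" R m] z[of x] r by linarith
        then have "\<bar>- (W1 i x + W2 i x)\<bar> * \<bar>th i x\<bar> \<le> (\<bar>W1 i x\<bar> + \<bar>W2 i x\<bar>) * R ^ m"
          by (intro mult_mono) auto
        then show "- (W1 i x + W2 i x) * th i x \<le> (\<bar>W1 i x\<bar> + \<bar>W2 i x\<bar>) * R ^ m"
          using abs_ge_self[of "- (W1 i x + W2 i x) * th i x"] unfolding abs_mult by linarith
      qed
      also have "\<dots> = R ^ m * (\<Sum>i\<in>UNIV. \<bar>W1 i x\<bar> + \<bar>W2 i x\<bar>)" by (simp add: sum_distrib_left mult.commute)
      finally have 2: "lin_op \<gamma> R \<rho> (harm_grad m) x \<bullet> harm_grad m x \<le>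
         4 * pi * \<rho>\<^sub>0 * (real m + 2) * z x ^ (2 * m) + R ^ m * (\<Sum>i\<in>UNIV. \<bar>W1 i x\<bar> + \<bar>W2 i x\<bar>)" (is "_ \<le> ?E")
        using 1 by linarith
      have "0 \<le> ?E" using \<rho>0 z(1)[of x] R by (intro add_nonneg_nonneg mult_nonneg_nonneg sum_nonneg) auto
      then have "\<rho> ?r * (lin_op \<gamma> R \<rho> (harm_grad m) x \<bullet> harm_grad m x) \<le> \<rho>\<^sub>0 * ?E"
        using mult_left_mono[OF 2, of "\<rho> ?r"] mult_right_mono[OF \<rho>r(2), of ?E] \<rho>r(1) by linarith
      then show ?case by (simp add: bnd_def algebra_simps power2_eq_square)
    qed
    have zi: "integrable ?B (\<lambda>x. z x ^ k)" for k unfolding z_def by (rule planar_power_integrable)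
    have Wi: "integrable ?B (\<lambda>x. \<bar>W1 i x\<bar>)" "integrable ?B (\<lambda>x. \<bar>W2 i x\<bar>)" for i
      using W1(2) W2(2) by auto
    have "weighted_inner R \<rho> (lin_op \<gamma> R \<rho> (harm_grad m)) (harm_grad m) \<le> (LINT x|?B. bnd x)"
      unfolding weighted_inner_def
    proof (rule LINT_le_bound[OF _ pt])
      show "integrable ?B bnd" unfolding bnd_def[abs_def] using zi Wi by auto
      show "AE x in ?B. 0 \<le> bnd x"
        using \<rho>0 R z(1) by (intro AE_I2) (auto simp: bnd_def intro!: add_nonneg_nonneg mult_nonneg_nonneg sum_nonneg)
    qed
    also have "(LINT x|?B. bnd x) = 4 * pi * \<rho>\<^sub>0\<^sup>2 * (real m + 2) * (LINT x|?B. z x ^ (2 * m)) +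
        \<rho>\<^sub>0 * R ^ m * (\<Sum>i\<in>UNIV. (LINT x|?B. \<bar>W1 i x\<bar>) + (LINT x|?B. \<bar>W2 i x\<bar>))"
      unfolding bnd_def using zi Wi by simp
    also have "\<dots> \<le> 4 * pi * \<rho>\<^sub>0\<^sup>2 * (real m + 2) * (R\<^sup>2 * planar_moment R (m - 1)) +
        \<rho>\<^sub>0 * R ^ m * (\<Sum>i\<in>(UNIV::3 set). D * R ^ Suc m * C * measure \<mu>1 UNIV + R ^ m * C * measure \<mu>2 UNIV)"
    proof (intro add_mono mult_left_mono sum_mono W1 W2)
      have "(LINT x|?B. z x ^ (2 * m)) \<le> (LINT x|?B. R\<^sup>2 * z x ^ (2 * (m - 1)))"
      proof (rule integral_mono)
        fix x assume "x \<in> space ?B"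
        then have "z x \<le> R" using z(2)[of x] by simp
        then have "(z x)\<^sup>2 * z x ^ (2 * (m - 1)) \<le> R\<^sup>2 * z x ^ (2 * (m - 1))"
          using z(1)[of x] by (intro mult_right_mono power_mono) auto
        moreover have "2 * m = 2 + 2 * (m - 1)" using m by simp
        ultimately show "z x ^ (2 * m) \<le> R\<^sup>2 * z x ^ (2 * (m - 1))" by (metis power_add)
      qed (use zi in auto)
      then show "(LINT x|?B. z x ^ (2 * m)) \<le> R\<^sup>2 * planar_moment R (m - 1)"
        by (simp add: planar_moment_def z_def)
    qed (use \<rho>0 R in auto)
    also have "\<dots> = a * (real m + 2) * planar_moment R (m - 1) + b * R ^ (2 * m)"
    proof -
      have "R ^ (2 * m) = R ^ m * R ^ m" by (simp add: mult_2 power_add)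
      then show ?thesis by (simp add: a_def b_def algebra_simps)
    qed
    finally show ?thesis .
  qed
  show ?thesis
  proof (rule that[of a b])
    show "a \<ge> 0" by (simp add: a_def)
    show "b \<ge> 0" using \<rho>0 D0 R C(1) by (simp add: b_def)
    show "harm_grad m \<in> admissible R \<rho>" if "odd m" for m by (rule harm_grad_admissible[OF that \<rho>c])
    show "weighted_inner R \<rho> (lin_op \<gamma> R \<rho> (harm_grad m)) (harm_grad m) \<le>
        a * (real m + 2) * planar_moment R (m - 1) + b * R ^ (2 * m)" if "3 \<le> m" for m
      by (rule main[OF that])
  qed
qed

text \<open>Along \<open>harm_grad m\<close> the square norm of the gradient is \<open>2 m\<^sup>2\<close> times the moment, while the form is at
  most of order \<open>m\<close> times the moment plus \<open>R ^ (2 m)\<close>, and \<open>R ^ (2 m)\<close> is of order at most \<open>m ^ (3/2)\<close> times the moment.\<close>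

theorem liquid_lane_emden_not_coercive:
  assumes le: "liquid_lane_emden \<gamma> \<rho>\<^sub>0 R \<rho>" and \<gamma>: "1 \<le> \<gamma>" "\<gamma> \<le> 2"
  shows "\<not> coercive \<gamma> R \<rho>"
proof
  assume "coercive \<gamma> R \<rho>"
  then obtain c where c: "c > 0" "\<And>\<theta>. \<theta> \<in> admissible R \<rho> \<Longrightarrow>
      weighted_inner R \<rho> (lin_op \<gamma> R \<rho> \<theta>) \<theta> \<ge> c * grad_norm_sq (ball 0 R) \<theta>"
    unfolding coercive_def by blast
  have R: "R > 0" using le by (simp add: liquid_lane_emden_def)
  obtain a b where ab: "a \<ge> 0" "b \<ge> 0" and adm: "\<And>m. odd m \<Longrightarrow> 3 \<le> m \<Longrightarrow> harm_grad m \<in> admissible R \<rho>"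
    and up: "\<And>m. odd m \<Longrightarrow> 3 \<le> m \<Longrightarrow> weighted_inner R \<rho> (lin_op \<gamma> R \<rho> (harm_grad m)) (harm_grad m) \<le>
        a * (real m + 2) * planar_moment R (m - 1) + b * R ^ (2 * m)"
    using harm_grad_form_bound[OF le \<gamma>] by blast
  obtain k where k: "k > 0" "\<And>m. m \<ge> 2 \<Longrightarrow> (real m)\<^sup>2 * planar_moment R (m - 1) \<ge> k * R ^ (2 * m) * sqrt (real m)"
    using planar_moment_lower_bound[OF R] by blast
  obtain n :: nat where n: "real n \<ge> max (2 * a / c) ((b / (c * k))\<^sup>2)" using real_arch_simple by blast
  define m where "m = 2 * n + 3"
  have m: "odd m" "3 \<le> m" "2 \<le> m" by (auto simp: m_def)
  have m1: "2 * a / c \<le> real m" "(b / (c * k))\<^sup>2 < real m" using n by (auto simp: m_def)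
  let ?I = "planar_moment R (m - 1)"
  have I: "?I \<ge> 0" unfolding planar_moment_def by (intro integral_nonneg_AE) auto
  have "c * (2 * (real m)\<^sup>2 * ?I) \<le> a * (real m + 2) * ?I + b * R ^ (2 * m)"
    using c(2)[OF adm[OF m(1,2)]] up[OF m(1,2)] by (simp add: grad_norm_sq_harm_grad)
  moreover have "a * (real m + 2) * ?I \<le> c * (real m)\<^sup>2 * ?I"
  proof (rule mult_right_mono[OF _ I])
    have "a * (real m + 2) \<le> a * (2 * real m)" using ab m by (intro mult_left_mono) auto
    also have "\<dots> = (2 * a / c) * (c * real m)" using c by simp
    also have "\<dots> \<le> real m * (c * real m)" using m1 c by (intro mult_right_mono) auto
    finally show "a * (real m + 2) \<le> c * (real m)\<^sup>2" by (simp add: power2_eq_square mult_ac)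
  qed
  ultimately have "c * ((real m)\<^sup>2 * ?I) \<le> b * R ^ (2 * m)" by (simp add: algebra_simps)
  moreover have "c * (k * R ^ (2 * m) * sqrt (real m)) \<le> c * ((real m)\<^sup>2 * ?I)"
    using k(2)[OF m(3)] c by (intro mult_left_mono) auto
  ultimately have "(c * k * sqrt (real m)) * R ^ (2 * m) \<le> b * R ^ (2 * m)" by (simp add: mult_ac)
  then have "c * k * sqrt (real m) \<le> b" using R by (simp add: mult_le_cancel_right)
  then have "sqrt (real m) \<le> b / (c * k)" using c k by (simp add: field_simps)
  then have "(sqrt (real m))\<^sup>2 \<le> (b / (c * k))\<^sup>2" by (intro power_mono) auto
  then show False using m1 by simp
qed

theorem proposition2p7:
  fixes \<gamma> :: real
  assumes "1 \<le> \<gamma>" and "\<gamma> \<le> 2"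
  shows "(\<gamma> \<ge> 4/3 \<longrightarrow>
            (\<forall>\<rho>\<^sub>0 R \<rho>. 1 < \<rho>\<^sub>0 \<and> liquid_lane_emden \<gamma> \<rho>\<^sub>0 R \<rho> \<longrightarrow> \<not> coercive \<gamma> R \<rho>)) \<and>
         (\<gamma> < 4/3 \<longrightarrow>
            (\<exists>\<epsilon>>0. \<forall>\<rho>\<^sub>0 R \<rho>. 1 < \<rho>\<^sub>0 \<and> \<rho>\<^sub>0 < 1 + \<epsilon> \<and> liquid_lane_emden \<gamma> \<rho>\<^sub>0 R \<rho> \<longrightarrow>
               \<not> coercive \<gamma> R \<rho>))"
  using liquid_lane_emden_not_coercive[OF _ assms] by (blast intro: zero_less_one)

end
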